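(* Let $\mathbf{I}=\mathbf{cup}$ or $\mathbf{I}=\mathbf{cat}$. For the $2$-torus $\mathbb{T}^2$ and the wedge sum space $\mathbb{S}^1\vee\mathbb{S}^2\vee\mathbb{S}^1$, $$\frac{\pi}{3}=d_{\mathrm{E}}\left(\mathbf{I}(\mathrm{VR}_\bullet(\mathbb{T}^2)),\mathbf{I}(\mathrm{VR}_\bullet(\mathbb{S}^1\vee\mathbb{S}^2\vee\mathbb{S}^1))\right)\leq 2\cdot d_{\mathrm{GH}}\left(\mathbb{T}^2,\mathbb{S}^1\vee\mathbb{S}^2\vee\mathbb{S}^1\right).$$
   Context: $\mathbb{S}^1$ is the unit circle (radius $1$) with geodesic metric; $\mathbb{S}^2$ is the unit $2$-sphere with geodesic metric; $\mathbb{T}^2=\mathbb{S}^1\times\mathbb{S}^1$ has the $\ell_\infty$-product metric. The wedge sum of pointed metric spaces $(X,x_0),(Y,y_0)$ carries the gluing metric: $d_{X\vee Y}(x,y)=d_X(x,x_0)+d_Y(y,y_0)$ for $x\in X,y\in Y$, restricting to $d_X$ on $X$ and $d_Y$ on $Y$. $\mathrm{VR}_t(X)$ is the geometric realization of the simplicial complex of finite nonempty subsets of $X$ of diameter at most $t$ (empty for $t<0$), with inclusions as transition maps. For a persistent space $X_\bullet$ (functor from $(\mathbb{R},\leq)$ to compactly generated weak Hausdorff spaces) with transition maps $f_a^b$, and $[a,b]\in\mathrm{Int}$ (the set of closed intervals with $a\leq b$ in $\mathbb{R}$): $\mathbf{cup}(X_\bullet)([a,b])$ is the length of the graded ring $\mathrm{im}(\mathbf{H}^*(X_b)\to\mathbf{H}^*(X_a))$,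 cohomology over a fixed field $K$, where the length of a graded ring is the largest $\ell\geq0$ such that some product of $\ell$ homogeneous positive-degree elements is nonzero ($0$ if there are no nonzero positive-degree elements, $\infty$ if no largest exists); $\mathbf{cat}(X_\bullet)([a,b])=\mathbf{cat}(f_a^b)$, where for $f:X\to Y$, $\mathbf{cat}(f)$ is the least $n\in\mathbb{N}$ (or $+\infty$) such that $X$ is covered by open sets $U_1,\dots,U_{n+1}$ with each $f|_{U_i}$ homotopic to a constant map to $Y$ (maps from the empty set count as null-homotopic). Erosion distance: $\mathbf{J}_1,\mathbf{J}_2$ on $\mathrm{Int}$ are $\epsilon$-eroded if $\mathbf{J}_1([a,b])\geq\mathbf{J}_2([a-\epsilon,b+\epsilon])$ and $\mathbf{J}_2([a,b])\geq\mathbf{J}_1([a-\epsilon,b+\epsilon])$ for all $[a,b]$; $d_{\mathrm{E}}(\mathbf{J}_1,\mathbf{J}_2)$ is the infimum of such $\epsilon\geq0$. $d_{\mathrm{GH}}$ is the Gromov-Hausdorff distance. *)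

theory Defs
  imports
    "HOL-Analysis.Analysis"
    "HOL-Homology.Homology"
    "HOL-Algebra.QuotRing"
    "HOL-Library.Extended_Nat"
    "HOL-Library.Extended_Nonnegative_Real"
begin

section \<open>Metric spaces\<close>

subsection \<open>Unit spheres\<close>

lemma arccos_inner_triangle:
  fixes x y z :: "'a::real_inner"
  assumes "norm x = 1" "norm y = 1" "norm z = 1"
  shows "arccos (x \<bullet> z) \<le> arccos (x \<bullet> y) + arccos (y \<bullet> z)"
proof -
  define a b c where "a = x \<bullet> y" and "b = y \<bullet> z" and "c = x \<bullet> z"
  have xx: "x \<bullet> x = 1" "y \<bullet> y = 1" "z \<bullet> z = 1"
    using assms by (simp_all add: dot_square_norm)
  have bd: "\<bar>a\<bar> \<le> 1" "\<bar>b\<bar> \<le> 1" "\<bar>c\<bar> \<le> 1"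
    unfolding a_def b_def c_def using Cauchy_Schwarz_ineq2 assms by (metis mult_1)+
  have "((x - a *\<^sub>R y) \<bullet> (z - b *\<^sub>R y))\<^sup>2 \<le>
        ((x - a *\<^sub>R y) \<bullet> (x - a *\<^sub>R y)) * ((z - b *\<^sub>R y) \<bullet> (z - b *\<^sub>R y))"
    by (rule Cauchy_Schwarz_ineq)
  also have "(x - a *\<^sub>R y) \<bullet> (z - b *\<^sub>R y) = c - a * b"
    by (simp add: a_def b_def c_def xx inner_diff_left inner_diff_right inner_commute)
  also have "(x - a *\<^sub>R y) \<bullet> (x - a *\<^sub>R y) = 1 - a\<^sup>2"
    by (simp add: a_def xx inner_diff_left inner_diff_right inner_commute power2_eq_square)
  also have "(z - b *\<^sub>R y) \<bullet> (z - b *\<^sub>R y) = 1 - b\<^sup>2"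
    by (simp add: b_def xx inner_diff_left inner_diff_right inner_commute power2_eq_square)
  finally have "\<bar>c - a * b\<bar> \<le> sqrt ((1 - a\<^sup>2) * (1 - b\<^sup>2))"
    using real_le_rsqrt by (metis power2_abs)
  then have "a * b - sqrt (1 - a\<^sup>2) * sqrt (1 - b\<^sup>2) \<le> c"
    by (simp add: real_sqrt_mult)
  moreover have "cos (arccos a + arccos b) = a * b - sqrt (1 - a\<^sup>2) * sqrt (1 - b\<^sup>2)"
    using bd by (simp add: cos_add sin_arccos_abs)
  ultimately have le: "cos (arccos a + arccos b) \<le> cos (arccos c)"
    using bd by (simp add: cos_arccos_abs)
  have "0 \<le> arccos a" "0 \<le> arccos b" "0 \<le> arccos c" "arccos c \<le> pi"
    using bd by (auto intro!: arccos_lbound arccos_ubound simp: abs_le_iff)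
  then have "arccos c \<le> arccos a + arccos b"
    using le by (cases "arccos a + arccos b \<le> pi") (auto simp: cos_mono_le_eq)
  then show ?thesis by (simp add: a_def b_def c_def)
qed

text \<open>The geodesic (great circle) distance on the unit sphere is the angle in
  \<open>[0, \<pi>]\<close> between two unit vectors. Elements of \<^typ>\<open>'a metric\<close> need a distance that is
  nonnegative and symmetric everywhere, whence the guard.\<close>

definition sphere_metric :: "'a::real_inner metric" where
  "sphere_metric =
     metric (sphere 0 1, \<lambda>x y. if norm x = 1 \<and> norm y = 1 then arccos (x \<bullet> y) else 0)"

lemma Metric_space_sphere:
  "Metric_space (sphere 0 1 :: 'a::real_inner set)
     (\<lambda>x y. if norm x = 1 \<and> norm y = 1 then arccos (x \<bullet> y) else 0)"
proof
  fix x y z :: 'a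
  have bd: "-1 \<le> x \<bullet> y \<and> x \<bullet> y \<le> 1" if "norm x = 1" "norm y = 1"
    using Cauchy_Schwarz_ineq2[of x y] that by auto
  show "0 \<le> (if norm x = 1 \<and> norm y = 1 then arccos (x \<bullet> y) else 0)"
    using bd by (auto intro: arccos_lbound)
  show "(if norm x = 1 \<and> norm y = 1 then arccos (x \<bullet> y) else 0) =
        (if norm y = 1 \<and> norm x = 1 then arccos (y \<bullet> x) else 0)"
    by (simp add: inner_commute)
  show "((if norm x = 1 \<and> norm y = 1 then arccos (x \<bullet> y) else 0) = 0) = (x = y)"
    if "x \<in> sphere 0 1" "y \<in> sphere 0 1"
  proof -
    have "arccos (x \<bullet> y) = 0 \<longleftrightarrow> x \<bullet> y = 1"
      using bd that by (metis arccos_1 cos_arccos cos_zero dist_0_norm mem_sphere)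
    also have "\<dots> \<longleftrightarrow> x = y"
    proof
      assume "x \<bullet> y = 1"
      moreover have "x \<bullet> x = 1" "y \<bullet> y = 1"
        using that by (simp_all add: dot_square_norm)
      ultimately have "(x - y) \<bullet> (x - y) = 0"
        by (simp add: inner_diff_left inner_diff_right inner_commute)
      then show "x = y" by simp
    qed (use that in \<open>simp add: dot_square_norm\<close>)
    finally show ?thesis using that by simp
  qed
  show "(if norm x = 1 \<and> norm z = 1 then arccos (x \<bullet> z) else 0)
     \<le> (if norm x = 1 \<and> norm y = 1 then arccos (x \<bullet> y) else 0)
      + (if norm y = 1 \<and> norm z = 1 then arccos (y \<bullet> z) else 0)"
    if "x \<in> sphere 0 1" "y \<in> sphere 0 1" "z \<in> sphere 0 1"
    using that arccos_inner_triangle[of x y z] by simp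
qed

lemma mspace_sphere_metric [simp]: "mspace sphere_metric = sphere 0 1"
  unfolding sphere_metric_def by (rule Metric_space.mspace_metric[OF Metric_space_sphere])

lemma mdist_sphere_metric:
  "norm x = 1 \<Longrightarrow> norm y = 1 \<Longrightarrow> mdist sphere_metric x y = arccos (x \<bullet> y)"
  unfolding sphere_metric_def by (simp add: Metric_space.mdist_metric[OF Metric_space_sphere])


subsection \<open>The \<open>\<ell>\<^sub>\<infinity>\<close>-product\<close>

definition linf_metric :: "'a metric \<Rightarrow> 'b metric \<Rightarrow> ('a \<times> 'b) metric" where
  "linf_metric m1 m2 =
     metric (mspace m1 \<times> mspace m2,
             \<lambda>(x, y) (x', y'). max (mdist m1 x x') (mdist m2 y y'))"

lemma Metric_space_linf:
  "Metric_space (mspace m1 \<times> mspace m2)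
     (\<lambda>(x, y) (x', y'). max (mdist m1 x x') (mdist m2 y y'))"
proof (unfold_locales, goal_cases)
  case (3 u v)
  then show ?case
    by (auto simp: max_def) (metis mdist_nonneg mdist_zero order_antisym_conv)+
next
  case (4 u v w)
  then obtain a b c a' b' c'
    where *: "u = (a, a')" "v = (b, b')" "w = (c, c')"
      "{a, b, c} \<subseteq> mspace m1" "{a', b', c'} \<subseteq> mspace m2" by auto
  then have "mdist m1 a c \<le> mdist m1 a b + mdist m1 b c"
    "mdist m2 a' c' \<le> mdist m2 a' b' + mdist m2 b' c'" by (auto intro: mdist_triangle)
  then show ?case by (auto simp: * max_def)
qed (auto simp: mdist_commute le_max_iff_disj)

lemma mspace_linf_metric [simp]: "mspace (linf_metric m1 m2) = mspace m1 \<times> mspace m2"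
  unfolding linf_metric_def by (rule Metric_space.mspace_metric[OF Metric_space_linf])

lemma mdist_linf_metric [simp]:
  "mdist (linf_metric m1 m2) (x, y) (x', y') = max (mdist m1 x x') (mdist m2 y y')"
  unfolding linf_metric_def by (simp add: Metric_space.mdist_metric[OF Metric_space_linf])


subsection \<open>Wedge sums\<close>

text \<open>The wedge sum of \<open>(m1, x0)\<close> and \<open>(m2, y0)\<close> is carried by the union of the two coordinate
  axes through \<open>(x0, y0)\<close>, which is also its base point; \<open>x\<close> in the first space becomes \<open>(x, y0)\<close>
  and \<open>y\<close> in the second becomes \<open>(x0, y)\<close>. On this set the gluing metric is the sum of the
  coordinate distances, as the three lemmas \<open>mdist_wedge\<close> below show.\<close>

definition wedge_metric :: "'a metric \<Rightarrow> 'a \<Rightarrow> 'b metric \<Rightarrow> 'b \<Rightarrow> ('a \<times> 'b) metric" where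
  "wedge_metric m1 x0 m2 y0 =
     metric (mspace m1 \<times> {y0} \<union> {x0} \<times> mspace m2,
             \<lambda>(x, y) (x', y'). mdist m1 x x' + mdist m2 y y')"

lemma Metric_space_wedge:
  assumes "x0 \<in> mspace m1" "y0 \<in> mspace m2"
  shows "Metric_space (mspace m1 \<times> {y0} \<union> {x0} \<times> mspace m2)
           (\<lambda>(x, y) (x', y'). mdist m1 x x' + mdist m2 y y')"
proof (unfold_locales, goal_cases)
  case (3 u v)
  then show ?case using assms by (auto simp: add_nonneg_eq_0_iff)
next
  case (4 u v w)
  then obtain a b c a' b' c'
    where *: "u = (a, a')" "v = (b, b')" "w = (c, c')"
      "{a, b, c} \<subseteq> mspace m1" "{a', b', c'} \<subseteq> mspace m2" using assms by auto
  then have "mdist m1 a c \<le> mdist m1 a b + mdist m1 b c"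
    "mdist m2 a' c' \<le> mdist m2 a' b' + mdist m2 b' c'" by (auto intro: mdist_triangle)
  then show ?case by (auto simp: *)
qed (auto simp: mdist_commute)

lemma mspace_wedge_metric:
  assumes "x0 \<in> mspace m1" "y0 \<in> mspace m2"
  shows "mspace (wedge_metric m1 x0 m2 y0) = mspace m1 \<times> {y0} \<union> {x0} \<times> mspace m2"
  unfolding wedge_metric_def by (rule Metric_space.mspace_metric[OF Metric_space_wedge[OF assms]])

lemma mdist_wedge:
  assumes "x0 \<in> mspace m1" "y0 \<in> mspace m2"
  shows "x \<in> mspace m1 \<Longrightarrow> x' \<in> mspace m1 \<Longrightarrow>
           mdist (wedge_metric m1 x0 m2 y0) (x, y0) (x', y0) = mdist m1 x x'"
    and "y \<in> mspace m2 \<Longrightarrow> y' \<in> mspace m2 \<Longrightarrow>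
           mdist (wedge_metric m1 x0 m2 y0) (x0, y) (x0, y') = mdist m2 y y'"
    and "x \<in> mspace m1 \<Longrightarrow> y \<in> mspace m2 \<Longrightarrow>
           mdist (wedge_metric m1 x0 m2 y0) (x, y0) (x0, y) = mdist m1 x x0 + mdist m2 y y0"
  using assms unfolding wedge_metric_def
  by (simp_all add: Metric_space.mdist_metric[OF Metric_space_wedge[OF assms]] mdist_commute)


subsection \<open>The Gromov-Hausdorff distance\<close>

definition hausdorff_dist :: "'a metric \<Rightarrow> 'a set \<Rightarrow> 'a set \<Rightarrow> ennreal" where
  "hausdorff_dist m A B =
     max (SUP x\<in>A. INF y\<in>B. ennreal (mdist m x y)) (SUP y\<in>B. INF x\<in>A. ennreal (mdist m x y))"

definition isometric_embedding :: "'a metric \<Rightarrow> 'b metric \<Rightarrow> ('a \<Rightarrow> 'b) \<Rightarrow> bool" where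
  "isometric_embedding m1 m2 f \<longleftrightarrow>
     f \<in> mspace m1 \<rightarrow> mspace m2 \<and>
     (\<forall>x\<in>mspace m1. \<forall>y\<in>mspace m1. mdist m2 (f x) (f y) = mdist m1 x y)"

text \<open>Points of the ambient space outside the two images do not matter, so every pair of isometric
  embeddings into a common metric space can be transported to one with ambient points in
  \<^typ>\<open>'a + 'b\<close>.\<close>

definition gromov_hausdorff_dist :: "'a metric \<Rightarrow> 'b metric \<Rightarrow> ennreal" where
  "gromov_hausdorff_dist m1 m2 =
     (INF (Z, f, g) \<in> {(Z :: ('a + 'b) metric, f, g).
                         isometric_embedding m1 Z f \<and> isometric_embedding m2 Z g}.
        hausdorff_dist Z (f ` mspace m1) (g ` mspace m2))"


section \<open>Vietoris-Rips persistent spaces\<close>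

subsection \<open>Geometric realization\<close>

text \<open>Points of the realization are given by their barycentric coordinates. The topology is
  the weak (coherent) one; on each closed simplex, the product topology
  restricts to the Euclidean topology.\<close>

definition closed_cell :: "'a set \<Rightarrow> ('a \<Rightarrow> real) set" where
  "closed_cell S = {u. (\<forall>v. 0 \<le> u v) \<and> (\<forall>v. v \<notin> S \<longrightarrow> u v = 0) \<and> (\<Sum>v\<in>S. u v) = 1}"

definition geometric_realization :: "'a set set \<Rightarrow> ('a \<Rightarrow> real) topology" where
  "geometric_realization K =
     topology (\<lambda>U. U \<subseteq> (\<Union>S\<in>K. closed_cell S) \<and>
       (\<forall>S\<in>K. openin (subtopology (powertop_real UNIV) (closed_cell S)) (U \<inter> closed_cell S)))"

lemma openin_geometric_realization:
  "openin (geometric_realization K) U \<longleftrightarrow>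
     U \<subseteq> (\<Union>S\<in>K. closed_cell S) \<and>
     (\<forall>S\<in>K. openin (subtopology (powertop_real UNIV) (closed_cell S)) (U \<inter> closed_cell S))"
proof -
  have "istopology (\<lambda>U. U \<subseteq> (\<Union>S\<in>K. closed_cell S) \<and>
       (\<forall>S\<in>K. openin (subtopology (powertop_real UNIV) (closed_cell S)) (U \<inter> closed_cell S)))"
    (is "istopology ?P")
    unfolding istopology_def
  proof (intro conjI allI impI)
    fix U V assume "?P U" "?P V"
    then have "openin (subtopology (powertop_real UNIV) (closed_cell S))
                 ((U \<inter> closed_cell S) \<inter> (V \<inter> closed_cell S))" if "S \<in> K" for S
      using that openin_Int by blast
    moreover have "(U \<inter> T) \<inter> (V \<inter> T) = U \<inter> V \<inter> T" for T by blast
    ultimately show "\<forall>S\<in>K. openin (subtopology (powertop_real UNIV) (closed_cell S))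
                      (U \<inter> V \<inter> closed_cell S)" by simp
    show "U \<inter> V \<subseteq> (\<Union>S\<in>K. closed_cell S)" using \<open>?P U\<close> by blast
  next
    fix \<U> assume *: "\<forall>U\<in>\<U>. ?P U"
    then show "\<Union>\<U> \<subseteq> (\<Union>S\<in>K. closed_cell S)" by blast
    have "openin (subtopology (powertop_real UNIV) (closed_cell S)) (\<Union>U\<in>\<U>. U \<inter> closed_cell S)"
      if "S \<in> K" for S using * that by (intro openin_Union) blast
    then show "\<forall>S\<in>K. openin (subtopology (powertop_real UNIV) (closed_cell S))
                      (\<Union>\<U> \<inter> closed_cell S)" by (simp add: Int_commute Int_Union)
  qed
  then show ?thesis by (simp add: geometric_realization_def)
qed

lemma topspace_geometric_realization:
  "topspace (geometric_realization K) = (\<Union>S\<in>K. closed_cell S)"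
proof -
  have "openin (geometric_realization K) (\<Union>S\<in>K. closed_cell S)"
    unfolding openin_geometric_realization
  proof (intro conjI ballI)
    fix S assume "S \<in> K"
    then have eq: "(\<Union>S\<in>K. closed_cell S) \<inter> closed_cell S = closed_cell S" by blast
    show "openin (subtopology (powertop_real UNIV) (closed_cell S))
            ((\<Union>S\<in>K. closed_cell S) \<inter> closed_cell S)"
      unfolding eq by (simp add: openin_subtopology_refl)
  qed simp
  then show ?thesis
    by (meson openin_geometric_realization openin_subset openin_topspace subset_antisym)
qed

subsection \<open>Persistent spaces\<close>

record 'a persistent_space =
  pspace :: "real \<Rightarrow> 'a topology"
  pmap :: "real \<Rightarrow> real \<Rightarrow> 'a \<Rightarrow> 'a"

definition rips_complex :: "'a metric \<Rightarrow> real \<Rightarrow> 'a set set" where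
  "rips_complex m t =
     {S. finite S \<and> S \<noteq> {} \<and> S \<subseteq> mspace m \<and> (\<forall>x\<in>S. \<forall>y\<in>S. mdist m x y \<le> t)}"

lemma rips_complex_neg: 
  assumes "t < 0"
  shows "rips_complex m t = {}"
proof (rule ccontr)
  assume "rips_complex m t \<noteq> {}"
  then obtain S x where "x \<in> S" "\<forall>x\<in>S. \<forall>y\<in>S. mdist m x y \<le> t"
    by (auto simp: rips_complex_def)
  then have "mdist m x x \<le> t" by blast
  with assms show False using mdist_nonneg[of m x x] by linarith
qed

definition rips :: "'a metric \<Rightarrow> ('a \<Rightarrow> real) persistent_space" where
  "rips m = \<lparr>pspace = \<lambda>t. geometric_realization (rips_complex m t), pmap = \<lambda>a b u. u\<rparr>"

lemma continuous_map_rips: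
  assumes "a \<le> b"
  shows "continuous_map (pspace (rips m) a) (pspace (rips m) b) (pmap (rips m) a b)"
proof -
  have sub: "rips_complex m a \<subseteq> rips_complex m b"
    using assms by (force simp: rips_complex_def)
  have "openin (geometric_realization (rips_complex m a))
          (U \<inter> (\<Union>S\<in>rips_complex m a. closed_cell S))"
    if "openin (geometric_realization (rips_complex m b)) U" for U
    unfolding openin_geometric_realization
  proof (intro conjI ballI)
    fix S assume S: "S \<in> rips_complex m a"
    then have "U \<inter> (\<Union>S\<in>rips_complex m a. closed_cell S) \<inter> closed_cell S = U \<inter> closed_cell S"
      by blast
    then show "openin (subtopology (powertop_real UNIV) (closed_cell S))
                 (U \<inter> (\<Union>S\<in>rips_complex m a. closed_cell S) \<inter> closed_cell S)"
      using that S sub unfolding openin_geometric_realization by auto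
  qed simp
  moreover have "{u \<in> A. u \<in> U} = U \<inter> A" for A U :: "('a \<Rightarrow> real) set" by blast
  moreover have "(\<Union>S\<in>rips_complex m a. closed_cell S) \<subseteq> (\<Union>S\<in>rips_complex m b. closed_cell S)"
    using sub by blast
  ultimately show ?thesis
    by (simp only: rips_def continuous_map_def topspace_geometric_realization
        persistent_space.simps Pi_iff subset_iff) blast
qed


section \<open>Singular cohomology rings\<close>

subsection \<open>The singular cochain algebra\<close>

text \<open>A cochain is a finitely supported sequence of its homogeneous parts; the part of
  degree \<open>n\<close> is a function on singular \<open>n\<close>-simplices, extended by zero.\<close>

type_synonym ('a, 'k) cochain = "nat \<Rightarrow> ((nat \<Rightarrow> real) \<Rightarrow> 'a) \<Rightarrow> 'k"

definition cochains :: "'a topology \<Rightarrow> ('a, 'k::field) cochain set" where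
  "cochains X = {c. (\<forall>n s. \<not> singular_simplex n X s \<longrightarrow> c n s = 0) \<and>
                    finite {n. \<exists>s. c n s \<noteq> 0}}"

definition coboundary :: "'a topology \<Rightarrow> ('a, 'k::field) cochain \<Rightarrow> ('a, 'k) cochain" where
  "coboundary X c = (\<lambda>n s. if 0 < n \<and> singular_simplex n X s
     then \<Sum>k\<le>n. (-1) ^ k * c (n - 1) (singular_face n k s) else 0)"

definition front_face :: "nat \<Rightarrow> ((nat \<Rightarrow> real) \<Rightarrow> 'a) \<Rightarrow> (nat \<Rightarrow> real) \<Rightarrow> 'a" where
  "front_face p s = restrict s (standard_simplex p)"

text \<open>The back face of dimension \<open>q\<close> is spanned by the vertices \<open>p, \<dots>, p + q\<close>.\<close>

definition back_face :: "nat \<Rightarrow> nat \<Rightarrow> ((nat \<Rightarrow> real) \<Rightarrow> 'a) \<Rightarrow> (nat \<Rightarrow> real) \<Rightarrow> 'a" where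
  "back_face p q s =
     restrict (\<lambda>x. s (\<lambda>i. if i < p then 0 else x (i - p))) (standard_simplex q)"

definition cup_product ::
    "'a topology \<Rightarrow> ('a, 'k::field) cochain \<Rightarrow> ('a, 'k) cochain \<Rightarrow> ('a, 'k) cochain" where
  "cup_product X c d = (\<lambda>n s. if singular_simplex n X s
     then \<Sum>p\<le>n. c p (front_face p s) * d (n - p) (back_face p (n - p) s) else 0)"

definition cochain_ring :: "'a topology \<Rightarrow> ('a, 'k::field) cochain ring" where
  "cochain_ring X =
     \<lparr>carrier = cochains X, mult = cup_product X,
      one = (\<lambda>n s. if n = 0 \<and> singular_simplex 0 X s then 1 else 0),
      zero = (\<lambda>n s. 0), add = (\<lambda>c d n s. c n s + d n s)\<rparr>"

definition cocycle_ring :: "'a topology \<Rightarrow> ('a, 'k::field) cochain ring" where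
  "cocycle_ring X =
     cochain_ring X\<lparr>carrier := {c \<in> cochains X. coboundary X c = (\<lambda>n s. 0)}\<rparr>"

definition coboundaries :: "'a topology \<Rightarrow> ('a, 'k::field) cochain set" where
  "coboundaries X = coboundary X ` cochains X"

subsection \<open>Cohomology and induced maps\<close>

definition cohomology_ring :: "'a topology \<Rightarrow> ('a, 'k::field) cochain set ring" where
  "cohomology_ring X = cocycle_ring X Quot coboundaries X"

definition cohomology_grade :: "'a topology \<Rightarrow> nat \<Rightarrow> ('a, 'k::field) cochain set set" where
  "cohomology_grade X p =
     {coboundaries X +>\<^bsub>cocycle_ring X\<^esub> z | z.
        z \<in> carrier (cocycle_ring X) \<and> (\<forall>n s. n \<noteq> p \<longrightarrow> z n s = 0)}"

definition cochain_pullback ::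
    "'a topology \<Rightarrow> ('a \<Rightarrow> 'b) \<Rightarrow> ('b, 'k::field) cochain \<Rightarrow> ('a, 'k) cochain" where
  "cochain_pullback X f c =
     (\<lambda>n s. if singular_simplex n X s then c n (simplex_map n f s) else 0)"

definition cohomology_map ::
    "'a topology \<Rightarrow> ('a \<Rightarrow> 'b) \<Rightarrow> ('b, 'k::field) cochain set \<Rightarrow> ('a, 'k) cochain set" where
  "cohomology_map X f A =
     (\<Union>c\<in>A. coboundaries X +>\<^bsub>cocycle_ring X\<^esub> cochain_pullback X f c)"


section \<open>Persistent invariants and the erosion distance\<close>

subsection \<open>Cup-length\<close>

text \<open>\<open>G p\<close> is the set of homogeneous elements of degree \<open>p\<close> of \<open>R\<close>. The supremum in
  \<^typ>\<open>enat\<close> of the empty set is \<open>0\<close>, and that of an unbounded set is \<open>\<infinity>\<close>.\<close>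

definition graded_ring_length :: "('c, 'm) ring_scheme \<Rightarrow> (nat \<Rightarrow> 'c set) \<Rightarrow> enat" where
  "graded_ring_length R G =
     Sup {enat (length xs) | xs.
            (\<forall>x\<in>set xs. \<exists>p>0. x \<in> G p) \<and> foldr (mult R) xs \<one>\<^bsub>R\<^esub> \<noteq> \<zero>\<^bsub>R\<^esub>}"

definition cup_length_map ::
    "'k::field itself \<Rightarrow> 'a topology \<Rightarrow> 'b topology \<Rightarrow> ('a \<Rightarrow> 'b) \<Rightarrow> enat" where
  "cup_length_map K X Y f =
     (let H = cohomology_map X f :: ('b, 'k) cochain set \<Rightarrow> ('a, 'k) cochain set in
      graded_ring_length
        (cohomology_ring X\<lparr>carrier := H ` carrier (cohomology_ring Y)\<rparr>)
        (\<lambda>p. H ` cohomology_grade Y p))"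

definition persistent_cup ::
    "'k::field itself \<Rightarrow> 'a persistent_space \<Rightarrow> real \<Rightarrow> real \<Rightarrow> enat" where
  "persistent_cup K X a b = cup_length_map K (pspace X a) (pspace X b) (pmap X a b)"

subsection \<open>Lusternik-Schnirelmann category\<close>

text \<open>For \<open>U = {}\<close> every map is homotopic to every constant. Otherwise the constant is
  necessarily a point of \<open>Y\<close>. The infimum in \<^typ>\<open>enat\<close> of the empty set is \<open>\<infinity>\<close>.\<close>

definition null_homotopic_on :: "'a topology \<Rightarrow> 'b topology \<Rightarrow> ('a \<Rightarrow> 'b) \<Rightarrow> 'a set \<Rightarrow> bool" where
  "null_homotopic_on X Y f U \<longleftrightarrow>
     (\<exists>c. homotopic_with (\<lambda>h. True) (subtopology X U) Y f (\<lambda>x. c))"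

definition cat_map :: "'a topology \<Rightarrow> 'b topology \<Rightarrow> ('a \<Rightarrow> 'b) \<Rightarrow> enat" where
  "cat_map X Y f =
     Inf {enat n | n. \<exists>U :: nat \<Rightarrow> 'a set.
            (\<forall>i\<le>n. openin X (U i) \<and> null_homotopic_on X Y f (U i)) \<and>
            (\<Union>i\<le>n. U i) = topspace X}"

definition persistent_cat :: "'a persistent_space \<Rightarrow> real \<Rightarrow> real \<Rightarrow> enat" where
  "persistent_cat X a b = cat_map (pspace X a) (pspace X b) (pmap X a b)"

subsection \<open>Erosion distance\<close>

text \<open>A function \<open>J\<close> on closed intervals \<open>[a, b]\<close> takes the two endpoints as arguments;
  only its values for \<open>a \<le> b\<close> are used.\<close>

definition eroded :: "real \<Rightarrow> (real \<Rightarrow> real \<Rightarrow> enat) \<Rightarrow> (real \<Rightarrow> real \<Rightarrow> enat) \<Rightarrow> bool" where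
  "eroded \<epsilon> J\<^sub>1 J\<^sub>2 \<longleftrightarrow>
     (\<forall>a b. a \<le> b \<longrightarrow> J\<^sub>1 a b \<ge> J\<^sub>2 (a - \<epsilon>) (b + \<epsilon>) \<and> J\<^sub>2 a b \<ge> J\<^sub>1 (a - \<epsilon>) (b + \<epsilon>))"

definition erosion_dist :: "(real \<Rightarrow> real \<Rightarrow> enat) \<Rightarrow> (real \<Rightarrow> real \<Rightarrow> enat) \<Rightarrow> ennreal" where
  "erosion_dist J\<^sub>1 J\<^sub>2 = Inf {ennreal \<epsilon> | \<epsilon>. 0 \<le> \<epsilon> \<and> eroded \<epsilon> J\<^sub>1 J\<^sub>2}"


section \<open>The two spaces\<close>

definition torus2 :: "(complex \<times> complex) metric" where
  "torus2 = linf_metric sphere_metric sphere_metric"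

definition wedge_S1_S2_S1 ::
    "complex \<Rightarrow> real ^ 3 \<Rightarrow> complex \<Rightarrow> ((complex \<times> (real ^ 3)) \<times> complex) metric" where
  "wedge_S1_S2_S1 p q r =
     wedge_metric (wedge_metric sphere_metric p sphere_metric q) (p, q) sphere_metric r"

end

theory Submission imports Defs begin

text \<open>The constants come from plane geometry. At most three unit vectors whose pairwise inner
  products exceed -1/2 = cos(2 pi/3) have no convex combination equal to 0, so below scale 2 pi/3 a
  center of mass misses 0 and has a winding number. In the wedge, collapsing the far hemisphere ends
  at the antipode of the base point, and three jumps of pi/3 lead back; this needs b >= pi/3 only,
  whatever the gap b - a. The intervals [pi/3 - d, pi/3 + d] meet both demands. The vertex sets are
  infinite and the realizations carry the weak topology, so maps and homotopies are built from
  vertex maps and checked cell by cell. No homotopy type of a Rips complex is determined. Cohomology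
  stays at the level of cochains. Relative groups are replaced by representatives that vanish on an
  open set, and a fundamental class of the torus by two triangles with the same edges. Winding
  numbers are integers, so that they make sense in a field of any characteristic.\<close>

text \<open>For both invariants the upper bound \<open>\<pi>/3\<close> holds because \<open>VR_a \<rightarrow> VR_b\<close> is null-homotopic for
  \<open>b \<ge> a + 2\<pi>/3\<close>: every point of either space is within \<open>2\<pi>/3\<close> of a finite set of diameter at
  most \<open>2\<pi>/3\<close>, and the nearest-point map is contiguous both to the identity and to a constant.
  For the lower bound, the torus has cup-length at least \<open>2\<close> on intervals in \<open>(0, 2\<pi>/3)\<close>, detected by
  the winding numbers of the two centers of mass, whereas near \<open>\<pi>/3\<close> the wedge has category at most
  \<open>1\<close>, since the hemispheres around the base point and the opposite ones contract separately.
  The inequality between cup-length and category of a map carries bounds from one invariant to the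
  other. The Gromov-Hausdorff distance is at least \<open>\<pi>/2\<close> because the diameters are \<open>\<pi>\<close> and \<open>2\<pi>\<close>.\<close>

section \<open>The Leibniz rule for the cup product\<close>

lemma singular_simplex_front_face:
  assumes "singular_simplex n X s" "p \<le> n"
  shows "singular_simplex p X (front_face p s)"
proof -
  have "continuous_map (subtopology (powertop_real UNIV) (standard_simplex p)) X s"
    using assms standard_simplex_mono continuous_map_from_subtopology_mono
    unfolding singular_simplex_def by blast
  then show ?thesis
    by (auto simp: singular_simplex_def front_face_def continuous_map_eq)
qed

lemma back_shift_in_standard_simplex:
  assumes "p + q \<le> n" "x \<in> standard_simplex q"
  shows "(\<lambda>i. if i < p then 0 else x (i - p)) \<in> standard_simplex n"
proof -
  have "(\<Sum>i\<le>p+q. if i < p then 0 else x (i - p)) = (\<Sum>i\<in>{p..p+q}. x (i - p))"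
    by (rule sum.mono_neutral_cong_right) auto
  also have "\<dots> = (\<Sum>i\<le>q. x i)"
    by (rule sum.reindex_bij_witness[of _ "\<lambda>i. i + p" "\<lambda>i. i - p"]) auto
  finally have "(\<lambda>i. if i < p then 0 else x (i - p)) \<in> standard_simplex (p + q)"
    using assms(2) by (auto simp: standard_simplex_def)
  then show ?thesis
    using standard_simplex_mono[OF assms(1)] by blast
qed

lemma singular_simplex_back_face:
  assumes "singular_simplex n X s" "p + q \<le> n"
  shows "singular_simplex q X (back_face p q s)"
proof -
  have "continuous_map (subtopology (powertop_real UNIV) (standard_simplex q))
          (subtopology (powertop_real UNIV) (standard_simplex n))
          (\<lambda>x i. if i < p then 0 else x (i - p))"
    using back_shift_in_standard_simplex[OF assms(2)]
    by (auto simp: continuous_map_in_subtopology continuous_map_componentwise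
        intro!: continuous_map_from_subtopology continuous_map_product_projection)
  then have "continuous_map (subtopology (powertop_real UNIV) (standard_simplex q)) X
      (s \<circ> (\<lambda>x i. if i < p then 0 else x (i - p)))"
    using assms(1) unfolding singular_simplex_def by (blast intro: continuous_map_compose)
  then show ?thesis
    by (auto simp: singular_simplex_def back_face_def o_def continuous_map_eq)
qed

text \<open>This and the next three lemmas say how deleting vertex \<open>k\<close> interacts with
  the splitting at vertex \<open>p\<close>. If \<open>k \<le> p\<close>, the deleted vertex lies in
  the front part, which absorbs the face while the back part only shifts; if \<open>p < k\<close>,
  it lies in the back part.\<close>

lemma front_face_singular_face_le:
  assumes "k \<le> p" "p < n"
  shows "front_face p (singular_face n k s) = singular_face (Suc p) k (front_face (Suc p) s)"
proof -
  have "standard_simplex p \<subseteq> standard_simplex (n - 1)"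
    using assms by (intro standard_simplex_mono) auto
  then show ?thesis
    using assms by (auto simp: front_face_def singular_face_def fun_eq_iff restrict_def
      simplical_face_in_standard_simplex)
qed

lemma back_face_singular_face_le:
  assumes "k \<le> p" "p < n"
  shows "back_face p (n - Suc p) (singular_face n k s) = back_face (Suc p) (n - Suc p) s"
proof -
  have "simplical_face k (\<lambda>i. if i < p then 0 else x (i - p)) =
        (\<lambda>i. if i < Suc p then 0 else x (i - Suc p))" for x :: "nat \<Rightarrow> real"
    using assms by (auto simp: simplical_face_def fun_eq_iff)
  then show ?thesis
    using assms back_shift_in_standard_simplex[of p "n - Suc p" "n - 1"]
    by (intro ext) (auto simp: back_face_def singular_face_def restrict_def)
qed

lemma front_face_singular_face_gt:
  assumes "p < k" "k \<le> n"
  shows "front_face p (singular_face n k s) = front_face p s"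
proof -
  have "simplical_face k x = x" if "x \<in> standard_simplex p" for x :: "nat \<Rightarrow> real"
    using assms that by (auto simp: simplical_face_def standard_simplex_def)
  moreover have "standard_simplex p \<subseteq> standard_simplex (n - 1)"
    using assms by (intro standard_simplex_mono) auto
  ultimately show ?thesis
    by (intro ext) (auto simp: front_face_def singular_face_def restrict_def)
qed

lemma back_face_singular_face_gt:
  assumes "p < k" "k \<le> n"
  shows "back_face p (n - Suc p) (singular_face n k s) =
         singular_face (n - p) (k - p) (back_face p (n - p) s)"
proof -
  have "simplical_face k (\<lambda>i. if i < p then 0 else x (i - p)) =
        (\<lambda>i. if i < p then 0 else simplical_face (k - p) x (i - p))" for x :: "nat \<Rightarrow> real"
    using assms by (auto simp: simplical_face_def fun_eq_iff intro!: arg_cong[where f = x])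
  moreover have "n - Suc p = n - p - Suc 0" by simp
  ultimately show ?thesis
    using assms back_shift_in_standard_simplex[of p "n - Suc p" "n - 1"]
      simplical_face_in_standard_simplex[of "n - p" "k - p"]
    by (intro ext) (auto simp: back_face_def singular_face_def restrict_def)
qed

text \<open>With \<open>singular_face_back_face\<close>, this identifies the two inner faces created
  by the splitting, whose contributions cancel in the Leibniz rule.\<close>

lemma singular_face_front_face:
  "singular_face (Suc p) (Suc p) (front_face (Suc p) s) = front_face p s"
proof -
  have "simplical_face (Suc p) x = x" if "x \<in> standard_simplex p" for x :: "nat \<Rightarrow> real"
    using that by (auto simp: simplical_face_def standard_simplex_def)
  then show ?thesis
    using simplical_face_in_standard_simplex[of "Suc p" "Suc p"]
    by (intro ext) (simp add: front_face_def singular_face_def restrict_def)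
qed

lemma singular_face_back_face:
  assumes "p < n"
  shows "singular_face (n - p) 0 (back_face p (n - p) s) = back_face (Suc p) (n - Suc p) s"
proof -
  have "(\<lambda>i. if i < p then 0 else simplical_face 0 x (i - p)) =
        (\<lambda>i. if i < Suc p then 0 else x (i - Suc p))" for x :: "nat \<Rightarrow> real"
    using assms by (auto simp: simplical_face_def fun_eq_iff)
  then show ?thesis
    using assms simplical_face_in_standard_simplex[of "n - p" 0]
    by (intro ext) (auto simp: back_face_def singular_face_def restrict_def)
qed

text \<open>The sign (-1)^deg of the graded Leibniz rule, applied degree by degree because a cochain
  may have parts in several degrees.\<close>

definition alternating :: "('a, 'k::field) cochain \<Rightarrow> ('a, 'k) cochain" where
  "alternating c = (\<lambda>n s. (-1) ^ n * c n s)"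

lemma sum_atMost_Suc_triangle:
  fixes g :: "nat \<Rightarrow> nat \<Rightarrow> 'k::comm_monoid_add"
  shows "(\<Sum>k\<le>Suc m. \<Sum>p\<le>m. g k p) =
         (\<Sum>p\<le>m. \<Sum>k\<le>p. g k p) + (\<Sum>p\<le>m. \<Sum>k\<in>{Suc p..Suc m}. g k p)"
proof -
  have "(\<Sum>k\<le>Suc m. g k p) = (\<Sum>k\<le>p. g k p) + (\<Sum>k\<in>{Suc p..Suc m}. g k p)" if "p \<le> m" for p
  proof -
    have "{..Suc m} = {..p} \<union> {Suc p..Suc m}" using that by auto
    then show ?thesis by (simp add: sum.union_disjoint)
  qed
  then show ?thesis
    by (subst sum.swap) (simp add: sum.distrib)
qed

lemma coboundary_cup_product:
  fixes c d :: "('a, 'k::field) cochain"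
  shows "coboundary X (cup_product X c d) =
    (\<lambda>n s. cup_product X (coboundary X c) d n s + cup_product X (alternating c) (coboundary X d) n s)"
proof (intro ext)
  fix n s
  show "coboundary X (cup_product X c d) n s = cup_product X (coboundary X c) d n s
      + cup_product X (alternating c) (coboundary X d) n s"
  proof (cases "0 < n \<and> singular_simplex n X s")
    case False
    then show ?thesis by (auto simp: coboundary_def cup_product_def)
  next
    case True
    then obtain m where n: "n = Suc m" by (cases n) auto
    have s: "singular_simplex (Suc m) X s" using True n by simp
    define A where "A p = d (m - p) (back_face (Suc p) (m - p) s)" for p
    define B where "B p = c p (front_face p s)" for p
    \<comment> \<open>\<open>P k p\<close> deletes vertex \<open>k\<close> of the front part and
      \<open>Q k p\<close> vertex \<open>k\<close> of the back part. The latter is vertex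
      \<open>k + p\<close> of \<open>s\<close>, whence its sign.\<close>
    define P where "P k p = (-1) ^ k * (c p (singular_face (Suc p) k (front_face (Suc p) s)) * A p)" for k p
    define Q where "Q k p = (-1) ^ (k + p) * (B p * d (m - p) (singular_face (Suc m - p) k (back_face p (Suc m - p) s)))" for k p
    have sf: "singular_simplex m X (singular_face (Suc m) k s)" if "k \<le> Suc m" for k
      using singular_simplex_singular_face[OF s, of k] that by simp
    have "coboundary X (cup_product X c d) n s =
       (\<Sum>k\<le>Suc m. \<Sum>p\<le>m. (-1) ^ k * (c p (front_face p (singular_face (Suc m) k s)) *
           d (m - p) (back_face p (m - p) (singular_face (Suc m) k s))))"
      using s sf by (simp add: coboundary_def n cup_product_def sum_distrib_left)
    also have "\<dots> = (\<Sum>k\<le>Suc m. \<Sum>p\<le>m. if k \<le> p then P k p else Q (k - p) p)"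
    proof (intro sum.cong refl)
      fix k p assume "k \<in> {..Suc m}" "p \<in> {..m}"
      then show "(-1) ^ k * (c p (front_face p (singular_face (Suc m) k s)) *
           d (m - p) (back_face p (m - p) (singular_face (Suc m) k s))) =
           (if k \<le> p then P k p else Q (k - p) p)"
        using front_face_singular_face_le[of k p "Suc m" s]
          back_face_singular_face_le[of k p "Suc m" s]
          front_face_singular_face_gt[of p k "Suc m" s]
          back_face_singular_face_gt[of p k "Suc m" s]
        by (simp add: P_def A_def Q_def B_def)
    qed
    also have "\<dots> = (\<Sum>p\<le>m. \<Sum>k\<le>p. P k p) + (\<Sum>p\<le>m. \<Sum>k\<in>{Suc p..Suc m}. Q (k - p) p)"
      by (simp only: sum_atMost_Suc_triangle) (auto intro!: arg_cong2[where f = "(+)"] sum.cong)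
    also have "(\<Sum>p\<le>m. \<Sum>k\<in>{Suc p..Suc m}. Q (k - p) p) = (\<Sum>p\<le>m. \<Sum>k\<in>{1..Suc m - p}. Q k p)"
    proof (rule sum.cong[OF refl])
      fix p assume "p \<in> {..m}"
      then show "(\<Sum>k\<in>{Suc p..Suc m}. Q (k - p) p) = (\<Sum>k\<in>{1..Suc m - p}. Q k p)"
        by (intro sum.reindex_bij_witness[of _ "\<lambda>i. i + p" "\<lambda>i. i - p"]) auto
    qed
    also have "(\<Sum>p\<le>m. \<Sum>k\<le>p. P k p) + (\<Sum>p\<le>m. \<Sum>k\<in>{1..Suc m - p}. Q k p) =
       (\<Sum>p\<le>m. \<Sum>k\<le>Suc p. P k p) + (\<Sum>p\<le>m. \<Sum>k\<le>Suc m - p. Q k p)"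
    proof -
      \<comment> \<open>Completing both sums to full coboundaries adds these two terms; each is
        \<open>B p * A p\<close> up to sign, with the opposite signs (-1)^(p+1) and (-1)^p.\<close>
      have "P (Suc p) p + Q 0 p = 0" if "p \<le> m" for p
        using singular_face_front_face[of p s] singular_face_back_face[of p "Suc m" s] that
        by (simp add: P_def Q_def A_def B_def)
      then have "(\<Sum>p\<le>m. P (Suc p) p + Q 0 p) = 0" by simp
      moreover have "(\<Sum>k\<le>Suc m - p. Q k p) = Q 0 p + (\<Sum>k\<in>{1..Suc m - p}. Q k p)" for p
        using sum.atLeast_Suc_atMost[of 0 "Suc m - p" "\<lambda>k. Q k p"] by (simp add: atMost_atLeast0)
      ultimately show ?thesis
        by (simp add: sum.distrib algebra_simps add_eq_0_iff)
    qed
    also have "(\<Sum>p\<le>m. \<Sum>k\<le>Suc p. P k p) = cup_product X (coboundary X c) d n s"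
    proof -
      have "cup_product X (coboundary X c) d n s =
         (\<Sum>p\<le>Suc m. coboundary X c p (front_face p s) * d (Suc m - p) (back_face p (Suc m - p) s))"
        using s by (simp add: cup_product_def n)
      also have "\<dots> = (\<Sum>p\<le>m. coboundary X c (Suc p) (front_face (Suc p) s) * A p)"
        by (simp add: sum.atMost_Suc_shift coboundary_def A_def del: sum.atMost_Suc)
      also have "\<dots> = (\<Sum>p\<le>m. \<Sum>k\<le>Suc p. P k p)"
        using singular_simplex_front_face[OF s]
        by (intro sum.cong) (auto simp: coboundary_def P_def sum_distrib_right mult.assoc simp del: sum.atMost_Suc)
      finally show ?thesis by simp
    qed
    also have "(\<Sum>p\<le>m. \<Sum>k\<le>Suc m - p. Q k p) = cup_product X (alternating c) (coboundary X d) n s"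
    proof -
      have "cup_product X (alternating c) (coboundary X d) n s =
         (\<Sum>p\<le>Suc m. (-1) ^ p * B p * coboundary X d (Suc m - p) (back_face p (Suc m - p) s))"
        using s by (simp add: cup_product_def n alternating_def B_def)
      also have "\<dots> = (\<Sum>p\<le>m. (-1) ^ p * B p * coboundary X d (Suc m - p) (back_face p (Suc m - p) s))"
        by (simp add: coboundary_def)
      also have "\<dots> = (\<Sum>p\<le>m. \<Sum>k\<le>Suc m - p. Q k p)"
      proof (intro sum.cong refl)
        fix p assume "p \<in> {..m}"
        then show "(-1) ^ p * B p * coboundary X d (Suc m - p) (back_face p (Suc m - p) s) =
            (\<Sum>k\<le>Suc m - p. Q k p)"
          using singular_simplex_back_face[OF s, of p "Suc m - p"]
          by (auto simp: coboundary_def Q_def sum_distrib_left power_add algebra_simps intro!: sum.cong)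
      qed
      finally show ?thesis by simp
    qed
    finally show ?thesis .
  qed
qed

section \<open>Evaluating cochains on chains\<close>

text \<open>Chains have integer coefficients, whereas cochains take values in \<open>'k\<close>;
  \<open>of_int\<close> mediates, also in positive characteristic.\<close>

definition chain_eval :: "(((nat \<Rightarrow> real) \<Rightarrow> 'a) \<Rightarrow> 'k::field) \<Rightarrow> 'a chain \<Rightarrow> 'k" where
  "chain_eval \<phi> c = (\<Sum>f\<in>Poly_Mapping.keys c. of_int (Poly_Mapping.lookup c f) * \<phi> f)"

lemma chain_eval_superset:
  assumes "finite F" "Poly_Mapping.keys c \<subseteq> F"
  shows "chain_eval \<phi> c = (\<Sum>f\<in>F. of_int (Poly_Mapping.lookup c f) * \<phi> f)"
  unfolding chain_eval_def using assms
  by (intro sum.mono_neutral_left) (auto simp: in_keys_iff)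

lemma chain_eval_0 [simp]: "chain_eval \<phi> 0 = 0"
  by (simp add: chain_eval_def)

lemma chain_eval_of [simp]: "chain_eval \<phi> (frag_of f) = \<phi> f"
  by (simp add: chain_eval_def)

lemma chain_eval_cmul [simp]: "chain_eval \<phi> (frag_cmul k c) = of_int k * chain_eval \<phi> c"
proof -
  have "Poly_Mapping.keys (frag_cmul k c) \<subseteq> Poly_Mapping.keys c" by (rule keys_cmul)
  then show ?thesis
    by (simp add: chain_eval_superset[of "Poly_Mapping.keys c"] sum_distrib_left mult.assoc)
qed

lemma chain_eval_add: "chain_eval \<phi> (a + b) = chain_eval \<phi> a + chain_eval \<phi> b"
proof -
  let ?F = "Poly_Mapping.keys a \<union> Poly_Mapping.keys b"
  have "Poly_Mapping.keys (a + b) \<subseteq> ?F" by (rule keys_add)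
  then show ?thesis
    by (simp add: chain_eval_superset[of ?F] lookup_add sum.distrib distrib_right)
qed

lemma chain_eval_diff: "chain_eval \<phi> (a - b) = chain_eval \<phi> a - chain_eval \<phi> b"
  using chain_eval_add[of \<phi> "a - b" b] by simp

lemma chain_eval_sum: "chain_eval \<phi> (sum g I) = (\<Sum>i\<in>I. chain_eval \<phi> (g i))"
  by (induction I rule: infinite_finite_induct) (auto simp: chain_eval_add)

lemma chain_eval_eq_0:
  "(\<And>f. f \<in> Poly_Mapping.keys c \<Longrightarrow> \<phi> f = 0) \<Longrightarrow> chain_eval \<phi> c = 0"
  by (simp add: chain_eval_def)

lemma coboundary_chain_eval:
  assumes "0 < n" "singular_simplex n X s"
  shows "coboundary X c n s = chain_eval (c (n - 1)) (chain_boundary n (frag_of s))"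
  using assms by (simp add: coboundary_def chain_boundary_of chain_eval_sum)

text \<open>The adjointness of coboundary and boundary, through which identities between chain
  operators (boundary squared, the subdivision homotopy) become statements about cochains.\<close>

lemma chain_eval_coboundary:
  assumes "0 < n" "singular_chain n X a"
  shows "chain_eval (coboundary X c n) a = chain_eval (c (n - 1)) (chain_boundary n a)"
  using assms(2) unfolding singular_chain_def
proof (induction rule: frag_induction)
  case (one f)
  then show ?case using assms(1) by (simp add: coboundary_chain_eval)
qed (auto simp: chain_eval_diff chain_boundary_diff)

lemma coboundary_coboundary: "coboundary X (coboundary X c) = (\<lambda>n s. 0)"
proof (intro ext)
  fix n s
  show "coboundary X (coboundary X c) n s = 0"
  proof (cases "1 < n \<and> singular_simplex n X s")
    case True
    then have "singular_chain (n - 1) X (chain_boundary n (frag_of s))"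
      using singular_chain_boundary[of n X "frag_of s"] by (simp add: singular_chain_of)
    then show ?thesis
      using True by (simp add: coboundary_chain_eval chain_eval_coboundary singular_chain_of
          chain_boundary_boundary[of n X])
  qed (auto simp: coboundary_def)
qed

section \<open>Cohomology classes\<close>

lemma cochains_add:
  assumes "c \<in> cochains X" "d \<in> cochains X"
  shows "(\<lambda>n s. c n s + d n s) \<in> cochains X"
proof -
  have "{n. \<exists>s. c n s + d n s \<noteq> 0} \<subseteq> {n. \<exists>s. c n s \<noteq> 0} \<union> {n. \<exists>s. d n s \<noteq> 0}"
    by auto
  then have "finite {n. \<exists>s. c n s + d n s \<noteq> 0}"
    by (rule finite_subset) (use assms in \<open>simp add: cochains_def\<close>)
  then show ?thesis
    using assms unfolding cochains_def by simp
qed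

lemma cochains_diff:
  assumes "c \<in> cochains X" "d \<in> cochains X"
  shows "(\<lambda>n s. c n s - d n s) \<in> cochains X"
proof -
  have "{n. \<exists>s. c n s - d n s \<noteq> 0} \<subseteq> {n. \<exists>s. c n s \<noteq> 0} \<union> {n. \<exists>s. d n s \<noteq> 0}"
    by auto
  then have "finite {n. \<exists>s. c n s - d n s \<noteq> 0}"
    by (rule finite_subset) (use assms in \<open>simp add: cochains_def\<close>)
  then show ?thesis
    using assms unfolding cochains_def by simp
qed

lemma cochains_0 [simp]: "(\<lambda>n s. 0) \<in> cochains X"
  by (simp add: cochains_def)

lemma cochains_alternating: "c \<in> cochains X \<Longrightarrow> alternating c \<in> cochains X"
  by (simp add: cochains_def alternating_def)

lemma cochains_coboundary:
  assumes "c \<in> cochains X"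
  shows "coboundary X c \<in> cochains X"
proof -
  have "{n. \<exists>s. coboundary X c n s \<noteq> 0} \<subseteq> Suc ` {n. \<exists>s. c n s \<noteq> 0}"
  proof
    fix n assume "n \<in> {n. \<exists>s. coboundary X c n s \<noteq> 0}"
    then obtain s where s: "coboundary X c n s \<noteq> 0" by blast
    then have "0 < n" "(\<Sum>k\<le>n. (-1) ^ k * c (n - 1) (singular_face n k s)) \<noteq> 0"
      by (auto simp: coboundary_def split: if_splits)
    then obtain k where "c (n - 1) (singular_face n k s) \<noteq> 0"
      by (auto elim!: sum.not_neutral_contains_not_neutral)
    then show "n \<in> Suc ` {n. \<exists>s. c n s \<noteq> 0}"
      using \<open>0 < n\<close> by (intro image_eqI[of _ _ "n - 1"]) auto
  qed
  then have "finite {n. \<exists>s. coboundary X c n s \<noteq> 0}"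
    by (rule finite_subset) (use assms in \<open>simp add: cochains_def\<close>)
  then show ?thesis by (simp add: cochains_def coboundary_def)
qed

lemma cochains_cup_product:
  assumes "c \<in> cochains X" "d \<in> cochains X"
  shows "cup_product X c d \<in> cochains X"
proof -
  let ?S = "\<lambda>c. {n. \<exists>s. c n s \<noteq> 0}"
  have "?S (cup_product X c d) \<subseteq> (\<lambda>(p, q). p + q) ` (?S c \<times> ?S d)"
  proof
    fix n assume "n \<in> ?S (cup_product X c d)"
    then obtain s where "cup_product X c d n s \<noteq> 0" by blast
    then have "(\<Sum>p\<le>n. c p (front_face p s) * d (n - p) (back_face p (n - p) s)) \<noteq> 0"
      by (auto simp: cup_product_def split: if_splits)
    then obtain p where "p \<le> n" "c p (front_face p s) * d (n - p) (back_face p (n - p) s) \<noteq> 0"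
      by (auto elim!: sum.not_neutral_contains_not_neutral)
    then show "n \<in> (\<lambda>(p, q). p + q) ` (?S c \<times> ?S d)"
      by (intro image_eqI[of _ _ "(p, n - p)"]) auto
  qed
  moreover have "finite (?S c \<times> ?S d)"
    using assms by (auto simp: cochains_def)
  ultimately have "finite (?S (cup_product X c d))"
    using finite_surj by blast
  then show ?thesis by (simp add: cochains_def cup_product_def)
qed

lemma coboundary_add:
  "coboundary X (\<lambda>n s. c n s + d n s) = (\<lambda>n s. coboundary X c n s + coboundary X d n s)"
  by (auto simp: coboundary_def fun_eq_iff sum.distrib distrib_left)

lemma coboundary_diff:
  "coboundary X (\<lambda>n s. c n s - d n s) = (\<lambda>n s. coboundary X c n s - coboundary X d n s)"
  by (auto simp: coboundary_def fun_eq_iff sum_subtractf right_diff_distrib)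

lemma coboundary_0 [simp]: "coboundary X (\<lambda>n s. 0) = (\<lambda>n s. 0)"
  by (auto simp: coboundary_def fun_eq_iff)

lemma coboundary_alternating:
  "coboundary X (alternating c) = (\<lambda>n s. - alternating (coboundary X c) n s)"
proof (intro ext)
  fix n s
  show "coboundary X (alternating c) n s = - alternating (coboundary X c) n s"
    by (cases n) (auto simp: coboundary_def alternating_def sum_distrib_left algebra_simps
        simp flip: sum_negf simp del: sum.atMost_Suc)
qed

lemma cup_product_add_left:
  "cup_product X (\<lambda>n s. c n s + d n s) e = (\<lambda>n s. cup_product X c e n s + cup_product X d e n s)"
  by (auto simp: cup_product_def fun_eq_iff sum.distrib distrib_right)

lemma cup_product_add_right:
  "cup_product X e (\<lambda>n s. c n s + d n s) = (\<lambda>n s. cup_product X e c n s + cup_product X e d n s)"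
  by (auto simp: cup_product_def fun_eq_iff sum.distrib distrib_left)

lemma cup_product_0_left [simp]: "cup_product X (\<lambda>n s. 0) e = (\<lambda>n s. 0)"
  and cup_product_0_right [simp]: "cup_product X e (\<lambda>n s. 0) = (\<lambda>n s. 0)"
  by (auto simp: cup_product_def fun_eq_iff)

section \<open>Cocycles modulo coboundaries\<close>

abbreviation cocycles :: "'a topology \<Rightarrow> ('a, 'k::field) cochain set" where
  "cocycles X \<equiv> carrier (cocycle_ring X)"

lemma cocycles_def: "cocycles X = {c \<in> cochains X. coboundary X c = (\<lambda>n s. 0)}"
  by (simp add: cocycle_ring_def)

lemma cocycle_ring_simps [simp]:
  "mult (cocycle_ring X) = cup_product X"
  "one (cocycle_ring X) = (\<lambda>n s. if n = 0 \<and> singular_simplex 0 X s then 1 else 0)"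
  "add (cocycle_ring X) = (\<lambda>c d n s. c n s + d n s)"
  by (simp_all add: cocycle_ring_def cochain_ring_def)

lemma cocycles_cup_product:
  assumes "c \<in> cocycles X" "d \<in> cocycles X"
  shows "cup_product X c d \<in> cocycles X"
  using assms by (simp add: cocycles_def cochains_cup_product coboundary_cup_product)

lemma cocycles_one:
  "(\<lambda>n s. if n = 0 \<and> singular_simplex 0 X s then 1 else 0) \<in> (cocycles X :: ('a, 'k::field) cochain set)"
proof -
  have "coboundary X (\<lambda>n s. if n = 0 \<and> singular_simplex 0 X s then 1 else 0 :: 'k) n s = 0" for n s
    using singular_simplex_singular_face[of 1 X s 0] singular_simplex_singular_face[of 1 X s 1]
    by (cases "n = 1") (auto simp: coboundary_def)
  moreover have "finite {n. \<exists>s. (if n = 0 \<and> singular_simplex 0 X s then 1 else 0 :: 'k) \<noteq> 0}"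
    by (rule finite_subset[of _ "{0}"]) auto
  ultimately show ?thesis
    by (simp add: cocycles_def cochains_def fun_eq_iff)
qed

lemma coboundaries_add:
  assumes "a \<in> coboundaries X" "b \<in> coboundaries X"
  shows "(\<lambda>n s. a n s + b n s) \<in> coboundaries X"
proof -
  obtain c d where "a = coboundary X c" "b = coboundary X d" "c \<in> cochains X" "d \<in> cochains X"
    using assms by (auto simp: coboundaries_def)
  then show ?thesis
    unfolding coboundaries_def
    by (intro image_eqI[of _ _ "\<lambda>n s. c n s + d n s"]) (auto simp: coboundary_add cochains_add)
qed

lemma coboundaries_diff:
  assumes "a \<in> coboundaries X" "b \<in> coboundaries X"
  shows "(\<lambda>n s. a n s - b n s) \<in> coboundaries X"
proof -
  obtain c d where "a = coboundary X c" "b = coboundary X d" "c \<in> cochains X" "d \<in> cochains X"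
    using assms by (auto simp: coboundaries_def)
  then show ?thesis
    unfolding coboundaries_def
    by (intro image_eqI[of _ _ "\<lambda>n s. c n s - d n s"]) (auto simp: coboundary_diff cochains_diff)
qed

lemma coboundaries_0 [simp]: "(\<lambda>n s. 0) \<in> coboundaries X"
  unfolding coboundaries_def by (rule image_eqI[of _ _ "\<lambda>n s. 0"]) auto

lemma coboundaries_subset_cocycles: "coboundaries X \<subseteq> cocycles X"
  by (auto simp: coboundaries_def cocycles_def cochains_coboundary coboundary_coboundary)

lemma coboundaries_cup_left:
  assumes "a \<in> coboundaries X" "d \<in> cocycles X"
  shows "cup_product X a d \<in> coboundaries X"
proof -
  obtain c where "a = coboundary X c" "c \<in> cochains X"
    using assms by (auto simp: coboundaries_def)
  then show ?thesis
    using assms(2) unfolding coboundaries_def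
    by (intro image_eqI[of _ _ "cup_product X c d"])
      (auto simp: coboundary_cup_product cochains_cup_product cocycles_def)
qed

text \<open>For a cocycle \<open>d\<close> and \<open>a = coboundary X c\<close>, the Leibniz rule
  for \<open>alternating d\<close> and \<open>c\<close> leaves only the product of
  \<open>alternating (alternating d) = d\<close> with \<open>a\<close>.\<close>

lemma coboundaries_cup_right:
  assumes "a \<in> coboundaries X" "d \<in> cocycles X"
  shows "cup_product X d a \<in> coboundaries X"
proof -
  obtain c where c: "a = coboundary X c" "c \<in> cochains X"
    using assms by (auto simp: coboundaries_def)
  have "alternating (alternating d) = d"
    by (simp add: alternating_def fun_eq_iff flip: mult.assoc power_add)
  moreover have "alternating d \<in> cocycles X"
    using assms(2) by (simp add: cocycles_def cochains_alternating coboundary_alternating)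
      (simp add: alternating_def)
  ultimately show ?thesis
    using c unfolding coboundaries_def
    by (intro image_eqI[of _ _ "cup_product X (alternating d) c"])
      (auto simp: coboundary_cup_product cochains_cup_product cocycles_def)
qed

definition cohomology_class :: "'a topology \<Rightarrow> ('a, 'k::field) cochain \<Rightarrow> ('a, 'k) cochain set" where
  "cohomology_class X z = coboundaries X +>\<^bsub>cocycle_ring X\<^esub> z"

lemma cohomology_class_eq: "cohomology_class X z = {\<lambda>n s. b n s + z n s | b. b \<in> coboundaries X}"
  by (auto simp: cohomology_class_def a_r_coset_def')

lemma cohomology_class_iff:
  "w \<in> cohomology_class X z \<longleftrightarrow> (\<lambda>n s. w n s - z n s) \<in> coboundaries X"
proof
  assume "(\<lambda>n s. w n s - z n s) \<in> coboundaries X"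
  then show "w \<in> cohomology_class X z"
    unfolding cohomology_class_eq by (intro CollectI exI[of _ "\<lambda>n s. w n s - z n s"]) auto
qed (auto simp: cohomology_class_eq)

lemma cohomology_class_self: "z \<in> cohomology_class X z"
  by (simp add: cohomology_class_iff)

lemma cohomology_class_eqI:
  assumes "(\<lambda>n s. z n s - w n s) \<in> coboundaries X"
  shows "cohomology_class X z = cohomology_class X w"
proof -
  have "(\<lambda>n s. v n s - w n s) \<in> coboundaries X \<longleftrightarrow> (\<lambda>n s. v n s - z n s) \<in> coboundaries X" for v
    using coboundaries_add[OF _ assms, of "\<lambda>n s. v n s - z n s"]
      coboundaries_diff[OF _ assms, of "\<lambda>n s. v n s - w n s"] by auto
  then show ?thesis by (auto simp: cohomology_class_iff)
qed

lemma cohomology_class_subset_cocycles: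
  assumes "z \<in> cocycles X"
  shows "cohomology_class X z \<subseteq> cocycles X"
  using assms coboundaries_subset_cocycles
  by (fastforce simp: cohomology_class_eq cocycles_def cochains_add coboundary_add)

lemma cohomology_class_eq_coboundaries:
  "z \<in> coboundaries X \<Longrightarrow> cohomology_class X z = coboundaries X"
  using cohomology_class_eqI[of z "\<lambda>n s. 0" X] by (simp add: cohomology_class_iff set_eq_iff)

text \<open>\<open>rcoset_mult\<close> is a union over all pairs of representatives. The difference
  of two such products is a coboundary times a cocycle plus a cocycle times a coboundary, so all
  pairs contribute the same class.\<close>

lemma mult_cohomology_class:
  assumes "a \<in> cocycles X" "b \<in> cocycles X"
  shows "rcoset_mult (cocycle_ring X) (coboundaries X) (cohomology_class X a) (cohomology_class X b) =
         cohomology_class X (cup_product X a b)"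
proof -
  have "cohomology_class X (cup_product X a' b') = cohomology_class X (cup_product X a b)"
    if a': "a' \<in> cohomology_class X a" and b': "b' \<in> cohomology_class X b" for a' b'
  proof (rule cohomology_class_eqI)
    obtain i where i: "i \<in> coboundaries X" "a' = (\<lambda>n s. i n s + a n s)"
      using a' unfolding cohomology_class_eq by blast
    obtain j where j: "j \<in> coboundaries X" "b' = (\<lambda>n s. j n s + b n s)"
      using b' unfolding cohomology_class_eq by blast
    have "b' \<in> cocycles X" using b' assms cohomology_class_subset_cocycles by blast
    then have "(\<lambda>n s. cup_product X i b' n s + cup_product X a j n s) \<in> coboundaries X"
      using i j assms by (intro coboundaries_add coboundaries_cup_left coboundaries_cup_right)
    moreover have "(\<lambda>n s. cup_product X a' b' n s - cup_product X a b n s) =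
       (\<lambda>n s. cup_product X i b' n s + cup_product X a j n s)"
      unfolding i(2) cup_product_add_left unfolding j(2) cup_product_add_right
      by (simp add: fun_eq_iff)
    ultimately show "(\<lambda>n s. cup_product X a' b' n s - cup_product X a b n s) \<in> coboundaries X"
      by simp
  qed
  then have "rcoset_mult (cocycle_ring X) (coboundaries X) (cohomology_class X a) (cohomology_class X b) =
      (\<Union>a'\<in>cohomology_class X a. \<Union>b'\<in>cohomology_class X b. cohomology_class X (cup_product X a b))"
    unfolding rcoset_mult_def cohomology_class_def[symmetric] cocycle_ring_simps
    by (intro SUP_cong refl) auto
  also have "\<dots> = cohomology_class X (cup_product X a b)"
    using cohomology_class_self[of a X] cohomology_class_self[of b X] by blast
  finally show ?thesis .
qed

lemma cohomology_ring_simps [simp]: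
  "mult (cohomology_ring X) = rcoset_mult (cocycle_ring X) (coboundaries X)"
  "one (cohomology_ring X) =
     cohomology_class X (\<lambda>n s. if n = 0 \<and> singular_simplex 0 X s then 1 else 0)"
  "zero (cohomology_ring X) = coboundaries X"
  by (simp_all add: cohomology_ring_def FactRing_def cohomology_class_def)

lemma cohomology_grade_eq:
  "cohomology_grade X p = cohomology_class X ` {z \<in> cocycles X. \<forall>n s. n \<noteq> p \<longrightarrow> z n s = 0}"
  by (auto simp: cohomology_grade_def cohomology_class_def)

section \<open>Pullbacks and induced maps\<close>

lemma cochains_pullback:
  assumes "c \<in> cochains Y"
  shows "cochain_pullback X f c \<in> cochains X"
proof -
  have "finite {n. \<exists>s. cochain_pullback X f c n s \<noteq> 0}"
    by (rule finite_subset[of _ "{n. \<exists>s. c n s \<noteq> 0}"])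
      (use assms in \<open>auto simp: cochains_def cochain_pullback_def split: if_splits\<close>)
  then show ?thesis by (simp add: cochains_def cochain_pullback_def)
qed

lemma singular_face_simplex_map':
  assumes "0 < n" "k \<le> n"
  shows "singular_face n k (simplex_map n f s) = simplex_map (n - 1) f (singular_face n k s)"
  using assms by (simp add: singular_face_simplex_map)
    (auto simp: simplex_map_def singular_face_def restrict_def)

lemma coboundary_pullback:
  assumes "continuous_map X Y f"
  shows "coboundary X (cochain_pullback X f c) = cochain_pullback X f (coboundary Y c)"
proof (intro ext)
  fix n s
  show "coboundary X (cochain_pullback X f c) n s = cochain_pullback X f (coboundary Y c) n s"
    using singular_simplex_simplex_map[of n X s Y f] assms singular_simplex_singular_face[of n X s]
    by (auto simp: coboundary_def cochain_pullback_def singular_face_simplex_map'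
        intro!: sum.cong)
qed

lemma cocycles_pullback:
  assumes "continuous_map X Y f" "c \<in> cocycles Y"
  shows "cochain_pullback X f c \<in> cocycles X"
  using assms cochains_pullback[of c Y X f]
  by (auto simp: cocycles_def coboundary_pullback) (simp add: cochain_pullback_def)

lemma cohomology_map_class:
  assumes "continuous_map X Y f"
  shows "cohomology_map X f (cohomology_class Y z) = cohomology_class X (cochain_pullback X f z)"
proof -
  have "cohomology_class X (cochain_pullback X f c) = cohomology_class X (cochain_pullback X f z)"
    if c: "c \<in> cohomology_class Y z" for c
  proof (rule cohomology_class_eqI)
    obtain d where d: "d \<in> cochains Y" "c = (\<lambda>n s. coboundary Y d n s + z n s)"
      using c unfolding cohomology_class_eq coboundaries_def by blast
    have "(\<lambda>n s. cochain_pullback X f c n s - cochain_pullback X f z n s) =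
          cochain_pullback X f (coboundary Y d)"
      by (simp add: d(2) cochain_pullback_def fun_eq_iff)
    also have "\<dots> = coboundary X (cochain_pullback X f d)"
      by (rule coboundary_pullback[OF assms, symmetric])
    finally show "(\<lambda>n s. cochain_pullback X f c n s - cochain_pullback X f z n s) \<in> coboundaries X"
      unfolding coboundaries_def using cochains_pullback[OF d(1)] by (metis imageI)
  qed
  then have "cohomology_map X f (cohomology_class Y z) =
      (\<Union>c\<in>cohomology_class Y z. cohomology_class X (cochain_pullback X f z))"
    unfolding cohomology_map_def cohomology_class_def[symmetric] by (intro SUP_cong refl) auto
  also have "\<dots> = cohomology_class X (cochain_pullback X f z)"
    using cohomology_class_self[of z Y] by blast
  finally show ?thesis .
qed

section \<open>Null-homotopies and cocycles\<close>

text \<open>The point of the \<open>(n+1)\<close>-simplex with coordinate \<open>x 0 = t\<close> is sent to the stage \<open>t\<close> of the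
  homotopy, applied to the projection of \<open>x\<close> from the vertex \<open>0\<close>. At that vertex the projection is
  undefined, but there the homotopy is constant.\<close>

definition null_cone :: "nat \<Rightarrow> (real \<times> 'a \<Rightarrow> 'b) \<Rightarrow> ((nat \<Rightarrow> real) \<Rightarrow> 'a) \<Rightarrow> (nat \<Rightarrow> real) \<Rightarrow> 'b" where
  "null_cone n H s = restrict
     (\<lambda>x. H (x 0, s (if x 0 = 1 then (\<lambda>j. if j = 0 then 1 else 0) else (\<lambda>i. x (Suc i) / (1 - x 0)))))
     (standard_simplex (Suc n))"

lemma rescale_in_standard_simplex:
  assumes "x \<in> standard_simplex (Suc n)" "x 0 \<noteq> 1"
  shows "(\<lambda>i. x (Suc i) / (1 - x 0)) \<in> standard_simplex n"
proof -
  have x: "0 \<le> x i" "x i \<le> 1" "i > Suc n \<Longrightarrow> x i = 0" "x 0 < 1" for i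
    using assms by (auto simp: standard_simplex_def less_le)
  have "x 0 + (\<Sum>i\<le>n. x (Suc i)) = 1"
    using assms by (simp add: standard_simplex_def sum.atMost_Suc_shift del: sum.atMost_Suc)
  then have sum: "(\<Sum>i\<le>n. x (Suc i)) = 1 - x 0" by simp
  have "x (Suc i) \<le> 1 - x 0" for i
  proof (cases "i \<le> n")
    case True
    then show ?thesis
      using member_le_sum[of i "{..n}" "\<lambda>i. x (Suc i)"] x sum by simp
  next
    case False
    then show ?thesis using x(3)[of "Suc i"] x(4) by simp
  qed
  then show ?thesis
    using x sum by (auto simp: standard_simplex_def divide_simps sum_divide_distrib[symmetric])
qed

text \<open>Continuity at the vertex 0, where the projection breaks down, is obtained from a
  quotient map. The join map \<open>q\<close> from interval times simplex onto the larger simplex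
  goes from a compact space onto a Hausdorff space, and the cone composed with \<open>q\<close> is
  simply \<open>H (t, s y)\<close>.\<close>

lemma singular_simplex_null_cone:
  assumes H: "continuous_map (prod_topology (top_of_set {0..1}) Z) Y H"
    and const: "\<And>x. H (1, x) = c" and s: "singular_simplex n Z s"
  shows "singular_simplex (Suc n) Y (null_cone n H s)"
proof -
  let ?D = "\<lambda>n. subtopology (powertop_real UNIV) (standard_simplex n)"
  let ?IX = "prod_topology (top_of_set {0..1::real}) (?D n)"
  define q :: "real \<times> (nat \<Rightarrow> real) \<Rightarrow> nat \<Rightarrow> real"
    where "q = (\<lambda>(t, y) i. if i = 0 then t else (1 - t) * y (i - 1))"
  have q_in: "q (t, y) \<in> standard_simplex (Suc n)" if "t \<in> {0..1}" "y \<in> standard_simplex n" for t y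
  proof -
    have y: "0 \<le> y i" "y i \<le> 1" "i > n \<Longrightarrow> y i = 0" "(\<Sum>i\<le>n. y i) = 1" for i
      using that by (auto simp: standard_simplex_def)
    have "(\<Sum>i\<le>Suc n. q (t, y) i) = t + (1 - t) * (\<Sum>i\<le>n. y i)"
      by (simp add: q_def sum.atMost_Suc_shift sum_distrib_left del: sum.atMost_Suc)
    moreover have "(1 - t) * y i \<le> 1" for i
      using y that by (intro mult_le_one) auto
    ultimately show ?thesis
      using y that by (auto simp: standard_simplex_def q_def simp del: sum.atMost_Suc)
  qed
  have "continuous_map ?IX euclideanreal (\<lambda>p. q p i)" for i
  proof -
    have "continuous_map ?IX euclideanreal (\<lambda>p. snd p j)" for j
      by (rule continuous_map_compose[OF continuous_map_snd, unfolded o_def])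
        (auto intro: continuous_map_from_subtopology continuous_map_product_projection)
    moreover have "continuous_map ?IX euclideanreal fst"
      by (rule continuous_map_into_fulltopology[OF continuous_map_fst])
    ultimately have "continuous_map ?IX euclideanreal (\<lambda>p. if i = 0 then fst p else (1 - fst p) * snd p (i - 1))"
      by (cases "i = 0") (auto intro!: continuous_map_real_mult continuous_map_diff)
    then show ?thesis by (simp add: q_def case_prod_beta)
  qed
  then have qcont: "continuous_map ?IX (?D (Suc n)) q"
    using q_in by (auto simp: continuous_map_in_subtopology continuous_map_componentwise)
  have surj: "q ` topspace ?IX = topspace (?D (Suc n))"
  proof
    show "q ` topspace ?IX \<subseteq> topspace (?D (Suc n))" using q_in by auto
    show "topspace (?D (Suc n)) \<subseteq> q ` topspace ?IX"
    proof
      fix x assume "x \<in> topspace (?D (Suc n))"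
      then have x: "x \<in> standard_simplex (Suc n)" by simp
      then have x01: "x 0 \<in> {0..1}" by (auto simp: standard_simplex_def)
      show "x \<in> q ` topspace ?IX"
      proof (cases "x 0 = 1")
        case True
        have "x 0 + (\<Sum>i\<le>n. x (Suc i)) = 1"
          using x by (simp add: standard_simplex_def sum.atMost_Suc_shift del: sum.atMost_Suc)
        then have "\<forall>i\<le>n. x (Suc i) = 0"
          using True x by (auto simp: standard_simplex_def sum_nonneg_eq_0_iff)
        then have "x i = 0" if "i \<noteq> 0" for i
          using x that by (cases i; cases "i > Suc n") (auto simp: standard_simplex_def)
        then have "x = q (1, \<lambda>j. if j = 0 then 1 else 0)"
          using True by (auto simp: q_def fun_eq_iff)
        then show ?thesis by (intro image_eqI) auto
      next
        case False
        then have "x = q (x 0, \<lambda>i. x (Suc i) / (1 - x 0))"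
          by (auto simp: q_def fun_eq_iff)
        then show ?thesis
          using rescale_in_standard_simplex[OF x False] x01 by (intro image_eqI) auto
      qed
    qed
  qed
  have "compact_space (top_of_set {0..1::real})"
    by (rule compact_space_subtopology) simp
  then have "compact_space ?IX"
    by (simp add: compact_space_prod_topology compact_space_subtopology compactin_standard_simplex)
  moreover have "Hausdorff_space (?D (Suc n))"
    by (simp add: Hausdorff_space_subtopology Hausdorff_space_product_topology)
  ultimately have quot: "quotient_map ?IX (?D (Suc n)) q"
    using qcont surj by (intro T1_Spaces.continuous_imp_quotient_map)
  have "continuous_map (?D n) Z s" using s by (simp add: singular_simplex_def)
  then have "continuous_map ?IX (prod_topology (top_of_set {0..1}) Z) (\<lambda>p. (fst p, s (snd p)))"
    by (auto simp: continuous_map_pairwise o_def continuous_map_fst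
        intro: continuous_map_compose[OF continuous_map_snd, unfolded o_def])
  then have "continuous_map ?IX Y (\<lambda>p. H (fst p, s (snd p)))"
    using continuous_map_compose[OF _ H] by (simp add: o_def)
  then have "continuous_map ?IX Y (null_cone n H s \<circ> q)"
  proof (rule continuous_map_eq)
    fix p assume "p \<in> topspace ?IX"
    then obtain t y where p: "p = (t, y)" "t \<in> {0..1}" "y \<in> standard_simplex n" by auto
    then show "H (fst p, s (snd p)) = (null_cone n H s \<circ> q) p"
      using q_in[of t y] by (cases "t = 1") (auto simp: null_cone_def const, auto simp: q_def)
  qed
  then have "continuous_map (?D (Suc n)) Y (null_cone n H s)"
    by (rule continuous_compose_quotient_map[OF quot])
  then show ?thesis by (simp add: singular_simplex_def null_cone_def)
qed

text \<open>The base of the cone is stage 0 of the homotopy, and by the next lemma the other faces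
  are cones over faces. So in positive degrees \<open>null_cone\<close> is a chain contraction of
  the map at stage 0.\<close>

lemma singular_face_null_cone_0:
  "singular_face (Suc n) 0 (null_cone n H s) = simplex_map n (\<lambda>x. H (0, x)) s"
  using simplical_face_in_standard_simplex[of "Suc n" 0]
  by (intro ext) (simp add: singular_face_def null_cone_def simplex_map_def restrict_def simplical_face_def)

lemma singular_face_null_cone_Suc:
  assumes const: "\<And>x. H (1, x) = c" and "k \<le> Suc n"
  shows "singular_face (Suc (Suc n)) (Suc k) (null_cone (Suc n) H s) =
         null_cone n H (singular_face (Suc n) k s)"
proof
  fix x :: "nat \<Rightarrow> real"
  have sf: "simplical_face (Suc k) x 0 = x 0"
    "(\<lambda>i. simplical_face (Suc k) x (Suc i) / (1 - x 0)) = simplical_face k (\<lambda>i. x (Suc i) / (1 - x 0))"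
    by (auto simp: simplical_face_def fun_eq_iff)
  show "singular_face (Suc (Suc n)) (Suc k) (null_cone (Suc n) H s) x =
      null_cone n H (singular_face (Suc n) k s) x"
  proof (cases "x \<in> standard_simplex (Suc n)")
    case True
    then show ?thesis
      using simplical_face_in_standard_simplex[of "Suc (Suc n)" "Suc k" x] assms
        rescale_in_standard_simplex[of x n] const
      by (cases "x 0 = 1") (auto simp: singular_face_def null_cone_def restrict_def sf)
  qed (auto simp: singular_face_def null_cone_def)
qed

text \<open>The cocycle equation of \<open>z\<close> on the cone over \<open>s\<close> exhibits the
  pullback as the coboundary of \<open>s \<mapsto> z (cone of s)\<close>. This cochain
  \<open>e\<close> is extended by zero to all of \<open>X\<close>, so that subtracting its
  coboundary changes a cocycle of \<open>X\<close> within its class into one that vanishes on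
  \<open>U\<close>. In degree 0 coboundaries vanish, hence the assumption on
  \<open>z 0\<close>.\<close>

lemma pullback_coboundary_on:
  fixes z :: "('b, 'k::field) cochain"
  assumes null: "null_homotopic_on X Y f U" and z: "z \<in> cocycles Y" "\<And>s. z 0 s = 0"
  shows "\<exists>e\<in>cochains X. \<forall>n s. singular_simplex n (subtopology X U) s \<longrightarrow>
           cochain_pullback X f z n s = coboundary X e n s"
proof -
  let ?Z = "subtopology X U"
  obtain H c where "continuous_map (prod_topology (top_of_set {0..1::real}) ?Z) Y H"
    "\<forall>x. H (0, x) = f x" "\<forall>x. H (1, x) = c"
    using null unfolding null_homotopic_on_def homotopic_with_def by blast
  then have H: "continuous_map (prod_topology (top_of_set {0..1}) ?Z) Y H"
    "\<And>x. H (0, x) = f x" "\<And>x. H (1, x) = c" by auto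
  define e where "e n s = (if singular_simplex n ?Z s then z (Suc n) (null_cone n H s) else 0)" for n s
  have sing: "singular_simplex n X s" if "singular_simplex n ?Z s" for n s
    using that by (simp add: singular_simplex_subtopology)
  have "{n. \<exists>s. e n s \<noteq> 0} \<subseteq> Suc -` {n. \<exists>s. z n s \<noteq> 0}"
    by (auto simp: e_def split: if_splits)
  then have "finite {n. \<exists>s. e n s \<noteq> 0}"
    by (rule finite_subset) (use z in \<open>simp add: cocycles_def cochains_def finite_vimageI del: vimage_Collect_eq\<close>)
  then have "e \<in> cochains X"
    using sing by (auto simp: cochains_def e_def)
  moreover have "cochain_pullback X f z n s = coboundary X e n s" if s: "singular_simplex n ?Z s" for n s
  proof (cases n)
    case 0
    then show ?thesis by (simp add: cochain_pullback_def coboundary_def z)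
  next
    case (Suc m)
    have "0 = coboundary Y z (Suc n) (null_cone n H s)"
      using z(1) by (simp add: cocycles_def)
    also have "\<dots> = (\<Sum>k\<le>Suc n. (-1) ^ k * z n (singular_face (Suc n) k (null_cone n H s)))"
      using singular_simplex_null_cone[OF H(1,3) s] by (simp add: coboundary_def del: sum.atMost_Suc)
    also have "\<dots> = z n (simplex_map n f s) -
        (\<Sum>k\<le>n. (-1) ^ k * z n (singular_face (Suc n) (Suc k) (null_cone n H s)))"
      by (simp add: sum.atMost_Suc_shift singular_face_null_cone_0 H(2) sum_negf del: sum.atMost_Suc)
    also have "(\<Sum>k\<le>n. (-1) ^ k * z n (singular_face (Suc n) (Suc k) (null_cone n H s))) =
        coboundary X e n s"
      using s singular_simplex_singular_face[OF s] sing
      by (auto simp: Suc coboundary_def e_def singular_face_null_cone_Suc[where H = H, OF H(3)] simp del: sum.atMost_Suc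
          intro!: sum.cong)
    finally show ?thesis using sing[OF s] by (simp add: cochain_pullback_def)
  qed
  ultimately show ?thesis by blast
qed

section \<open>Cocycles that vanish on small simplices\<close>

lemma chain_boundary_power_singular_subdivision:
  assumes "singular_chain p X c"
  shows "chain_boundary p ((singular_subdivision p ^^ i) c) =
         (singular_subdivision (p - 1) ^^ i) (chain_boundary p c)"
    and "singular_chain p X ((singular_subdivision p ^^ i) c)"
proof -
  have "chain_boundary p ((singular_subdivision p ^^ i) c) =
         (singular_subdivision (p - 1) ^^ i) (chain_boundary p c) \<and>
        singular_chain p X ((singular_subdivision p ^^ i) c)"
    using assms
    by (induction i) (auto simp: singular_chain_singular_subdivision chain_boundary_singular_subdivision[of p X])
  then show "chain_boundary p ((singular_subdivision p ^^ i) c) =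
         (singular_subdivision (p - 1) ^^ i) (chain_boundary p c)"
    and "singular_chain p X ((singular_subdivision p ^^ i) c)" by auto
qed

text \<open>If \<open>h\<close> is the chain homotopy from the identity to the subdivision \<open>sd\<close>, then the cocycle is
  the coboundary of \<open>\<tau> \<mapsto> - (\<Sum>i. \<phi> (h (sd\<^sup>i \<tau>)))\<close>: all but finitely many summands vanish
  because \<open>h\<close> preserves small chains.\<close>

lemma cocycle_vanishing_on_small_simplices:
  fixes \<phi> :: "('a, 'k::field) cochain"
  assumes \<phi>: "\<phi> \<in> cocycles X"
    and opn: "\<And>U. U \<in> \<U> \<Longrightarrow> openin X U" and cover: "topspace X \<subseteq> \<Union>\<U>"
    and van: "\<And>n s U. U \<in> \<U> \<Longrightarrow> singular_simplex n (subtopology X U) s \<Longrightarrow> \<phi> n s = 0"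
  shows "\<phi> \<in> coboundaries X"
proof -
  \<comment> \<open>One and the same \<open>h\<close> serves every space \<open>X\<close>, in
    particular the subspaces \<open>subtopology X U\<close>; this is why it preserves small
    chains.\<close>
  obtain h :: "nat \<Rightarrow> 'a chain \<Rightarrow> 'a chain" where h:
    "\<And>p. h p 0 = 0"
    "\<And>p c1 c2. h p (c1 - c2) = h p c1 - h p c2"
    "\<And>p X c. singular_chain p X c \<Longrightarrow> singular_chain (Suc p) X (h p c)"
    "\<And>p X c. singular_chain p X c \<Longrightarrow>
        chain_boundary (Suc p) (h p c) + h (p - Suc 0) (chain_boundary p c) = singular_subdivision p c - c"
    using chain_homotopic_singular_subdivision by blast
  define small where "small n s \<longleftrightarrow> (\<exists>U\<in>\<U>. singular_simplex n (subtopology X U) s)" for n s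
  have small_0: "\<phi> n s = 0" if "small n s" for n s
    using that van by (auto simp: small_def)
  have eval_small: "chain_eval (\<phi> n) c = 0" "chain_eval (\<phi> (Suc n)) (h n c) = 0"
    if "Poly_Mapping.keys c \<subseteq> Collect (small n)" for n c
  proof -
    show "chain_eval (\<phi> n) c = 0"
      using that small_0 by (intro chain_eval_eq_0) blast
    show "chain_eval (\<phi> (Suc n)) (h n c) = 0"
      using that
    proof (induction rule: frag_induction)
      case (one s)
      then obtain U where U: "U \<in> \<U>" "singular_simplex n (subtopology X U) s" by (auto simp: small_def)
      then have "singular_chain (Suc n) (subtopology X U) (h n (frag_of s))"
        by (intro h(3)) (simp add: singular_chain_of)
      then show ?case
        using van[OF U(1)] by (intro chain_eval_eq_0) (auto simp: singular_chain_def)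
    qed (auto simp: h chain_eval_diff)
  qed
  have "\<exists>N. \<forall>m\<ge>N. Poly_Mapping.keys ((singular_subdivision n ^^ m) (frag_of s)) \<subseteq> Collect (small n)"
    if "singular_simplex n X s" for n s
  proof -
    have sc: "singular_chain n X (frag_of s)" using that by (simp add: singular_chain_of)
    obtain N where N: "\<And>m f. \<lbrakk>N \<le> m; f \<in> Poly_Mapping.keys ((singular_subdivision n ^^ m) (frag_of s))\<rbrakk>
                      \<Longrightarrow> \<exists>V\<in>\<U>. f \<in> standard_simplex n \<rightarrow> V"
      using sufficient_iterated_singular_subdivision_exists[OF opn cover sc] by blast
    have "small n f" if "N \<le> m" "f \<in> Poly_Mapping.keys ((singular_subdivision n ^^ m) (frag_of s))" for m f
      using N[OF that] chain_boundary_power_singular_subdivision(2)[OF sc, of m] that(2)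
      by (auto simp: small_def singular_simplex_subtopology singular_chain_def image_subset_iff_funcset)
    then show ?thesis by blast
  qed
  then obtain M where M: "\<And>n s m. singular_simplex n X s \<Longrightarrow> M n s \<le> m \<Longrightarrow>
      Poly_Mapping.keys ((singular_subdivision n ^^ m) (frag_of s)) \<subseteq> Collect (small n)"
    by metis
  define L where "L n i c = chain_eval (\<phi> (Suc n)) (h n ((singular_subdivision n ^^ i) c))" for n i c
  have L0: "L n i 0 = 0" and Ldiff: "L n i (a - b) = L n i a - L n i b" for n i a b
    by (auto simp: L_def h singular_subdivision_power_diff chain_eval_diff)
  define \<psi> where "\<psi> n s = (if singular_simplex n X s then - (\<Sum>i<M n s. L n i (frag_of s)) else 0)" for n s
  have eval_psi: "chain_eval (\<psi> n) c = - (\<Sum>i<N. L n i c)"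
    if "Poly_Mapping.keys c \<subseteq> {s. singular_simplex n X s \<and> M n s \<le> N}" for n c N
    using that
  proof (induction rule: frag_induction)
    case (one s)
    have "(\<Sum>i<M n s. L n i (frag_of s)) = (\<Sum>i<N. L n i (frag_of s))"
      using one M[of n s] by (intro sum.mono_neutral_left) (auto simp: L_def eval_small)
    then show ?case using one by (simp add: \<psi>_def)
  qed (auto simp: L0 Ldiff chain_eval_diff sum_subtractf)
  have "{n. \<exists>s. \<psi> n s \<noteq> 0} \<subseteq> Suc -` {n. \<exists>s. \<phi> n s \<noteq> 0}"
  proof
    fix n assume "n \<in> {n. \<exists>s. \<psi> n s \<noteq> 0}"
    then obtain s i where "L n i (frag_of s) \<noteq> 0"
      by (auto simp: \<psi>_def split: if_splits elim!: sum.not_neutral_contains_not_neutral)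
    then have "\<exists>s. \<phi> (Suc n) s \<noteq> 0"
      unfolding L_def using chain_eval_eq_0[of _ "\<phi> (Suc n)"] by blast
    then show "n \<in> Suc -` {n. \<exists>s. \<phi> n s \<noteq> 0}" by simp
  qed
  then have "finite {n. \<exists>s. \<psi> n s \<noteq> 0}"
    by (rule finite_subset) (use \<phi> in \<open>simp add: cocycles_def cochains_def finite_vimageI del: vimage_Collect_eq\<close>)
  then have "\<psi> \<in> cochains X" by (simp add: cochains_def \<psi>_def)
  moreover have "coboundary X \<psi> = \<phi>"
  proof (intro ext)
    fix n s
    show "coboundary X \<psi> n s = \<phi> n s"
    proof (cases "singular_simplex n X s")
      case False
      then show ?thesis using \<phi> by (simp add: coboundary_def cocycles_def cochains_def)
    next
      case s: True
      show ?thesis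
      proof (cases n)
        \<comment> \<open>There is nothing to subdivide in degree 0: a point already lies in a
          member of the cover.\<close>
        case 0
        have "s (\<lambda>j. if j = 0 then 1 else 0) \<in> topspace X"
          using s by (simp add: singular_simplex_def continuous_map_def 0 standard_simplex_0)
        then obtain U where "U \<in> \<U>" "s (\<lambda>j. if j = 0 then 1 else 0) \<in> U"
          using cover by blast
        then have "singular_simplex n (subtopology X U) s"
          using s by (simp add: singular_simplex_subtopology 0 standard_simplex_0)
        then show ?thesis using van \<open>U \<in> \<U>\<close> 0 by (simp add: coboundary_def)
      next
        case (Suc m)
        have sc: "singular_chain n X (frag_of s)" using s by (simp add: singular_chain_of)
        have keys: "Poly_Mapping.keys (chain_boundary n (frag_of s)) \<subseteq> {s. singular_simplex m X s}"
          using singular_chain_boundary[OF sc] by (simp add: Suc singular_chain_def)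
        \<comment> \<open>The number of summands in \<psi> depends on the simplex. A common bound
          for \<open>s\<close> and all its faces makes the sums equally long, so that they
          telescope.\<close>
        define N where "N = Max (insert (M n s) (M m ` Poly_Mapping.keys (chain_boundary n (frag_of s))))"
        have N: "M n s \<le> N" "\<And>t. t \<in> Poly_Mapping.keys (chain_boundary n (frag_of s)) \<Longrightarrow> M m t \<le> N"
          by (auto simp: N_def)
        \<comment> \<open>The chain homotopy identity evaluated by \<phi>: the boundary of
          \<open>h\<close> contributes nothing because \<phi> is a cocycle.\<close>
        have step: "L m i (chain_boundary n (frag_of s)) =
            chain_eval (\<phi> n) ((singular_subdivision n ^^ Suc i) (frag_of s)) -
            chain_eval (\<phi> n) ((singular_subdivision n ^^ i) (frag_of s))" for i
        proof -
          let ?c = "(singular_subdivision n ^^ i) (frag_of s)"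
          have c: "singular_chain n X ?c" by (rule chain_boundary_power_singular_subdivision(2)[OF sc])
          have "chain_eval (\<phi> n) (chain_boundary (Suc n) (h n ?c)) = 0"
            using chain_eval_coboundary[of "Suc n" X "h n ?c" \<phi>] h(3)[OF c] \<phi>
            by (simp add: cocycles_def chain_eval_def)
          moreover have "chain_boundary (Suc n) (h n ?c) + h m (chain_boundary n ?c) =
              singular_subdivision n ?c - ?c"
            using h(4)[OF c] by (simp add: Suc)
          ultimately have "chain_eval (\<phi> n) (h m (chain_boundary n ?c)) =
              chain_eval (\<phi> n) (singular_subdivision n ?c) - chain_eval (\<phi> n) ?c"
            by (metis add_0 chain_eval_add chain_eval_diff)
          then show ?thesis
            using chain_boundary_power_singular_subdivision(1)[OF sc, of i] by (simp add: L_def Suc)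
        qed
        have "coboundary X \<psi> n s = - (\<Sum>i<N. L m i (chain_boundary n (frag_of s)))"
          using eval_psi[of "chain_boundary n (frag_of s)" m N] keys N s
          by (auto simp: coboundary_chain_eval Suc)
        also have "\<dots> = chain_eval (\<phi> n) (frag_of s) -
            chain_eval (\<phi> n) ((singular_subdivision n ^^ N) (frag_of s))"
          unfolding step by (subst sum_lessThan_telescope) simp
        also have "\<dots> = \<phi> n s"
          using eval_small(1)[OF M[OF s N(1)]] by simp
        finally show ?thesis .
      qed
    qed
  qed
  ultimately show ?thesis unfolding coboundaries_def by blast
qed

section \<open>The cup-length of a map is at most its category\<close>

lemma cup_product_vanishing_left:
  assumes "\<And>n s. singular_simplex n (subtopology X U) s \<Longrightarrow> c n s = 0"
    and "singular_simplex n (subtopology X U) s"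
  shows "cup_product X c d n s = 0"
  using assms singular_simplex_front_face[OF assms(2)] by (auto simp: cup_product_def)

lemma cup_product_vanishing_right:
  assumes "\<And>n s. singular_simplex n (subtopology X U) s \<Longrightarrow> d n s = 0"
    and "singular_simplex n (subtopology X U) s"
  shows "cup_product X c d n s = 0"
  using assms singular_simplex_back_face[OF assms(2)] by (auto simp: cup_product_def)

lemma foldr_mult_cohomology_class:
  assumes "set zs \<subseteq> cocycles X"
  defines "u \<equiv> \<lambda>n s. if n = 0 \<and> singular_simplex 0 X s then 1 else 0 :: 'k::field"
  shows "foldr (rcoset_mult (cocycle_ring X) (coboundaries X)) (map (cohomology_class X) zs)
           (cohomology_class X u) = cohomology_class X (foldr (cup_product X) zs u)"
    and "foldr (cup_product X) zs u \<in> cocycles X"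
proof -
  have "foldr (rcoset_mult (cocycle_ring X) (coboundaries X)) (map (cohomology_class X) zs)
           (cohomology_class X u) = cohomology_class X (foldr (cup_product X) zs u) \<and>
        foldr (cup_product X) zs u \<in> cocycles X"
    using assms(1) by (induction zs) (auto simp: u_def cocycles_one mult_cohomology_class cocycles_cup_product)
  then show "foldr (rcoset_mult (cocycle_ring X) (coboundaries X)) (map (cohomology_class X) zs)
           (cohomology_class X u) = cohomology_class X (foldr (cup_product X) zs u)"
    and "foldr (cup_product X) zs u \<in> cocycles X" by auto
qed

lemma foldr_cup_product_vanishing:
  assumes "z \<in> set zs" "\<And>n s. singular_simplex n (subtopology X U) s \<Longrightarrow> z n s = 0"
    and "singular_simplex n (subtopology X U) s"
  shows "foldr (cup_product X) zs u n s = 0"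
  using assms(1,3)
proof (induction zs arbitrary: n s)
  case (Cons w zs)
  show ?case
  proof (cases "z = w")
    case True
    then show ?thesis using Cons.prems assms(2) by (auto intro: cup_product_vanishing_left)
  next
    case False
    then show ?thesis using Cons by (auto intro: cup_product_vanishing_right)
  qed
qed simp

text \<open>The factor at position \<open>i\<close> is represented by a cocycle vanishing on
  \<open>U i\<close>. A product of more than \<open>n\<close> factors then vanishes on each of the
  \<open>n + 1\<close> members of the cover, hence on all small simplices, and is therefore a
  coboundary.\<close>

theorem cup_length_map_le_cat_map:
  assumes f: "continuous_map X Y f"
  shows "cup_length_map (K :: 'k::field itself) X Y f \<le> cat_map X Y f"
proof -
  let ?H = "cohomology_map X f :: ('b, 'k) cochain set \<Rightarrow> ('a, 'k) cochain set"
  let ?u = "\<lambda>n s. if n = 0 \<and> singular_simplex 0 X s then 1 else 0 :: 'k"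
  let ?m = "rcoset_mult (cocycle_ring X) (coboundaries X :: ('a, 'k) cochain set)"
  have "length xs \<le> n"
    if U: "\<And>i. i \<le> n \<Longrightarrow> openin X (U i) \<and> null_homotopic_on X Y f (U i)" "(\<Union>i\<le>n. U i) = topspace X"
      and xs: "\<forall>x\<in>set xs. \<exists>p>0. x \<in> ?H ` cohomology_grade Y p"
      and nz: "foldr ?m xs (cohomology_class X ?u) \<noteq> coboundaries X"
    for n xs and U :: "nat \<Rightarrow> 'a set"
  proof (rule ccontr)
    assume len: "\<not> length xs \<le> n"
    have "\<exists>z. z \<in> cocycles X \<and> x = cohomology_class X z \<and>
        (i \<le> n \<longrightarrow> (\<forall>n s. singular_simplex n (subtopology X (U i)) s \<longrightarrow> z n s = 0))"
      if x: "x \<in> set xs" for x i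
    proof -
      obtain p y where y: "0 < p" "y \<in> cocycles Y" "\<forall>n s. n \<noteq> p \<longrightarrow> y n s = 0"
        "x = ?H (cohomology_class Y y)"
        using xs x unfolding cohomology_grade_eq by blast
      let ?z = "cochain_pullback X f y"
      have z: "?z \<in> cocycles X" "x = cohomology_class X ?z"
        using y(4) cocycles_pullback[OF f y(2)] cohomology_map_class[OF f, of y] by simp_all
      show ?thesis
      proof (cases "i \<le> n")
        case True
        obtain e where e: "e \<in> cochains X"
          "\<And>n s. singular_simplex n (subtopology X (U i)) s \<Longrightarrow> ?z n s = coboundary X e n s"
          using pullback_coboundary_on[OF _ y(2), of X f "U i"] U(1)[OF True] y(1,3) by force
        have "(\<lambda>n s. ?z n s - coboundary X e n s) \<in> cocycles X"
          using e(1) z(1)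
          by (auto simp: cocycles_def cochains_diff cochains_coboundary coboundary_diff coboundary_coboundary)
        moreover have "coboundary X e \<in> coboundaries X" using e(1) by (simp add: coboundaries_def)
        then have "x = cohomology_class X (\<lambda>n s. ?z n s - coboundary X e n s)"
          unfolding z(2) by (intro cohomology_class_eqI) simp
        ultimately show ?thesis
          using e(2) by (intro exI[of _ "\<lambda>n s. ?z n s - coboundary X e n s"]) auto
      qed (use z in blast)
    qed
    then obtain w where w: "\<And>x i. x \<in> set xs \<Longrightarrow> w x i \<in> cocycles X"
      "\<And>x i. x \<in> set xs \<Longrightarrow> x = cohomology_class X (w x i)"
      "\<And>x i n' s. x \<in> set xs \<Longrightarrow> i \<le> n \<Longrightarrow> singular_simplex n' (subtopology X (U i)) s \<Longrightarrow> w x i n' s = 0"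
      by metis
    \<comment> \<open>The representative depends on the position as well as on the class, because
      one class may occur several times in \<open>xs\<close>.\<close>
    define ws where "ws = map (\<lambda>i. w (xs ! i) i) [0..<length xs]"
    have ws: "set ws \<subseteq> cocycles X" using w(1) by (auto simp: ws_def)
    have xs_eq: "xs = map (cohomology_class X) ws"
      using w(2) by (intro nth_equalityI) (auto simp: ws_def simp flip: w(2))
    have "foldr (cup_product X) ws ?u \<in> coboundaries X"
    proof (rule cocycle_vanishing_on_small_simplices)
      show "foldr (cup_product X) ws ?u \<in> cocycles X"
        by (rule foldr_mult_cohomology_class(2)[OF ws])
      show "openin X V" if "V \<in> U ` {..n}" for V using that U(1) by auto
      show "topspace X \<subseteq> \<Union> (U ` {..n})" using U(2) by simp
      fix n' s V assume "V \<in> U ` {..n}" and s: "singular_simplex n' (subtopology X V) s"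
      then obtain i where i: "i \<le> n" "V = U i" by auto
      then have "w (xs ! i) i \<in> set ws" using len by (auto simp: ws_def)
      then show "foldr (cup_product X) ws ?u n' s = 0"
        using w(3)[of "xs ! i" i] i len s 
        by (intro foldr_cup_product_vanishing[where U = V and z = "w (xs ! i) i"]) auto
    qed
    then have "foldr ?m xs (cohomology_class X ?u) = coboundaries X"
      unfolding xs_eq foldr_mult_cohomology_class(1)[OF ws] by (rule cohomology_class_eq_coboundaries)
    then show False using nz by simp
  qed
  then show ?thesis
    unfolding cup_length_map_def graded_ring_length_def cat_map_def Let_def
    by (intro Inf_greatest Sup_least) (auto; blast)
qed

section \<open>Continuity and geometric realizations\<close>

lemma closedin_closed_cell:
  assumes "finite S"
  shows "closedin (powertop_real UNIV) (closed_cell S)"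
proof -
  let ?X = "powertop_real UNIV"
  have eq: "closed_cell S = (\<Inter>v. {u \<in> topspace ?X. u v \<in> {0..}}) \<inter>
      (\<Inter>v\<in>UNIV. {u \<in> topspace ?X. u v \<in> (if v \<in> S then UNIV else {0})}) \<inter>
      {u \<in> topspace ?X. (\<Sum>v\<in>S. u v) \<in> {1}}"
    by (auto simp: closed_cell_def split: if_splits)
  show ?thesis
    unfolding eq using assms
    by (intro closedin_Int closedin_INT closedin_continuous_map_preimage[where Y = euclideanreal]
        continuous_map_sum continuous_map_product_projection) auto
qed

lemma closed_cell_mono:
  assumes "S \<subseteq> T" "finite T"
  shows "closed_cell S \<subseteq> closed_cell T"
proof
  fix u assume u: "u \<in> closed_cell S"
  then have "(\<Sum>v\<in>T. u v) = (\<Sum>v\<in>S. u v)"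
    using assms by (intro sum.mono_neutral_right) (auto simp: closed_cell_def)
  then show "u \<in> closed_cell T"
    using u assms by (auto simp: closed_cell_def)
qed

lemma convex_closed_cell:
  assumes "u \<in> closed_cell S" "w \<in> closed_cell S" "t \<in> {0..1}"
  shows "(\<lambda>v. (1 - t) * u v + t * w v) \<in> closed_cell S"
  using assms by (auto simp: closed_cell_def sum.distrib simp flip: sum_distrib_left)

lemma closedin_realization_cell:
  assumes "closedin (geometric_realization K) C" "S \<in> K" "finite S"
  shows "closedin (powertop_real UNIV) (C \<inter> closed_cell S)"
proof -
  let ?D = "subtopology (powertop_real UNIV) (closed_cell S)"
  let ?T = "topspace (geometric_realization K)"
  have "openin ?D ((?T - C) \<inter> closed_cell S)"
    using assms(1,2) unfolding closedin_def openin_geometric_realization by blast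
  then have "closedin ?D (topspace ?D - (?T - C) \<inter> closed_cell S)"
    by (rule closedin_diff[OF closedin_topspace])
  moreover have "topspace ?D - (?T - C) \<inter> closed_cell S = C \<inter> closed_cell S"
    using assms(2) by (auto simp: topspace_geometric_realization)
  ultimately show ?thesis
    using closedin_closed_cell[OF assms(3)] by (metis closedin_trans_full)
qed

text \<open>The weak topology is in general finer than the product topology. Finitely many cells
  bridge the gap: a closed set meets each of them in a set closed for the product topology, and a
  finite union of these stays closed.\<close>

lemma continuous_map_into_realization:
  assumes f: "continuous_map Z (powertop_real UNIV) f"
    and F: "finite F" "F \<subseteq> K" "\<And>S. S \<in> F \<Longrightarrow> finite S" "f ` topspace Z \<subseteq> (\<Union>S\<in>F. closed_cell S)"
  shows "continuous_map Z (geometric_realization K) f"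
  unfolding continuous_map_closedin
proof (intro conjI allI impI ballI funcsetI)
  fix z assume "z \<in> topspace Z"
  then obtain S where "S \<in> F" "f z \<in> closed_cell S" using F(4) by blast
  then show "f z \<in> topspace (geometric_realization K)"
    using F(2) by (auto simp: topspace_geometric_realization)
next
  fix C assume C: "closedin (geometric_realization K) C"
  have "closedin (powertop_real UNIV) (\<Union>S\<in>F. C \<inter> closed_cell S)"
    using F closedin_realization_cell[OF C] by (intro closedin_Union) auto
  then have "closedin Z {z \<in> topspace Z. f z \<in> (\<Union>S\<in>F. C \<inter> closed_cell S)}"
    by (rule closedin_continuous_map_preimage[OF f])
  moreover have "{z \<in> topspace Z. f z \<in> (\<Union>S\<in>F. C \<inter> closed_cell S)} = {z \<in> topspace Z. f z \<in> C}"
    using F by blast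
  ultimately show "closedin Z {z \<in> topspace Z. f z \<in> C}" by (simp only:)
qed

lemma continuous_map_from_realization:
  assumes "\<And>S. S \<in> K \<Longrightarrow> continuous_map (subtopology (powertop_real UNIV) (closed_cell S)) Y g"
  shows "continuous_map (geometric_realization K) Y g"
  unfolding continuous_map_def
proof (intro conjI allI impI funcsetI)
  fix u assume "u \<in> topspace (geometric_realization K)"
  then show "g u \<in> topspace Y"
    using assms by (force simp: topspace_geometric_realization continuous_map_def)
next
  fix V assume V: "openin Y V"
  have "openin (subtopology (powertop_real UNIV) (closed_cell S))
      ({u \<in> topspace (geometric_realization K). g u \<in> V} \<inter> closed_cell S)" if "S \<in> K" for S
  proof -
    have "{u \<in> topspace (geometric_realization K). g u \<in> V} \<inter> closed_cell S =
        {u \<in> topspace (subtopology (powertop_real UNIV) (closed_cell S)). g u \<in> V}"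
      using that by (auto simp: topspace_geometric_realization)
    then show ?thesis
      using openin_continuous_map_preimage[OF assms[OF that] V] by simp
  qed
  then show "openin (geometric_realization K) {u \<in> topspace (geometric_realization K). g u \<in> V}"
    unfolding openin_geometric_realization by (auto simp: topspace_geometric_realization)
qed

text \<open>The product of the realization with the interval carries the weak topology as well; this is
  where compactness of closed subintervals enters, through the tube lemma.\<close>

lemma continuous_map_prod_realization:
  assumes U: "openin (geometric_realization K) U"
    and h: "\<And>S. S \<in> K \<Longrightarrow> continuous_map
      (prod_topology (top_of_set {0..1::real}) (subtopology (powertop_real UNIV) (closed_cell S \<inter> U))) Y h"
  shows "continuous_map (prod_topology (top_of_set {0..1::real}) (subtopology (geometric_realization K) U)) Y h"
proof -
  let ?I = "top_of_set {0..1::real}"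
  let ?G = "geometric_realization K"
  let ?C = "\<lambda>S. subtopology (powertop_real UNIV) (closed_cell S \<inter> U)"
  have UT: "U \<subseteq> (\<Union>S\<in>K. closed_cell S)"
    using openin_subset[OF U] by (simp add: topspace_geometric_realization)
  show ?thesis
    unfolding continuous_map_def
  proof (intro conjI allI impI funcsetI)
    fix p assume "p \<in> topspace (prod_topology ?I (subtopology ?G U))"
    then obtain t u S where "p = (t, u)" "t \<in> {0..1}" "u \<in> U" "S \<in> K" "u \<in> closed_cell S"
      using UT by auto
    then show "h p \<in> topspace Y" using h[of S] by (auto simp: continuous_map_def Pi_iff)
  next
    fix V assume V: "openin Y V"
    show "openin (prod_topology ?I (subtopology ?G U))
        {p \<in> topspace (prod_topology ?I (subtopology ?G U)). h p \<in> V}"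
      unfolding openin_prod_topology_alt
    proof (intro allI impI)
      fix t u assume tu: "(t, u) \<in> {p \<in> topspace (prod_topology ?I (subtopology ?G U)). h p \<in> V}"
      then have t: "t \<in> {0..1}" and u: "u \<in> U" and htu: "h (t, u) \<in> V" by auto
      obtain S where S: "S \<in> K" "u \<in> closed_cell S" using u UT by blast
      have "continuous_map ?I Y (h \<circ> (\<lambda>t. (t, u)))"
        using S u by (intro continuous_map_compose[OF _ h[OF S(1)]]) (auto simp: continuous_map_pairwise o_def)
      then have "openin ?I {s \<in> topspace ?I. (h \<circ> (\<lambda>t. (t, u))) s \<in> V}"
        using V by (rule openin_continuous_map_preimage)
      then obtain e where e: "0 < e" "\<And>s. s \<in> {0..1} \<Longrightarrow> dist s t < e \<Longrightarrow> h (s, u) \<in> V"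
        unfolding openin_euclidean_subtopology_iff using t htu by auto
      define J where "J = {0..1} \<inter> cball t (e / 2)"
      have J: "compactin ?I J" "\<And>s. s \<in> J \<Longrightarrow> h (s, u) \<in> V"
        using e by (auto simp: J_def compactin_subtopology dist_commute intro: compact_Int_closed)
      \<comment> \<open>\<open>W\<close> keeps the whole segment over \<open>J\<close> inside the
        preimage of \<open>V\<close>. The tube lemma makes its trace on every cell open, which is
        all that the weak topology asks.\<close>
      define W where "W = {w \<in> U. \<forall>s\<in>J. h (s, w) \<in> V}"
      have "openin (subtopology (powertop_real UNIV) (closed_cell T)) (W \<inter> closed_cell T)" if T: "T \<in> K" for T
      proof -
        have "openin (?C T) (W \<inter> closed_cell T)"
        proof (subst openin_subopen, intro ballI)
          fix w assume w: "w \<in> W \<inter> closed_cell T"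
          let ?P = "{p \<in> topspace (prod_topology ?I (?C T)). h p \<in> V}"
          have "openin (prod_topology ?I (?C T)) ?P"
            using h[OF T] V by (rule openin_continuous_map_preimage)
          moreover have "J \<times> {w} \<subseteq> ?P" using w by (auto simp: W_def J_def)
          moreover have "w \<in> topspace (?C T)" using w by (auto simp: W_def)
          ultimately have "\<exists>A B. openin ?I A \<and> openin (?C T) B \<and> J \<subseteq> A \<and> w \<in> B \<and> A \<times> B \<subseteq> ?P"
            using J(1) by (intro tube_lemma_left)
          then obtain A B where AB: "openin (?C T) B" "J \<subseteq> A" "w \<in> B" "A \<times> B \<subseteq> ?P"
            by (elim exE conjE)
          have "B \<subseteq> closed_cell T \<inter> U" using openin_subset[OF AB(1)] by auto
          moreover have "h (s, w') \<in> V" if "s \<in> J" "w' \<in> B" for s w' using AB(2,4) that by blast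
          ultimately have "B \<subseteq> W \<inter> closed_cell T" by (auto simp: W_def)
          then show "\<exists>B. openin (?C T) B \<and> w \<in> B \<and> B \<subseteq> W \<inter> closed_cell T" using AB by blast
        qed
        moreover have "?C T = subtopology (subtopology (powertop_real UNIV) (closed_cell T)) (U \<inter> closed_cell T)"
          by (simp add: subtopology_subtopology Int_commute Int_left_commute)
        moreover have "openin (subtopology (powertop_real UNIV) (closed_cell T)) (U \<inter> closed_cell T)"
          using U T unfolding openin_geometric_realization by blast
        ultimately show ?thesis using openin_trans_full by metis
      qed
      then have "openin ?G W"
        using UT unfolding openin_geometric_realization by (auto simp: W_def)
      then have "openin (subtopology ?G U) W"
        by (auto simp: openin_subtopology W_def)
      moreover have "openin ?I ({0..1} \<inter> ball t (e / 2))"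
        by (rule openin_open_Int) simp
      moreover have "({0..1} \<inter> ball t (e / 2)) \<times> W \<subseteq> {p \<in> topspace (prod_topology ?I (subtopology ?G U)). h p \<in> V}"
        using UT by (auto simp: W_def J_def topspace_geometric_realization)
      moreover have "t \<in> {0..1} \<inter> ball t (e / 2)" "u \<in> W" using t u e J by (auto simp: W_def)
      ultimately show "\<exists>A B. openin ?I A \<and> openin (subtopology ?G U) B \<and> t \<in> A \<and> u \<in> B \<and>
          A \<times> B \<subseteq> {p \<in> topspace (prod_topology ?I (subtopology ?G U)). h p \<in> V}"
        by blast
    qed
  qed
qed

text \<open>The straight-line homotopy stays in the common simplex by convexity, and a single finite
  target simplex per cell gives continuity into the weak topology.\<close>

lemma homotopic_in_common_cells:
  assumes U: "openin (geometric_realization K) U"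
    and f: "\<And>S. S \<in> K \<Longrightarrow> continuous_map (subtopology (powertop_real UNIV) (closed_cell S \<inter> U)) (powertop_real UNIV) f"
    and g: "\<And>S. S \<in> K \<Longrightarrow> continuous_map (subtopology (powertop_real UNIV) (closed_cell S \<inter> U)) (powertop_real UNIV) g"
    and cells: "\<And>S. S \<in> K \<Longrightarrow> closed_cell S \<inter> U \<noteq> {} \<Longrightarrow>
      \<exists>T\<in>L. finite T \<and> f ` (closed_cell S \<inter> U) \<subseteq> closed_cell T \<and> g ` (closed_cell S \<inter> U) \<subseteq> closed_cell T"
  shows "homotopic_with (\<lambda>h. True) (subtopology (geometric_realization K) U) (geometric_realization L) f g"
proof -
  define h where "h = (\<lambda>(t, u) v. (1 - t) * f u v + t * g u v)"
  have "continuous_map (prod_topology (top_of_set {0..1::real}) (subtopology (powertop_real UNIV) (closed_cell S \<inter> U)))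
      (geometric_realization L) h" (is "continuous_map ?P _ _") if S: "S \<in> K" for S
  proof (cases "closed_cell S \<inter> U = {}")
    case True
    then show ?thesis by (simp add: continuous_map_on_empty prod_topology_trivial_iff)
  next
    case False
    obtain T where T: "T \<in> L" "finite T" "f ` (closed_cell S \<inter> U) \<subseteq> closed_cell T"
      "g ` (closed_cell S \<inter> U) \<subseteq> closed_cell T"
      using cells[OF S False] by blast
    have "continuous_map ?P euclideanreal (\<lambda>p. h p v)" for v
    proof -
      have "continuous_map ?P euclideanreal (\<lambda>p. k (snd p) v)"
        if "continuous_map (subtopology (powertop_real UNIV) (closed_cell S \<inter> U)) (powertop_real UNIV) k" for k
      proof -
        have "continuous_map (subtopology (powertop_real UNIV) (closed_cell S \<inter> U)) euclideanreal (\<lambda>u. k u v)"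
          using that by (simp add: continuous_map_componentwise_UNIV)
        from continuous_map_compose[OF continuous_map_snd this] show ?thesis by (simp add: o_def)
      qed
      from this[OF f[OF S]] this[OF g[OF S]]
      have "continuous_map ?P euclideanreal (\<lambda>p. f (snd p) v)" "continuous_map ?P euclideanreal (\<lambda>p. g (snd p) v)" .
      moreover have "continuous_map ?P euclideanreal fst"
        by (rule continuous_map_into_fulltopology[OF continuous_map_fst])
      ultimately show ?thesis
        unfolding h_def case_prod_beta by (intro continuous_map_add continuous_map_real_mult continuous_map_diff) auto
    qed
    then have "continuous_map ?P (powertop_real UNIV) h"
      by (simp add: continuous_map_componentwise_UNIV)
    moreover have "h ` topspace ?P \<subseteq> closed_cell T"
      using T(3,4) by (auto simp: h_def intro!: convex_closed_cell)
    ultimately show ?thesis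
      using T by (intro continuous_map_into_realization[where F = "{T}"]) auto
  qed
  then have "continuous_map (prod_topology (top_of_set {0..1::real}) (subtopology (geometric_realization K) U))
      (geometric_realization L) h"
    by (rule continuous_map_prod_realization[OF U])
  then show ?thesis
    unfolding homotopic_with_def by (intro exI[of _ h]) (auto simp: h_def)
qed

section \<open>Contiguous vertex maps\<close>

text \<open>The subcomplex spanned by \<open>A\<close> need not be open. This neighbourhood of it
  is, and it can be pushed back onto that subcomplex, so a cover of the vertex set yields an open
  cover.\<close>

definition open_star_union :: "'a set set \<Rightarrow> 'a set \<Rightarrow> ('a \<Rightarrow> real) set" where
  "open_star_union K A = {u \<in> topspace (geometric_realization K). \<exists>v\<in>A. u v \<noteq> 0}"

text \<open>The mass outside \<open>A\<close> is discarded, the rest is normalised and moved by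
  \<phi>. Summing over the support of \<open>u\<close> instead of a simplex gives one formula valid
  on all cells.\<close>

definition push :: "'a set \<Rightarrow> ('a \<Rightarrow> 'a) \<Rightarrow> ('a \<Rightarrow> real) \<Rightarrow> 'a \<Rightarrow> real" where
  "push A \<phi> u = (\<lambda>w. (\<Sum>v | v \<in> A \<and> u v \<noteq> 0 \<and> \<phi> v = w. u v) / (\<Sum>v | v \<in> A \<and> u v \<noteq> 0. u v))"

lemma openin_open_star_union: "openin (geometric_realization K) (open_star_union K A)"
  unfolding openin_geometric_realization
proof (intro conjI ballI)
  fix S assume S: "S \<in> K"
  let ?D = "subtopology (powertop_real UNIV) (closed_cell S)"
  have "openin ?D {u \<in> topspace ?D. u v \<in> - {0}}" for v
    by (rule openin_continuous_map_preimage[where Y = euclideanreal])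
      (auto intro: continuous_map_from_subtopology continuous_map_product_projection)
  then have "openin ?D (\<Union>v\<in>A. {u \<in> topspace ?D. u v \<in> - {0}})" by blast
  moreover have "(\<Union>v\<in>A. {u \<in> topspace ?D. u v \<in> - {0}}) = open_star_union K A \<inter> closed_cell S"
    using S by (auto simp: open_star_union_def topspace_geometric_realization)
  ultimately show "openin ?D (open_star_union K A \<inter> closed_cell S)" by simp
qed (auto simp: open_star_union_def topspace_geometric_realization)

lemma push_on_cell:
  assumes "u \<in> closed_cell S" "finite S"
  shows "push A \<phi> u = (\<lambda>w. (\<Sum>v\<in>{v \<in> S \<inter> A. \<phi> v = w}. u v) / (\<Sum>v\<in>S \<inter> A. u v))"
proof -
  have u: "u v = 0" if "v \<notin> S" for v using assms that by (simp add: closed_cell_def)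
  have "(\<Sum>v | v \<in> A \<and> u v \<noteq> 0 \<and> \<phi> v = w. u v) = (\<Sum>v\<in>{v \<in> S \<inter> A. \<phi> v = w}. u v)" for w
    using assms(2) u by (intro sum.mono_neutral_left) auto
  moreover have "(\<Sum>v | v \<in> A \<and> u v \<noteq> 0. u v) = (\<Sum>v\<in>S \<inter> A. u v)"
    using assms(2) u by (intro sum.mono_neutral_left) auto
  ultimately show ?thesis by (simp add: push_def)
qed

lemma open_star_union_mass:
  assumes "u \<in> closed_cell S" "finite S" "u \<in> open_star_union K A"
  shows "0 < (\<Sum>v\<in>S \<inter> A. u v)"
proof -
  obtain v where v: "v \<in> A" "u v \<noteq> 0" using assms by (auto simp: open_star_union_def)
  then have "v \<in> S \<inter> A" "0 < u v" using assms by (auto simp: closed_cell_def less_le)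
  then show ?thesis
    using assms by (intro sum_pos2[where i = v]) (auto simp: closed_cell_def)
qed

lemma push_in_closed_cell:
  assumes "u \<in> closed_cell S" "finite S" "u \<in> open_star_union K A"
  shows "push A \<phi> u \<in> closed_cell (\<phi> ` (S \<inter> A))"
proof -
  have pos: "0 < (\<Sum>v\<in>S \<inter> A. u v)" by (rule open_star_union_mass[OF assms])
  have u: "0 \<le> u v" for v using assms by (simp add: closed_cell_def)
  have "(\<Sum>w\<in>\<phi> ` (S \<inter> A). \<Sum>v\<in>{v \<in> S \<inter> A. \<phi> v = w}. u v) = (\<Sum>v\<in>S \<inter> A. u v)"
    using assms(2) by (intro sum.image_gen[symmetric]) auto
  then have "(\<Sum>w\<in>\<phi> ` (S \<inter> A). push A \<phi> u w) = 1"
    using pos by (simp add: push_on_cell[OF assms(1,2)] flip: sum_divide_distrib)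
  moreover have "push A \<phi> u w = 0" if "w \<notin> \<phi> ` (S \<inter> A)" for w
  proof -
    have "{v \<in> S \<inter> A. \<phi> v = w} = {}" using that by auto
    then show ?thesis by (simp only: push_on_cell[OF assms(1,2)] sum.empty)
  qed
  moreover have "0 \<le> push A \<phi> u w" for w
    using pos u by (auto simp: push_on_cell[OF assms(1,2)] intro!: divide_nonneg_pos sum_nonneg)
  ultimately show ?thesis by (auto simp: closed_cell_def)
qed

lemma continuous_map_push:
  assumes "finite S"
  shows "continuous_map (subtopology (powertop_real UNIV) (closed_cell S \<inter> open_star_union K A))
           (powertop_real UNIV) (push A \<phi>)"
proof -
  let ?D = "subtopology (powertop_real UNIV) (closed_cell S \<inter> open_star_union K A)"
  have proj: "continuous_map ?D euclideanreal (\<lambda>u. u v)" for v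
    by (intro continuous_map_from_subtopology continuous_map_product_projection) auto
  have "continuous_map ?D euclideanreal (\<lambda>u. (\<Sum>v\<in>{v \<in> S \<inter> A. \<phi> v = w}. u v) / (\<Sum>v\<in>S \<inter> A. u v))" for w
  proof (rule continuous_map_real_divide)
    show "continuous_map ?D euclideanreal (\<lambda>u. \<Sum>v\<in>{v \<in> S \<inter> A. \<phi> v = w}. u v)"
      "continuous_map ?D euclideanreal (\<lambda>u. \<Sum>v\<in>S \<inter> A. u v)"
      using assms by (intro continuous_map_sum proj; simp)+
    show "(\<Sum>v\<in>S \<inter> A. u v) \<noteq> 0" if "u \<in> topspace ?D" for u
      using open_star_union_mass[of u S K A] assms that by simp
  qed
  then have "continuous_map ?D (powertop_real UNIV)
      (\<lambda>u w. (\<Sum>v\<in>{v \<in> S \<inter> A. \<phi> v = w}. u v) / (\<Sum>v\<in>S \<inter> A. u v))"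
    by (simp add: continuous_map_componentwise_UNIV)
  then show ?thesis
    by (rule continuous_map_eq) (use assms in \<open>auto simp: push_on_cell\<close>)
qed

text \<open>Membership in a Rips complex depends on pairwise distances only. So for a simplex
  \<open>S\<close> at scale \<open>a\<close>, testing pairs amounts to asking that the images of its
  vertices in \<open>A\<close> under \<phi> and \<psi> jointly span a simplex at scale
  \<open>b\<close>.\<close>

definition contiguous :: "'a metric \<Rightarrow> real \<Rightarrow> real \<Rightarrow> 'a set \<Rightarrow> ('a \<Rightarrow> 'a) \<Rightarrow> ('a \<Rightarrow> 'a) \<Rightarrow> bool" where
  "contiguous m a b A \<phi> \<psi> \<longleftrightarrow> \<phi> ` A \<subseteq> mspace m \<and> \<psi> ` A \<subseteq> mspace m \<and>
     (\<forall>x\<in>A. \<forall>y\<in>A. mdist m x y \<le> a \<longrightarrow>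
        mdist m (\<phi> x) (\<phi> y) \<le> b \<and> mdist m (\<psi> x) (\<psi> y) \<le> b \<and> mdist m (\<phi> x) (\<psi> y) \<le> b)"

lemma finite_rips_complex: "S \<in> rips_complex m a \<Longrightarrow> finite S"
  by (simp add: rips_complex_def)

lemma homotopic_push:
  assumes "contiguous m a b A \<phi> \<psi>"
  shows "homotopic_with (\<lambda>h. True)
    (subtopology (geometric_realization (rips_complex m a)) (open_star_union (rips_complex m a) A))
    (geometric_realization (rips_complex m b)) (push A \<phi>) (push A \<psi>)"
proof (rule homotopic_in_common_cells[OF openin_open_star_union])
  fix S assume S: "S \<in> rips_complex m a"
  then have fin: "finite S" by (rule finite_rips_complex)
  let ?V = "closed_cell S \<inter> open_star_union (rips_complex m a) A"
  show "continuous_map (subtopology (powertop_real UNIV) ?V) (powertop_real UNIV) (push A \<phi>)"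
    "continuous_map (subtopology (powertop_real UNIV) ?V) (powertop_real UNIV) (push A \<psi>)"
    by (intro continuous_map_push fin)+
  assume "?V \<noteq> {}"
  then have "S \<inter> A \<noteq> {}"
    using open_star_union_mass[OF _ fin] by fastforce
  let ?T = "\<phi> ` (S \<inter> A) \<union> \<psi> ` (S \<inter> A)"
  have "?T \<in> rips_complex m b"
    using assms S \<open>S \<inter> A \<noteq> {}\<close> mdist_commute[of m]
    unfolding rips_complex_def contiguous_def by (auto simp: image_subset_iff)
  moreover have "push A \<eta> ` ?V \<subseteq> closed_cell (\<eta> ` (S \<inter> A))" for \<eta>
    using fin by (auto intro: push_in_closed_cell)
  then have "push A \<phi> ` ?V \<subseteq> closed_cell ?T" "push A \<psi> ` ?V \<subseteq> closed_cell ?T"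
    using closed_cell_mono[of "\<phi> ` (S \<inter> A)" ?T] closed_cell_mono[of "\<psi> ` (S \<inter> A)" ?T] fin
    by (meson Un_upper1 Un_upper2 finite_Int finite_UnI finite_imageI subset_trans)+
  moreover have "finite ?T" using fin by simp
  ultimately show "\<exists>T\<in>rips_complex m b. finite T \<and> push A \<phi> ` ?V \<subseteq> closed_cell T \<and>
      push A \<psi> ` ?V \<subseteq> closed_cell T"
    by (intro bexI[of _ ?T] conjI)
qed

text \<open>Dropping the mass outside \<open>A\<close> stays in the same closed simplex. This turns
  the inclusion into a pushed vertex map, where a chain of contiguities can start.\<close>

lemma homotopic_push_id:
  assumes "a \<le> b"
  shows "homotopic_with (\<lambda>h. True)
    (subtopology (geometric_realization (rips_complex m a)) (open_star_union (rips_complex m a) A))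
    (geometric_realization (rips_complex m b)) (\<lambda>u. u) (push A id)"
proof (rule homotopic_in_common_cells[OF openin_open_star_union])
  fix S assume S: "S \<in> rips_complex m a"
  then have fin: "finite S" by (rule finite_rips_complex)
  let ?V = "closed_cell S \<inter> open_star_union (rips_complex m a) A"
  show "continuous_map (subtopology (powertop_real UNIV) ?V) (powertop_real UNIV) (\<lambda>u. u)"
    by (simp add: continuous_map_from_subtopology)
  show "continuous_map (subtopology (powertop_real UNIV) ?V) (powertop_real UNIV) (push A id)"
    by (intro continuous_map_push fin)
  have "S \<in> rips_complex m b" using S assms by (force simp: rips_complex_def)
  moreover have "push A id ` ?V \<subseteq> closed_cell S"
    using push_in_closed_cell[OF _ fin, of _ _ A id] closed_cell_mono[of "S \<inter> A" S] fin by fastforce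
  ultimately show "\<exists>T\<in>rips_complex m b. finite T \<and> (\<lambda>u. u) ` ?V \<subseteq> closed_cell T \<and>
      push A id ` ?V \<subseteq> closed_cell T"
    using fin by (intro bexI[of _ S]) auto
qed

lemma contiguous_imp_null_homotopic:
  assumes "(contiguous m a b A)\<^sup>*\<^sup>* id \<phi>" "a \<le> b" "\<And>x. x \<in> A \<Longrightarrow> \<phi> x = c"
  shows "null_homotopic_on (geometric_realization (rips_complex m a)) (geometric_realization (rips_complex m b))
           (\<lambda>u. u) (open_star_union (rips_complex m a) A)"
proof -
  let ?X = "subtopology (geometric_realization (rips_complex m a)) (open_star_union (rips_complex m a) A)"
  let ?Y = "geometric_realization (rips_complex m b)"
  have hom: "homotopic_with (\<lambda>h. True) ?X ?Y (\<lambda>u. u) (push A \<phi>)"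
    using assms(1)
  proof (induction rule: rtranclp_induct)
    case base
    show ?case by (rule homotopic_push_id[OF assms(2)])
  next
    case (step \<phi> \<psi>)
    then show ?case using homotopic_push homotopic_with_trans by blast
  qed
  have "push A \<phi> u = (\<lambda>w. if w = c then 1 else 0)" if u: "u \<in> topspace ?X" for u
  proof -
    obtain S where S: "S \<in> rips_complex m a" "u \<in> closed_cell S" "u \<in> open_star_union (rips_complex m a) A"
      using u by (auto simp: topspace_geometric_realization)
    have "push A \<phi> u \<in> closed_cell (\<phi> ` (S \<inter> A))"
      by (rule push_in_closed_cell[OF S(2) finite_rips_complex[OF S(1)] S(3)])
    moreover have "\<phi> ` (S \<inter> A) \<subseteq> {c}" using assms(3) by auto
    ultimately have "push A \<phi> u \<in> closed_cell {c}" using closed_cell_mono[of _ "{c}"] by blast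
    then show ?thesis by (auto simp: closed_cell_def fun_eq_iff)
  qed
  then have "homotopic_with (\<lambda>h. True) ?X ?Y (push A \<phi>) (\<lambda>u w. if w = c then 1 else 0)"
    using homotopic_with_imp_continuous_maps[OF hom] by (intro homotopic_with_equal) auto
  then have "homotopic_with (\<lambda>h. True) ?X ?Y (\<lambda>u. u) (\<lambda>u w. if w = c then 1 else 0)"
    by (rule homotopic_with_trans[OF hom])
  then show ?thesis unfolding null_homotopic_on_def by blast
qed

lemma open_star_union_cover:
  assumes "mspace m \<subseteq> N \<union> F"
  shows "open_star_union (rips_complex m a) N \<union> open_star_union (rips_complex m a) F =
         topspace (geometric_realization (rips_complex m a))"
proof -
  have "\<exists>v\<in>N \<union> F. u v \<noteq> 0" if "S \<in> rips_complex m a" "u \<in> closed_cell S" for S u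
  proof -
    have "(\<Sum>v\<in>S. u v) \<noteq> 0" using that by (simp add: closed_cell_def)
    then obtain v where "v \<in> S" "u v \<noteq> 0" using sum.not_neutral_contains_not_neutral by blast
    then show ?thesis using that assms by (auto simp: rips_complex_def)
  qed
  then show ?thesis by (fastforce simp: open_star_union_def topspace_geometric_realization)
qed

lemma persistent_cat_rips_le_1:
  assumes "a \<le> b" "mspace m \<subseteq> N \<union> F"
    and "(contiguous m a b N)\<^sup>*\<^sup>* id \<phi>" "\<And>x. x \<in> N \<Longrightarrow> \<phi> x = c"
    and "(contiguous m a b F)\<^sup>*\<^sup>* id \<psi>" "\<And>x. x \<in> F \<Longrightarrow> \<psi> x = d"
  shows "persistent_cat (rips m) a b \<le> 1"
proof -
  let ?K = "rips_complex m a"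
  let ?U = "\<lambda>i::nat. if i = 0 then open_star_union ?K N else open_star_union ?K F"
  have "null_homotopic_on (pspace (rips m) a) (pspace (rips m) b) (pmap (rips m) a b) (?U i)" for i
    using contiguous_imp_null_homotopic[OF assms(3,1,4)] contiguous_imp_null_homotopic[OF assms(5,1,6)]
    by (auto simp: rips_def)
  moreover have "openin (pspace (rips m) a) (?U i)" for i
    by (simp add: rips_def openin_open_star_union)
  moreover have "(\<Union>i\<le>1. ?U i) = topspace (pspace (rips m) a)"
    using open_star_union_cover[OF assms(2), of a] by (auto simp: rips_def atMost_Suc)
  ultimately have "\<exists>U :: nat \<Rightarrow> _. (\<forall>i\<le>1. openin (pspace (rips m) a) (U i) \<and>
      null_homotopic_on (pspace (rips m) a) (pspace (rips m) b) (pmap (rips m) a b) (U i)) \<and>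
      (\<Union>i\<le>1. U i) = topspace (pspace (rips m) a)"
    by (intro exI[of _ ?U]) simp
  then show ?thesis
    unfolding persistent_cat_def cat_map_def by (intro Inf_lower) (auto simp: one_enat_def)
qed

lemma persistent_cat_rips_eq_0:
  assumes "a < 0 \<or> a \<le> b \<and> (contiguous m a b (mspace m))\<^sup>*\<^sup>* id \<phi> \<and> (\<forall>x\<in>mspace m. \<phi> x = c)"
  shows "persistent_cat (rips m) a b = 0"
proof -
  let ?X = "pspace (rips m) a"
  have "null_homotopic_on ?X (pspace (rips m) b) (pmap (rips m) a b) (topspace ?X)"
    using assms
  proof
    assume "a < 0"
    then have "topspace ?X = {}" by (simp add: rips_def topspace_geometric_realization rips_complex_neg)
    then show ?thesis
      unfolding null_homotopic_on_def
      by (intro exI homotopic_with_equal) (auto simp: continuous_map_on_empty)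
  next
    assume *: "a \<le> b \<and> (contiguous m a b (mspace m))\<^sup>*\<^sup>* id \<phi> \<and> (\<forall>x\<in>mspace m. \<phi> x = c)"
    then have "null_homotopic_on ?X (pspace (rips m) b) (pmap (rips m) a b)
        (open_star_union (rips_complex m a) (mspace m))"
      using contiguous_imp_null_homotopic[of m a b "mspace m" \<phi> c] by (simp add: rips_def)
    moreover have "open_star_union (rips_complex m a) (mspace m) = topspace ?X"
      using open_star_union_cover[of m "mspace m" "mspace m" a] by (simp add: rips_def)
    ultimately show ?thesis by simp
  qed
  then have "\<exists>U::nat \<Rightarrow> _. (\<forall>i\<le>0. openin ?X (U i) \<and>
      null_homotopic_on ?X (pspace (rips m) b) (pmap (rips m) a b) (U i)) \<and> (\<Union>i\<le>0. U i) = topspace ?X"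
    by (intro exI[of _ "\<lambda>_. topspace ?X"]) auto
  then have "persistent_cat (rips m) a b \<le> enat 0"
    unfolding persistent_cat_def cat_map_def by (intro Inf_lower) blast
  then show ?thesis by (simp add: zero_enat_def[symmetric])
qed

section \<open>Distances on spheres, products and wedges\<close>

lemma mdist_refl [simp]: "x \<in> mspace m \<Longrightarrow> mdist m x x = 0"
  by (simp add: mdist_zero)

lemma mdist_le_0_imp_eq: "x \<in> mspace m \<Longrightarrow> y \<in> mspace m \<Longrightarrow> mdist m x y \<le> 0 \<Longrightarrow> x = y"
  using mdist_nonneg[of m x y] mdist_zero[of x m y] by auto

lemma mdist_sphere_le_iff:
  assumes "norm x = 1" "norm y = 1" "0 \<le> d" "d \<le> pi"
  shows "mdist sphere_metric x y \<le> d \<longleftrightarrow> cos d \<le> x \<bullet> y"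
proof -
  have b: "-1 \<le> x \<bullet> y" "x \<bullet> y \<le> 1"
    using Cauchy_Schwarz_ineq2[of x y] assms by auto
  then have "arccos (x \<bullet> y) \<le> d \<longleftrightarrow> cos d \<le> cos (arccos (x \<bullet> y))"
    using assms by (intro cos_mono_le_eq[symmetric]) (auto intro: arccos_lbound arccos_ubound)
  then show ?thesis using b assms by (simp add: mdist_sphere_metric)
qed

lemma mdist_sphere_le_pi:
  assumes "norm x = 1" "norm y = 1"
  shows "mdist sphere_metric x y \<le> pi"
  using Cauchy_Schwarz_ineq2[of x y] assms by (simp add: mdist_sphere_le_iff)

lemma exists_orthogonal_unit_vector:
  fixes p :: "'a::euclidean_space"
  assumes "2 \<le> DIM('a)"
  obtains v where "norm v = 1" "p \<bullet> v = 0"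
proof -
  obtain y where y: "y \<noteq> 0" "orthogonal p y"
    using orthogonal_to_vector_exists[OF assms] by blast
  show ?thesis
    using y by (intro that[of "sgn y"]) (auto simp: norm_sgn orthogonal_def sgn_div_norm)
qed

lemma mdist_wedge_metric:
  assumes "x0 \<in> mspace m1" "y0 \<in> mspace m2"
    and "u \<in> mspace (wedge_metric m1 x0 m2 y0)" "v \<in> mspace (wedge_metric m1 x0 m2 y0)"
  shows "mdist (wedge_metric m1 x0 m2 y0) u v = mdist m1 (fst u) (fst v) + mdist m2 (snd u) (snd v)"
  using Metric_space.mdist_metric[OF Metric_space_wedge[OF assms(1,2)]]
  by (simp add: wedge_metric_def case_prod_beta)

section \<open>Coarse retractions\<close>

text \<open>Displacement at most 2 pi/3 makes the map contiguous to the identity once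
  \<open>b \<ge> a + 2 * pi / 3\<close>; distance at most pi/3 from the base point bounds the
  diameter of the image by 2 pi/3. Both conditions pass to max-products and, applied summand by
  summand, to wedges.\<close>

definition coarsely_retractable :: "'a metric \<Rightarrow> 'a \<Rightarrow> bool" where
  "coarsely_retractable m x0 \<longleftrightarrow> (\<exists>\<phi>. \<forall>x\<in>mspace m. \<phi> x \<in> mspace m \<and>
     mdist m x (\<phi> x) \<le> 2 * pi / 3 \<and> mdist m (\<phi> x) x0 \<le> pi / 3)"

text \<open>Each point of the sphere is within \<open>2\<pi>/3\<close> of one of the two points at distance \<open>\<pi>/3\<close> from
  \<open>p\<close> on a fixed great circle, since these two points add up to \<open>p\<close>.\<close>

lemma coarsely_retractable_sphere:
  fixes p :: "'a::euclidean_space"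
  assumes "2 \<le> DIM('a)" "norm p = 1"
  shows "coarsely_retractable sphere_metric p"
proof -
  obtain v where v: "norm v = 1" "p \<bullet> v = 0"
    using exists_orthogonal_unit_vector[OF assms(1)] by blast
  define w where "w s = (1 / 2) *\<^sub>R p + (s * (sqrt 3 / 2)) *\<^sub>R v" for s :: real
  have pv: "p \<bullet> p = 1" "v \<bullet> v = 1" "v \<bullet> p = 0"
    using assms v by (auto simp: dot_square_norm inner_commute)
  have "w s \<bullet> w s = 1" if "s\<^sup>2 = 1" for s
  proof -
    have "w s \<bullet> w s = 1 / 4 + s\<^sup>2 * ((sqrt 3)\<^sup>2 / 4)"
      by (simp add: w_def inner_add_left inner_add_right pv v power2_eq_square)
    then show ?thesis using that by simp
  qed
  then have norm_w: "norm (w 1) = 1" "norm (w (-1)) = 1"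
    by (simp_all add: norm_eq_sqrt_inner)
  have wp: "w s \<bullet> p = 1 / 2" for s by (simp add: w_def inner_add_left pv v)
  define \<phi> where "\<phi> x = (if x \<bullet> w 1 \<ge> - 1 / 2 then w 1 else w (-1))" for x
  have "\<phi> x \<in> mspace sphere_metric \<and> mdist sphere_metric x (\<phi> x) \<le> 2 * pi / 3 \<and>
        mdist sphere_metric (\<phi> x) p \<le> pi / 3" if "x \<in> mspace sphere_metric" for x
  proof -
    have x: "norm x = 1" using that by simp
    have nphi: "norm (\<phi> x) = 1" using norm_w by (simp add: \<phi>_def)
    \<comment> \<open>If both inner products were below -1/2, their sum would be below -1.\<close>
    have "x \<bullet> w 1 + x \<bullet> w (-1) = x \<bullet> p" by (simp add: w_def inner_add_right inner_diff_right)
    moreover have "- 1 \<le> x \<bullet> p" using Cauchy_Schwarz_ineq2[of x p] assms x by auto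
    ultimately have "x \<bullet> \<phi> x \<ge> - 1 / 2" by (auto simp: \<phi>_def)
    moreover have "cos (2 * pi / 3) = - 1 / 2" by (rule cos_120)
    moreover have "\<phi> x \<bullet> p = 1 / 2" by (simp add: \<phi>_def wp)
    ultimately have "mdist sphere_metric x (\<phi> x) \<le> 2 * pi / 3" "mdist sphere_metric (\<phi> x) p \<le> pi / 3"
      using nphi x assms by (subst mdist_sphere_le_iff; simp add: cos_60)+
    then show ?thesis using nphi by simp
  qed
  then show ?thesis unfolding coarsely_retractable_def by blast
qed

lemma coarsely_retractable_linf:
  assumes "coarsely_retractable m1 x0" "coarsely_retractable m2 y0"
  shows "coarsely_retractable (linf_metric m1 m2) (x0, y0)"
proof -
  define c d where "c = 2 * pi / 3" and "d = pi / 3"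
  obtain \<phi> \<psi> where
    "\<And>x. x \<in> mspace m1 \<Longrightarrow> \<phi> x \<in> mspace m1 \<and> mdist m1 x (\<phi> x) \<le> c \<and> mdist m1 (\<phi> x) x0 \<le> d"
    "\<And>x. x \<in> mspace m2 \<Longrightarrow> \<psi> x \<in> mspace m2 \<and> mdist m2 x (\<psi> x) \<le> c \<and> mdist m2 (\<psi> x) y0 \<le> d"
    using assms unfolding coarsely_retractable_def c_def[symmetric] d_def[symmetric] by metis
  then show ?thesis
    unfolding coarsely_retractable_def c_def[symmetric] d_def[symmetric] by (intro exI[of _ "map_prod \<phi> \<psi>"]) auto
qed

lemma coarsely_retractable_wedge:
  assumes "coarsely_retractable m1 x0" "coarsely_retractable m2 y0"
    and base: "x0 \<in> mspace m1" "y0 \<in> mspace m2"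
  shows "coarsely_retractable (wedge_metric m1 x0 m2 y0) (x0, y0)"
proof -
  define c d where "c = 2 * pi / 3" and "d = pi / 3"
  obtain \<phi> \<psi> where
    "\<And>x. x \<in> mspace m1 \<Longrightarrow> \<phi> x \<in> mspace m1 \<and> mdist m1 x (\<phi> x) \<le> c \<and> mdist m1 (\<phi> x) x0 \<le> d"
    "\<And>x. x \<in> mspace m2 \<Longrightarrow> \<psi> x \<in> mspace m2 \<and> mdist m2 x (\<psi> x) \<le> c \<and> mdist m2 (\<psi> x) y0 \<le> d"
    using assms unfolding coarsely_retractable_def c_def[symmetric] d_def[symmetric] by metis
  then show ?thesis
    unfolding coarsely_retractable_def c_def[symmetric] d_def[symmetric] using base
    by (intro exI[of _ "\<lambda>(x, y). if y = y0 then (\<phi> x, y0) else (x0, \<psi> y)"])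
      (auto simp: mdist_wedge_metric mspace_wedge_metric)
qed

text \<open>The step from the identity to \<phi> uses the gap 2 pi/3. The step from \<phi> to the
  constant uses the image alone, whose diameter 2 pi/3 is at most \<open>b\<close> for nonnegative
  \<open>a\<close>; for negative \<open>a\<close> the complex is empty.\<close>

lemma persistent_cat_coarsely_retractable:
  assumes "coarsely_retractable m x0" "x0 \<in> mspace m" "a + 2 * pi / 3 \<le> b"
  shows "persistent_cat (rips m) a b = 0"
proof (cases "a < 0")
  case False
  obtain \<phi> where \<phi>: "\<And>x. x \<in> mspace m \<Longrightarrow> \<phi> x \<in> mspace m"
    "\<And>x. x \<in> mspace m \<Longrightarrow> mdist m x (\<phi> x) \<le> 2 * pi / 3"
    "\<And>x. x \<in> mspace m \<Longrightarrow> mdist m (\<phi> x) x0 \<le> pi / 3"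
    using assms(1) unfolding coarsely_retractable_def by metis
  have "mdist m (\<phi> x) (\<phi> y) \<le> b" if "x \<in> mspace m" "y \<in> mspace m" for x y
    using mdist_triangle[of "\<phi> x" m x0 "\<phi> y"] \<phi>(1,3)[OF that(1)] \<phi>(1,3)[OF that(2)] assms(2,3) False
      mdist_commute[of m x0 "\<phi> y"] by auto
  moreover have "mdist m x (\<phi> y) \<le> b" if "x \<in> mspace m" "y \<in> mspace m" "mdist m x y \<le> a" for x y
    using mdist_triangle[of x m y "\<phi> y"] \<phi>(1,2)[OF that(2)] that assms(3) by auto
  moreover have ab: "a \<le> b" using assms(3) pi_gt_zero by linarith
  ultimately have "contiguous m a b (mspace m) id \<phi>"
    using \<phi>(1) by (auto simp: contiguous_def intro: order_trans[OF _ ab])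
  moreover have "contiguous m a b (mspace m) \<phi> (\<lambda>_. x0)"
  proof -
    have "pi / 3 \<le> b" using assms(3) False pi_gt_zero by linarith
    then have "mdist m (\<phi> x) x0 \<le> b" if "x \<in> mspace m" for x
      using \<phi>(3)[OF that] by linarith
    then show ?thesis
      using \<open>\<And>y x. x \<in> mspace m \<Longrightarrow> y \<in> mspace m \<Longrightarrow> mdist m (\<phi> x) (\<phi> y) \<le> b\<close> \<phi>(1) assms(2) order_trans[OF _ \<open>pi / 3 \<le> b\<close>, of 0]
      by (auto simp: contiguous_def)
  qed
  ultimately have "(contiguous m a b (mspace m))\<^sup>*\<^sup>* id (\<lambda>_. x0)"
    by (meson rtranclp.rtrancl_into_rtrancl rtranclp.rtrancl_refl)
  then show ?thesis using ab by (intro persistent_cat_rips_eq_0) auto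
qed (simp add: persistent_cat_rips_eq_0)

section \<open>Decomposition into two contractible parts\<close>

text \<open>A homotopy in discrete time whose consecutive stages are contiguous. It remains constant
  after stage \<open>n\<close>, so contractions of different lengths can run side by side.\<close>

definition contracts :: "'a metric \<Rightarrow> real \<Rightarrow> real \<Rightarrow> 'a set \<Rightarrow> (nat \<Rightarrow> 'a \<Rightarrow> 'a) \<Rightarrow> nat \<Rightarrow> 'a \<Rightarrow> bool" where
  "contracts m a b A \<phi> n c \<longleftrightarrow> A \<subseteq> mspace m \<and> (\<forall>x\<in>A. \<phi> 0 x = x) \<and>
     (\<forall>i. \<forall>x\<in>A. \<phi> i x \<in> mspace m) \<and> (\<forall>i\<ge>n. \<forall>x\<in>A. \<phi> i x = c) \<and>
     (\<forall>i. \<forall>x\<in>A. \<forall>y\<in>A. mdist m x y \<le> a \<longrightarrow>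
        mdist m (\<phi> i x) (\<phi> i y) \<le> b \<and> mdist m (\<phi> i x) (\<phi> (Suc i) y) \<le> b)"

lemma contracts_imp_contiguous:
  assumes "contracts m a b A \<phi> n c"
  shows "(contiguous m a b A)\<^sup>*\<^sup>* id (\<phi> n)"
proof -
  have "contiguous m a b A (\<phi> i) (\<phi> (Suc i))" for i
    using assms by (auto simp: contracts_def contiguous_def)
  then have "(contiguous m a b A)\<^sup>*\<^sup>* (\<phi> 0) (\<phi> n)"
    by (induction n) (auto intro: rtranclp.rtrancl_into_rtrancl)
  moreover have "contiguous m a b A id (\<phi> 0)"
  proof -
    have "mdist m x y \<le> b" if "x \<in> A" "y \<in> A" "mdist m x y \<le> a" for x y
      using assms that unfolding contracts_def by metis
    then show ?thesis
      using assms by (auto simp: contracts_def contiguous_def)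
  qed
  ultimately show ?thesis by (meson converse_rtranclp_into_rtranclp)
qed

text \<open>Once \<open>A\<close> has collapsed to a point, the point travels alone, and only the
  jumps along \<gamma> have to be at most \<open>b\<close>.\<close>

lemma contracts_extend:
  assumes c: "contracts m a b A \<phi> n c"
    and \<gamma>: "\<And>k. \<gamma> k \<in> mspace m" "\<gamma> 0 = c" "\<And>k. l \<le> k \<Longrightarrow> \<gamma> k = c'"
      "\<And>k. mdist m (\<gamma> k) (\<gamma> (Suc k)) \<le> b" and "0 \<le> b"
  shows "contracts m a b A (\<lambda>i. if i \<le> n then \<phi> i else (\<lambda>_. \<gamma> (i - n))) (n + Suc l) c'"
proof -
  let ?\<psi> = "\<lambda>i. if i \<le> n then \<phi> i else (\<lambda>_. \<gamma> (i - n))"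
  have late: "?\<psi> i x = \<gamma> (i - n)" if "n \<le> i" "x \<in> A" for i x
    using that c \<gamma>(2) by (cases "i = n") (auto simp: contracts_def)
  have "mdist m (?\<psi> i x) (?\<psi> i y) \<le> b \<and> mdist m (?\<psi> i x) (?\<psi> (Suc i) y) \<le> b"
    if "x \<in> A" "y \<in> A" "mdist m x y \<le> a" for i x y
  proof (cases "n \<le> i")
    case True
    then show ?thesis
      using \<gamma>(4)[of "i - n"] \<gamma>(1) \<open>0 \<le> b\<close> that late[of i] late[of "Suc i"]
      by (simp add: Suc_diff_le del: if_split_asm split del: if_split)
  next
    case False
    then show ?thesis using c that by (simp add: contracts_def)
  qed
  moreover have "?\<psi> i x = c'" if "n + Suc l \<le> i" "x \<in> A" for i x
    using that late[of i x] \<gamma>(3)[of "i - n"] by auto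
  ultimately show ?thesis
    using c \<gamma>(1) unfolding contracts_def by auto
qed

text \<open>The two distance clauses are what the wedge needs. Distances between different summands
  pass through the base point: they do not grow if each stage on the near part \<open>N\<close>
  brings points no farther from it, and they exceed \<open>a\<close> on the far part
  \<open>F\<close>, where no condition across summands is left.\<close>

definition bicontractible :: "'a metric \<Rightarrow> real \<Rightarrow> real \<Rightarrow> 'a \<Rightarrow> bool" where
  "bicontractible m a b x0 \<longleftrightarrow> (\<exists>N F \<phi> \<psi> n. mspace m \<subseteq> N \<union> F \<and> x0 \<in> N \<and>
     contracts m a b N \<phi> n x0 \<and> (\<forall>i. \<forall>x\<in>N. mdist m (\<phi> i x) x0 \<le> mdist m x x0) \<and>
     contracts m a b F \<psi> n x0 \<and> (\<forall>x\<in>F. a < mdist m x x0))"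

lemma persistent_cat_bicontractible:
  assumes "bicontractible m a b x0" "a \<le> b"
  shows "persistent_cat (rips m) a b \<le> 1"
proof -
  obtain N F \<phi> \<psi> n where *: "mspace m \<subseteq> N \<union> F" "contracts m a b N \<phi> n x0" "contracts m a b F \<psi> n x0"
    using assms(1) unfolding bicontractible_def by blast
  show ?thesis
    using contracts_imp_contiguous[OF *(2)] contracts_imp_contiguous[OF *(3)] *
    by (intro persistent_cat_rips_le_1[OF assms(2) *(1), of "\<phi> n" x0 "\<psi> n" x0]) (auto simp: contracts_def)
qed

lemma contracts_mono: "contracts m a b A \<phi> n c \<Longrightarrow> n \<le> n' \<Longrightarrow> contracts m a b A \<phi> n' c"
  unfolding contracts_def by (meson order_trans)

text \<open>Points of the far parts of the two summands are more than \<open>a\<close> apart, so these parts can be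
  contracted independently.\<close>

lemma bicontractible_wedge:
  assumes "bicontractible m1 a b x0" "bicontractible m2 a b y0" "a \<le> b" "0 < a"
  shows "bicontractible (wedge_metric m1 x0 m2 y0) a b (x0, y0)"
proof -
  let ?m = "wedge_metric m1 x0 m2 y0"
  obtain N1 F1 \<phi>1 \<psi>1 n1 where 1: "mspace m1 \<subseteq> N1 \<union> F1" "x0 \<in> N1" "contracts m1 a b N1 \<phi>1 n1 x0"
    "\<And>i x. x \<in> N1 \<Longrightarrow> mdist m1 (\<phi>1 i x) x0 \<le> mdist m1 x x0" "contracts m1 a b F1 \<psi>1 n1 x0"
    "\<And>x. x \<in> F1 \<Longrightarrow> a < mdist m1 x x0"
    using assms(1) unfolding bicontractible_def by blast
  obtain N2 F2 \<phi>2 \<psi>2 n2 where 2: "mspace m2 \<subseteq> N2 \<union> F2" "y0 \<in> N2" "contracts m2 a b N2 \<phi>2 n2 y0"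
    "\<And>i x. x \<in> N2 \<Longrightarrow> mdist m2 (\<phi>2 i x) y0 \<le> mdist m2 x y0" "contracts m2 a b F2 \<psi>2 n2 y0"
    "\<And>x. x \<in> F2 \<Longrightarrow> a < mdist m2 x y0"
    using assms(2) unfolding bicontractible_def by blast
  have base: "x0 \<in> mspace m1" "y0 \<in> mspace m2" using 1 2 by (auto simp: contracts_def)
  define n where "n = max n1 n2"
  note c1 = contracts_mono[OF 1(3), of n, unfolded contracts_def] contracts_mono[OF 1(5), of n, unfolded contracts_def]
  note c2 = contracts_mono[OF 2(3), of n, unfolded contracts_def] contracts_mono[OF 2(5), of n, unfolded contracts_def]
  have n: "n1 \<le> n" "n2 \<le> n" by (auto simp: n_def)
  define N where "N = N1 \<times> {y0} \<union> {x0} \<times> N2"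
  define F where "F = F1 \<times> {y0} \<union> {x0} \<times> F2"
  define \<phi> where "\<phi> i = map_prod (\<phi>1 i) (\<phi>2 i)" for i
  \<comment> \<open>\<open>F2\<close> avoids \<open>y0\<close>, so the test tells the two summands
    apart. The base points are not in the far parts, so \<open>\<psi>1\<close> and
    \<open>\<psi>2\<close> may move freely without conflict.\<close>
  define \<psi> where "\<psi> i = (\<lambda>(x, y). if y = y0 then (\<psi>1 i x, y0) else (x0, \<psi>2 i y))" for i
  \<comment> \<open>Not getting farther from the base point means, at the base point itself, not
    moving.\<close>
  have fix1: "\<phi>1 i x0 = x0" for i
    using 1(4)[OF 1(2), of i] c1(1) n base 1(2) by (intro mdist_le_0_imp_eq[of _ m1]) auto
  have fix2: "\<phi>2 i y0 = y0" for i
    using 2(4)[OF 2(2), of i] c2(1) n base 2(2) by (intro mdist_le_0_imp_eq[of _ m2]) auto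
  have F1: "x \<noteq> x0" if "x \<in> F1" for x using 1(6)[OF that] assms(4) base by auto
  have F2: "y \<noteq> y0" if "y \<in> F2" for y using 2(6)[OF that] assms(4) base by auto
  have sub: "N \<subseteq> mspace ?m" "F \<subseteq> mspace ?m"
    using c1 c2 n base by (auto simp: N_def F_def mspace_wedge_metric)
  have \<phi>_in: "\<phi> i u \<in> mspace ?m" if "u \<in> N" for i u
    using that c1(1) c2(1) n base by (auto simp: N_def \<phi>_def mspace_wedge_metric fix1 fix2)
  have \<psi>_in: "\<psi> i u \<in> mspace ?m" if "u \<in> F" for i u
    using that c1(2) c2(2) n base F2 by (auto simp: F_def \<psi>_def mspace_wedge_metric)
  have d: "mdist ?m u v = mdist m1 (fst u) (fst v) + mdist m2 (snd u) (snd v)"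
    if "u \<in> mspace ?m" "v \<in> mspace ?m" for u v
    by (rule mdist_wedge_metric[OF base that])
  have "contracts ?m a b N \<phi> n (x0, y0)"
  proof -
    have "mdist ?m (\<phi> i u) (\<phi> j v) \<le> b" if uv: "u \<in> N" "v \<in> N" "mdist ?m u v \<le> a" and j: "j = i \<or> j = Suc i" for i j u v
    proof -
      have le: "mdist m1 (fst u) (fst v) + mdist m2 (snd u) (snd v) \<le> a"
        using uv(3) d[OF subsetD[OF sub(1) uv(1)] subsetD[OF sub(1) uv(2)]] by simp
      have *: "mdist ?m (\<phi> i u) (\<phi> j v) = mdist m1 (\<phi>1 i (fst u)) (\<phi>1 j (fst v)) + mdist m2 (\<phi>2 i (snd u)) (\<phi>2 j (snd v))"
        using d[OF \<phi>_in[OF uv(1)] \<phi>_in[OF uv(2)]] by (simp add: \<phi>_def)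
      consider x y where "u = (x, y0)" "v = (y, y0)" "x \<in> N1" "y \<in> N1"
        | x y where "u = (x0, x)" "v = (x0, y)" "x \<in> N2" "y \<in> N2"
        | x y where "u = (x, y0)" "v = (x0, y)" "x \<in> N1" "y \<in> N2"
        | x y where "u = (x0, y)" "v = (x, y0)" "x \<in> N1" "y \<in> N2"
        using uv by (auto simp: N_def)
      then show ?thesis
      proof cases
        case 1
        then show ?thesis using * le j c1(1) n base by (auto simp: fix2)
      next
        case 2
        then show ?thesis using * le j c2(1) n base by (auto simp: fix1)
      next
        case 3
        then show ?thesis
          using * le 1(4)[of x i] 2(4)[of y j] assms(3) by (auto simp: fix1 fix2 mdist_commute)
      next
        case 4
        then show ?thesis
          using * le 1(4)[of x j] 2(4)[of y i] assms(3) by (auto simp: fix1 fix2 mdist_commute)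
      qed
    qed
    moreover have "\<phi> 0 u = u" "i \<ge> n \<Longrightarrow> \<phi> i u = (x0, y0)" if "u \<in> N" for u i
      using that c1(1) c2(1) n by (auto simp: N_def \<phi>_def fix1 fix2)
    ultimately show ?thesis using sub \<phi>_in by (simp add: contracts_def)
  qed
  moreover have "mdist ?m (\<phi> i u) (x0, y0) \<le> mdist ?m u (x0, y0)" if "u \<in> N" for i u
  proof -
    have "(x0, y0) \<in> mspace ?m" using base by (simp add: mspace_wedge_metric)
    then show ?thesis
      using d[OF \<phi>_in[OF that, of i]] d[of u] that sub base 1(4) 2(4)
      by (auto simp: N_def \<phi>_def fix1 fix2)
  qed
  moreover have "contracts ?m a b F \<psi> n (x0, y0)"
  proof -
    have "mdist ?m (\<psi> i u) (\<psi> j v) \<le> b" if uv: "u \<in> F" "v \<in> F" "mdist ?m u v \<le> a" and j: "j = i \<or> j = Suc i" for i j u v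
    proof -
      have le: "mdist m1 (fst u) (fst v) + mdist m2 (snd u) (snd v) \<le> a"
        using uv(3) d[OF subsetD[OF sub(2) uv(1)] subsetD[OF sub(2) uv(2)]] by simp
      have *: "mdist ?m (\<psi> i u) (\<psi> j v) =
          mdist m1 (fst (\<psi> i u)) (fst (\<psi> j v)) + mdist m2 (snd (\<psi> i u)) (snd (\<psi> j v))"
        by (rule d[OF \<psi>_in[OF uv(1)] \<psi>_in[OF uv(2)]])
      consider x y where "u = (x, y0)" "v = (y, y0)" "x \<in> F1" "y \<in> F1"
        | x y where "u = (x0, x)" "v = (x0, y)" "x \<in> F2" "y \<in> F2"
        | x y where "u = (x, y0)" "v = (x0, y)" "x \<in> F1" "y \<in> F2"
        | x y where "u = (x0, y)" "v = (x, y0)" "x \<in> F1" "y \<in> F2"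
        using uv by (auto simp: F_def)
      then show ?thesis
      proof cases
        case 1
        then show ?thesis using * le j c1(2) n base by (auto simp: \<psi>_def)
      next
        case 2
        then show ?thesis using * le j c2(2) n base F2 by (auto simp: \<psi>_def)
      next
        case 3
        then have "a < mdist m1 (fst u) (fst v)" using 1(6) by auto
        then show ?thesis using le mdist_nonneg[of m2 "snd u" "snd v"] by linarith
      next
        case 4
        then have "a < mdist m1 (fst u) (fst v)" using 1(6) by (auto simp: mdist_commute[of m1 x0])
        then show ?thesis using le mdist_nonneg[of m2 "snd u" "snd v"] by linarith
      qed
    qed
    moreover have "\<psi> 0 u = u" "i \<ge> n \<Longrightarrow> \<psi> i u = (x0, y0)" if "u \<in> F" for u i
      using that c1(2) c2(2) n F2 by (auto simp: F_def \<psi>_def)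
    ultimately show ?thesis using sub \<psi>_in by (simp add: contracts_def)
  qed
  moreover have "a < mdist ?m u (x0, y0)" if "u \<in> F" for u
  proof -
    have "(x0, y0) \<in> mspace ?m" using base by (simp add: mspace_wedge_metric)
    then show ?thesis
      using d[of u "(x0, y0)"] that sub base 1(6) 2(6) by (auto simp: F_def)
  qed
  moreover have "mspace ?m \<subseteq> N \<union> F" "(x0, y0) \<in> N"
    using 1(1,2) 2(1,2) base by (auto simp: N_def F_def mspace_wedge_metric)
  ultimately show ?thesis unfolding bicontractible_def by blast
qed

section \<open>Contracting a hemisphere\<close>

text \<open>The central projection of the chord from \<open>x\<close> to \<open>q\<close>. It
  follows the great circle at non-constant speed, but inner products remain algebraic in
  \<open>t\<close>.\<close>

definition slide :: "'a::real_inner \<Rightarrow> real \<Rightarrow> 'a \<Rightarrow> 'a" where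
  "slide q t x = sgn ((1 - t) *\<^sub>R x + t *\<^sub>R q)"

lemma inner_slide_aux:
  fixes x y q :: "'a::real_inner"
  assumes "norm x = 1" "norm y = 1" "norm q = 1"
  shows "((1 - t) *\<^sub>R x + t *\<^sub>R q) \<bullet> ((1 - t) *\<^sub>R y + t *\<^sub>R q) =
         (1 - t)\<^sup>2 * (x \<bullet> y) + (1 - t) * t * (x \<bullet> q + y \<bullet> q) + t\<^sup>2"
  using assms
  by (simp add: inner_add_left inner_add_right inner_commute[of q] dot_square_norm power2_eq_square algebra_simps)

lemma slide_nonzero:
  assumes "norm x = 1" "norm q = 1" "0 \<le> x \<bullet> q" "t \<in> {0..1}"
  shows "(1 - t) *\<^sub>R x + t *\<^sub>R q \<noteq> 0"
proof
  assume "(1 - t) *\<^sub>R x + t *\<^sub>R q = 0"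
  then have "0 = (1 - t)\<^sup>2 + (1 - t) * t * (x \<bullet> q + x \<bullet> q) + t\<^sup>2"
    using inner_slide_aux[OF assms(1,1,2), of t] assms by (simp add: dot_square_norm)
  moreover have "0 \<le> (1 - t) * t * (x \<bullet> q + x \<bullet> q)" using assms by auto
  ultimately have "(1 - t)\<^sup>2 = 0" "t\<^sup>2 = 0"
    using zero_le_power2[of "1 - t"] zero_le_power2[of t] by linarith+
  then show False by simp
qed

lemma norm_slide:
  assumes "norm x = 1" "norm q = 1" "0 \<le> x \<bullet> q" "t \<in> {0..1}"
  shows "norm (slide q t x) = 1"
  using slide_nonzero[OF assms] by (simp add: slide_def norm_sgn)

text \<open>With \<open>C = x \<bullet> y\<close>, the AM-GM inequality bounds the product of the norms by
  \<open>(1-t)\<^sup>2 + t\<^sup>2 + t(1-t)(x \<bullet> q + y \<bullet> q)\<close>, and \<open>C\<close> times this is at most the inner product because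
  \<open>0 \<le> C \<le> 1\<close>.\<close>

lemma inner_slide_ge:
  fixes x y q :: "'a::real_inner"
  assumes "norm x = 1" "norm y = 1" "norm q = 1" "0 \<le> x \<bullet> y" "0 \<le> x \<bullet> q" "0 \<le> y \<bullet> q" "t \<in> {0..1}"
  shows "x \<bullet> y \<le> slide q t x \<bullet> slide q t y"
proof -
  define u v where "u = (1 - t) *\<^sub>R x + t *\<^sub>R q" and "v = (1 - t) *\<^sub>R y + t *\<^sub>R q"
  have nz: "u \<noteq> 0" "v \<noteq> 0" unfolding u_def v_def using slide_nonzero[OF assms(1,3,5,7)] slide_nonzero[OF assms(2,3,6,7)] by auto
  define D where "D = (1 - t)\<^sup>2 + (1 - t) * t * (x \<bullet> q + y \<bullet> q) + t\<^sup>2"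
  have "(norm u)\<^sup>2 = (1 - t)\<^sup>2 + (1 - t) * t * (x \<bullet> q + x \<bullet> q) + t\<^sup>2"
    "(norm v)\<^sup>2 = (1 - t)\<^sup>2 + (1 - t) * t * (y \<bullet> q + y \<bullet> q) + t\<^sup>2"
    using inner_slide_aux[OF assms(1,1,3), of t] inner_slide_aux[OF assms(2,2,3), of t] assms(1,2)
    by (simp_all add: u_def v_def dot_square_norm)
  then have "(norm u)\<^sup>2 + (norm v)\<^sup>2 = 2 * D" by (simp add: D_def algebra_simps)
  moreover have "0 \<le> (norm u - norm v)\<^sup>2" by simp
  ultimately have amgm: "norm u * norm v \<le> D" by (simp add: power2_diff)
  have le1: "x \<bullet> y \<le> 1" using Cauchy_Schwarz_ineq2[of x y] assms by auto
  have "(x \<bullet> y) * (norm u * norm v) \<le> (x \<bullet> y) * D"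
    using amgm assms(4) by (rule mult_left_mono)
  also have "\<dots> = u \<bullet> v - (1 - x \<bullet> y) * ((1 - t) * t * (x \<bullet> q + y \<bullet> q) + t\<^sup>2)"
    unfolding u_def v_def inner_slide_aux[OF assms(1,2,3)] by (simp add: D_def algebra_simps)
  also have "\<dots> \<le> u \<bullet> v"
    using le1 assms by (auto intro!: mult_nonneg_nonneg add_nonneg_nonneg)
  finally have "x \<bullet> y \<le> (u \<bullet> v) / (norm u * norm v)"
    using nz by (simp add: pos_le_divide_eq)
  also have "(u \<bullet> v) / (norm u * norm v) = slide q t x \<bullet> slide q t y"
    unfolding slide_def u_def[symmetric] v_def[symmetric] sgn_div_norm by (simp add: divide_inverse mult_ac)
  finally show ?thesis .
qed

lemma mdist_sphere_le_if_close:
  assumes "0 < d"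
  obtains e where "0 < e"
    "\<And>x y :: 'a::real_inner. norm x = 1 \<Longrightarrow> norm y = 1 \<Longrightarrow> dist x y < e \<Longrightarrow> mdist sphere_metric x y \<le> d"
proof -
  define d' where "d' = min d pi"
  have d': "0 < d'" "d' \<le> pi" "d' \<le> d" using assms by (auto simp: d'_def)
  then have "cos d' < cos 0" by (intro cos_monotone_0_pi) auto
  then have pos: "0 < 2 * (1 - cos d')" by simp
  show ?thesis
  proof (rule that[of "sqrt (2 * (1 - cos d'))"])
    fix x y :: 'a assume xy: "norm x = 1" "norm y = 1" "dist x y < sqrt (2 * (1 - cos d'))"
    then have "(norm (x - y))\<^sup>2 < 2 * (1 - cos d')"
      using real_sqrt_less_iff[of "(norm (x - y))\<^sup>2"] by (simp add: dist_norm)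
    moreover have "x \<bullet> x = 1" "y \<bullet> y = 1" using xy(1,2) by (simp_all add: dot_square_norm)
    then have "(norm (x - y))\<^sup>2 = 2 - 2 * (x \<bullet> y)"
      by (simp add: power2_norm_eq_inner inner_diff_left inner_diff_right inner_commute[of y x])
    ultimately have "cos d' \<le> x \<bullet> y" by simp
    then show "mdist sphere_metric x y \<le> d"
      using xy d' mdist_sphere_le_iff[of x y d'] by auto
  qed (use pos in simp)
qed

text \<open>Uniform continuity on the compact product of the interval and the closed hemisphere
  gives one step width for all points. Truncating the time at 1 freezes the stages after
  \<open>n\<close>.\<close>

lemma slide_small_steps:
  fixes q :: "'a::euclidean_space"
  assumes q: "norm q = 1" and "0 < d"
  obtains n :: nat where "0 < n" "\<And>i x. norm x = 1 \<Longrightarrow> 0 \<le> x \<bullet> q \<Longrightarrow>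
     mdist sphere_metric (slide q (min 1 (real i / real n)) x) (slide q (min 1 (real (Suc i) / real n)) x) \<le> d"
proof -
  obtain e where e: "0 < e"
    "\<And>x y :: 'a. norm x = 1 \<Longrightarrow> norm y = 1 \<Longrightarrow> dist x y < e \<Longrightarrow> mdist sphere_metric x y \<le> d"
    using mdist_sphere_le_if_close[OF \<open>0 < d\<close>] by blast
  let ?H = "sphere 0 1 \<inter> {x. 0 \<le> x \<bullet> q}"
  have "closed {x :: 'a. 0 \<le> x \<bullet> q}" by (intro closed_Collect_le continuous_intros)
  then have "compact ({0..1::real} \<times> ?H)" by (intro compact_Times compact_Int_closed) auto
  moreover have "continuous_on ({0..1::real} \<times> ?H) (\<lambda>(t, x). slide q t x)"
    unfolding slide_def sgn_div_norm case_prod_beta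
    by (intro continuous_intros) (use slide_nonzero[of _ q] q in auto)
  ultimately have "uniformly_continuous_on ({0..1::real} \<times> ?H) (\<lambda>(t, x). slide q t x)"
    by (rule compact_uniformly_continuous[rotated])
  then obtain c where c: "0 < c" "\<And>t t' x. t \<in> {0..1} \<Longrightarrow> t' \<in> {0..1} \<Longrightarrow> x \<in> ?H \<Longrightarrow> dist (t', x) (t, x) < c \<Longrightarrow>
      dist (slide q t' x) (slide q t x) < e"
    unfolding uniformly_continuous_on_def using e(1) by fastforce
  obtain n where n: "inverse (real (Suc n)) < c" using reals_Archimedean[OF c(1)] by blast
  show ?thesis
  proof (rule that[of "Suc n"])
    fix i :: nat and x :: 'a assume x: "norm x = 1" "0 \<le> x \<bullet> q"
    let ?t = "\<lambda>i. min 1 (real i / real (Suc n))"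
    have t: "?t i \<in> {0..1}" for i by auto
    have "\<bar>?t i - ?t (Suc i)\<bar> \<le> inverse (real (Suc n))"
      by (simp add: field_simps min_def del: of_nat_Suc)
    then have "dist (?t i) (?t (Suc i)) < c" using n by (simp add: dist_real_def del: of_nat_Suc)
    then have "dist (?t i, x) (?t (Suc i), x) < c" by (simp add: dist_Pair_Pair del: of_nat_Suc)
    then have "dist (slide q (?t i) x) (slide q (?t (Suc i)) x) < e"
      using c(2)[OF t[of "Suc i"] t[of i], of x] x by (simp del: of_nat_Suc)
    then show "mdist sphere_metric (slide q (?t i) x) (slide q (?t (Suc i)) x) \<le> d"
      using norm_slide[OF x(1) q x(2) t] by (intro e(2)) (auto simp del: of_nat_Suc)
  qed simp
qed

text \<open>Points at distance at most \<open>a < pi / 2\<close> have nonnegative inner product, so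
  by \<open>inner_slide_ge\<close> sliding brings them no farther apart; the slack
  \<open>b - a\<close> pays for one time step.\<close>

lemma contracts_hemisphere:
  fixes q :: "'a::euclidean_space"
  assumes q: "norm q = 1" and ab: "0 < a" "a < b" "a < pi / 2"
    and A: "A \<subseteq> {x. norm x = 1 \<and> 0 \<le> x \<bullet> q}"
  obtains \<phi> n where "contracts sphere_metric a b A \<phi> n q"
    "\<And>i x. x \<in> A \<Longrightarrow> mdist sphere_metric (\<phi> i x) q \<le> mdist sphere_metric x q"
proof -
  obtain n :: nat where n: "0 < n" "\<And>i x. norm x = 1 \<Longrightarrow> 0 \<le> x \<bullet> q \<Longrightarrow>
     mdist sphere_metric (slide q (min 1 (real i / real n)) x) (slide q (min 1 (real (Suc i) / real n)) x) \<le> b - a"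
    using slide_small_steps[OF q, of "b - a"] ab by auto
  define \<phi> where "\<phi> i = slide q (min 1 (real i / real n))" for i
  have t: "min 1 (real i / real n) \<in> {0..1}" for i by auto
  have norm_\<phi>: "norm (\<phi> i x) = 1" if "x \<in> A" for i x
    using norm_slide[OF _ q _ t] that A by (auto simp: \<phi>_def)
  \<comment> \<open>Stated for \<open>slide\<close> at \<open>y\<close> rather than \<phi>, with
    \<open>y\<close> not confined to \<open>A\<close>, so that \<open>y = q\<close> is allowed; this
    yields the claim on distances to \<open>q\<close>.\<close>
  have mono: "mdist sphere_metric (\<phi> i x) (slide q (min 1 (real i / real n)) y) \<le> mdist sphere_metric x y"
    if "x \<in> A" "norm y = 1" "0 \<le> y \<bullet> q" "0 \<le> x \<bullet> y" for i x y
  proof -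
    have le: "x \<bullet> y \<le> \<phi> i x \<bullet> slide q (min 1 (real i / real n)) y"
      unfolding \<phi>_def using that A q t by (intro inner_slide_ge) auto
    have ny: "norm (slide q (min 1 (real i / real n)) y) = 1"
      using norm_slide[OF that(2) q that(3) t] .
    have "\<phi> i x \<bullet> slide q (min 1 (real i / real n)) y \<le> 1"
      using Cauchy_Schwarz_ineq2[of "\<phi> i x" "slide q (min 1 (real i / real n)) y"] norm_\<phi>[OF that(1)] ny by auto
    moreover have "norm x = 1" using that A by auto
    ultimately show ?thesis
      using le that norm_\<phi>[OF that(1)] ny by (auto simp: mdist_sphere_metric intro!: arccos_le_arccos)
  qed
  have close: "0 \<le> x \<bullet> y" if "norm x = 1" "norm y = 1" "mdist sphere_metric x y \<le> a" for x y :: 'a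
    using that mdist_sphere_le_iff[of x y "pi / 2"] ab by auto
  have step: "mdist sphere_metric (\<phi> i x) (\<phi> i y) \<le> a" if "x \<in> A" "y \<in> A" "mdist sphere_metric x y \<le> a" for i x y
    using mono[of x y i] that subsetD[OF A that(1)] subsetD[OF A that(2)] close[of x y]
    by (auto simp: \<phi>_def)
  have step': "mdist sphere_metric (\<phi> i x) (\<phi> (Suc i) y) \<le> b" if "x \<in> A" "y \<in> A" "mdist sphere_metric x y \<le> a" for i x y
  proof -
    have "mdist sphere_metric (\<phi> i x) (\<phi> (Suc i) y) \<le>
        mdist sphere_metric (\<phi> i x) (\<phi> i y) + mdist sphere_metric (\<phi> i y) (\<phi> (Suc i) y)"
      using norm_\<phi> that by (intro mdist_triangle) auto
    moreover have "mdist sphere_metric (\<phi> i y) (\<phi> (Suc i) y) \<le> b - a"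
      using n(2)[of y i] that A by (auto simp: \<phi>_def)
    ultimately show ?thesis using step[OF that, of i] by simp
  qed
  have "\<phi> 0 x = x" if "x \<in> A" for x
    using that A by (auto simp: \<phi>_def slide_def sgn_div_norm)
  moreover have "\<phi> i x = q" if "n \<le> i" for i x
  proof -
    have "min 1 (real i / real n) = 1" using that n(1) by (simp add: min_def)
    then show ?thesis using q by (simp add: \<phi>_def slide_def sgn_div_norm)
  qed
  moreover have "A \<subseteq> mspace sphere_metric" using A by auto
  ultimately have "contracts sphere_metric a b A \<phi> n q"
    unfolding contracts_def using norm_\<phi> order_trans[OF step less_imp_le[OF ab(2)]] step' by simp
  moreover have "mdist sphere_metric (\<phi> i x) q \<le> mdist sphere_metric x q" if "x \<in> A" for i x
  proof -
    have "slide q (min 1 (real i / real n)) q = q"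
      using q by (simp add: slide_def sgn_div_norm flip: scaleR_add_left)
    then show ?thesis using mono[OF that q, of i] that A q by (auto simp: dot_square_norm)
  qed
  ultimately show ?thesis by (rule that)
qed

text \<open>The near hemisphere slides to \<open>p\<close>. The open far hemisphere, more than pi/2
  away from \<open>p\<close> or exactly beyond the equator, slides to the antipode, which then walks
  to \<open>p\<close> along half a great circle in three jumps of pi/3: this is the origin of
  \<open>pi / 3 \<le> b\<close>.\<close>

lemma bicontractible_sphere:
  fixes p :: "'a::euclidean_space"
  assumes "2 \<le> DIM('a)" "norm p = 1" and ab: "0 < a" "a < b" "a < pi / 2" "pi / 3 \<le> b"
  shows "bicontractible sphere_metric a b p"
proof -
  define N where "N = {x :: 'a. norm x = 1 \<and> 0 \<le> x \<bullet> p}"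
  define F where "F = {x :: 'a. norm x = 1 \<and> x \<bullet> p < 0}"
  obtain \<phi> n where \<phi>: "contracts sphere_metric a b N \<phi> n p"
    "\<And>i x. x \<in> N \<Longrightarrow> mdist sphere_metric (\<phi> i x) p \<le> mdist sphere_metric x p"
    using contracts_hemisphere[OF assms(2) ab(1-3), of N] by (auto simp: N_def)
  have "norm (- p) = 1" "F \<subseteq> {x. norm x = 1 \<and> 0 \<le> x \<bullet> (- p)}" using assms(2) by (auto simp: F_def)
  from contracts_hemisphere[OF this(1) ab(1-3) this(2)]
  obtain \<psi> k where \<psi>: "contracts sphere_metric a b F \<psi> k (- p)" by metis
  obtain v where v: "norm v = 1" "p \<bullet> v = 0"
    using exists_orthogonal_unit_vector[OF assms(1)] by blast
  have pv: "p \<bullet> p = 1" "v \<bullet> v = 1" "v \<bullet> p = 0"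
    using assms v by (auto simp: dot_square_norm inner_commute)
  \<comment> \<open>\<open>w (-1)\<close> and \<open>w 1\<close> lie at angles 2 pi/3 and pi/3 from
    \<open>p\<close> and divide the half circle into three equal arcs.\<close>
  define w where "w s = (s / 2) *\<^sub>R p + (sqrt 3 / 2) *\<^sub>R v" for s :: real
  have ww: "w s \<bullet> w t = s * t / 4 + 3 / 4" for s t
    by (simp add: w_def inner_add_left inner_add_right pv v power_divide power2_eq_square[symmetric])
  have wp: "w s \<bullet> p = s / 2" "p \<bullet> w s = s / 2" for s
    by (simp_all add: w_def inner_add_left inner_add_right pv v)
  define \<gamma> :: "nat \<Rightarrow> 'a" where "\<gamma> i = (if i = 0 then - p else if i = 1 then w (-1) else if i = 2 then w 1 else p)" for i
  have norm_\<gamma>: "norm (\<gamma> i) = 1" for i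
    using assms(2) ww[of 1 1] ww[of "-1" "-1"] by (simp add: \<gamma>_def norm_eq_sqrt_inner pv)
  have "\<gamma> i \<bullet> \<gamma> (Suc i) \<ge> 1 / 2" for i
    using ww[of "-1" 1] by (simp add: \<gamma>_def wp pv)
  then have "mdist sphere_metric (\<gamma> i) (\<gamma> (Suc i)) \<le> pi / 3" for i
    using norm_\<gamma> by (subst mdist_sphere_le_iff; simp add: cos_60)
  then have "mdist sphere_metric (\<gamma> i) (\<gamma> (Suc i)) \<le> b" for i
    using ab(4) order_trans by blast
  then have "contracts sphere_metric a b F (\<lambda>i. if i \<le> k then \<psi> i else (\<lambda>_. \<gamma> (i - k))) (k + Suc 3) p"
    using norm_\<gamma> ab by (intro contracts_extend[OF \<psi>]) (auto simp: \<gamma>_def)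
  then obtain \<psi>' k' where \<psi>': "contracts sphere_metric a b F \<psi>' k' p" by blast
  have "a < mdist sphere_metric x p" if "x \<in> F" for x
    using that mdist_sphere_le_iff[of x p "pi / 2"] assms(2) ab(3) by (auto simp: F_def)
  moreover have "mspace sphere_metric \<subseteq> N \<union> F" "p \<in> N"
    using assms(2) by (auto simp: N_def F_def pv)
  ultimately show ?thesis
    unfolding bicontractible_def
    using \<phi>(2) contracts_mono[OF \<phi>(1), of "max n k'"] contracts_mono[OF \<psi>', of "max n k'"]
    by (intro exI[of _ N] exI[of _ F] exI[of _ \<phi>] exI[of _ \<psi>'] exI[of _ "max n k'"]) auto
qed

section \<open>The winding cocycle\<close>

definition log_increment :: "(real \<Rightarrow> complex) \<Rightarrow> complex" where
  "log_increment p = (SOME d. \<exists>g. continuous_on {0..1} g \<and> (\<forall>t\<in>{0..1}. p t = exp (g t)) \<and> d = g 1 - g 0)"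

text \<open>Two continuous logarithms of one path differ by a continuous function into the discrete
  set of multiples of 2 pi i, which is constant on the interval. So the choice made by
  \<open>SOME\<close> does not matter.\<close>

lemma log_increment_eq:
  assumes g: "continuous_on {0..1} g" "\<And>t. t \<in> {0..1} \<Longrightarrow> p t = exp (g t)"
  shows "log_increment p = g 1 - g 0"
proof -
  obtain h where h: "continuous_on {0..1} h" "\<forall>t\<in>{0..1}. p t = exp (h t)" "log_increment p = h 1 - h 0"
    using someI[of "\<lambda>d. \<exists>g. continuous_on {0..1} g \<and> (\<forall>t\<in>{0..1}. p t = exp (g t)) \<and> d = g 1 - g 0" "g 1 - g 0"] g
    unfolding log_increment_def by blast
  have "(\<lambda>t. h t - g t) constant_on {0..1}"
  proof (rule continuous_discrete_range_constant)
    show "continuous_on {0..1} (\<lambda>t. h t - g t)" using g h by (intro continuous_intros)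
    fix s :: real assume s: "s \<in> {0..1}"
    have one: "exp (h t - g t) = 1" if "t \<in> {0..1}" for t
      using that g(2)[OF that] h(2) by (simp add: exp_diff)
    have "2 * pi \<le> norm (h t - g t - (h s - g s))" if "t \<in> {0..1}" "h t - g t \<noteq> h s - g s" for t
    proof -
      have "2 * pi \<le> \<bar>Im (h t - g t) - Im (h s - g s)\<bar>"
        using exp_complex_eqI[of "h t - g t" "h s - g s"] one[OF s] one[OF that(1)] that(2) by force
      also have "\<dots> \<le> norm (h t - g t - (h s - g s))"
        using abs_Im_le_cmod[of "h t - g t - (h s - g s)"] by simp
      finally show ?thesis .
    qed
    then show "\<exists>e>0. \<forall>t. t \<in> {0..1} \<and> h t - g t \<noteq> h s - g s \<longrightarrow> e \<le> norm (h t - g t - (h s - g s))"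
      by (intro exI[of _ "2 * pi"]) auto
  qed (auto simp: is_interval_connected)
  then have "h 1 - g 1 = h 0 - g 0" by (auto simp: constant_on_def)
  then have "h 1 = g 1 + (h 0 - g 0)" by (metis add.commute diff_add_cancel)
  then show ?thesis using h(3) by simp
qed

definition simplex_edge :: "real \<Rightarrow> nat \<Rightarrow> real" where
  "simplex_edge t = (\<lambda>i. if i = 0 then 1 - t else if i = 1 then t else 0)"

definition simplex_triangle :: "real \<times> real \<Rightarrow> nat \<Rightarrow> real" where
  "simplex_triangle z = (\<lambda>i. if i = 0 then 1 - fst z - snd z else if i = 1 then fst z else if i = 2 then snd z else 0)"

lemma simplex_edge_in: "t \<in> {0..1} \<Longrightarrow> simplex_edge t \<in> standard_simplex 1"
  by (auto simp: simplex_edge_def standard_simplex_def)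

lemma simplex_triangle_in:
  "0 \<le> fst z \<Longrightarrow> 0 \<le> snd z \<Longrightarrow> fst z + snd z \<le> 1 \<Longrightarrow> simplex_triangle z \<in> standard_simplex 2"
  by (auto simp: simplex_triangle_def standard_simplex_def numeral_2_eq_2)

lemma simplical_face_edge:
  "simplical_face 0 (simplex_edge t) = simplex_triangle (1 - t, t)"
  "simplical_face 1 (simplex_edge t) = simplex_triangle (0, t)"
  "simplical_face 2 (simplex_edge t) = simplex_triangle (t, 0)"
  by (auto simp: simplical_face_def simplex_edge_def simplex_triangle_def fun_eq_iff)

text \<open>The number of turns of \<open>w\<close> along the edge \<open>s\<close>, with both ends of the path in \<open>\<complex> - {0}\<close>
  joined to \<open>1\<close> by principal logarithms.\<close>

definition turns :: "('a \<Rightarrow> complex) \<Rightarrow> ((nat \<Rightarrow> real) \<Rightarrow> 'a) \<Rightarrow> int" where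
  "turns w s = \<lfloor>Re ((log_increment (\<lambda>t. w (s (simplex_edge t))) -
     (Ln (w (s (simplex_edge 1))) - Ln (w (s (simplex_edge 0))))) / (2 * pi * \<i>))\<rfloor>"

text \<open>A continuous logarithm and the principal one differ by an integer multiple of 2 pi i at
  each point. Hence the floor in \<open>turns\<close> rounds nothing, and the number of turns is a
  difference of integers attached to the two ends.\<close>

lemma turns_eq:
  assumes g: "continuous_on {0..1} g" "\<And>t. t \<in> {0..1} \<Longrightarrow> w (s (simplex_edge t)) = exp (g t)"
  shows "of_int (turns w s) = (g 1 - Ln (w (s (simplex_edge 1)))) / (2 * pi * \<i>) -
           (g 0 - Ln (w (s (simplex_edge 0)))) / (2 * pi * \<i>)"
proof -
  have "\<exists>n::int. g t - Ln (w (s (simplex_edge t))) = of_int n * (2 * pi * \<i>)" if "t \<in> {0..1}" for t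
  proof -
    have "exp (g t) = exp (Ln (w (s (simplex_edge t))))" using g(2)[OF that] by simp
    then obtain n :: int where "g t = Ln (w (s (simplex_edge t))) + of_int (2 * n) * pi * \<i>"
      using exp_eq by auto
    then show ?thesis by (intro exI[of _ n]) simp
  qed
  then obtain m n :: int where mn: "g 1 - Ln (w (s (simplex_edge 1))) = of_int m * (2 * pi * \<i>)"
    "g 0 - Ln (w (s (simplex_edge 0))) = of_int n * (2 * pi * \<i>)"
    by (meson atLeastAtMost_iff order_refl zero_le_one)
  have "log_increment (\<lambda>t. w (s (simplex_edge t))) - (Ln (w (s (simplex_edge 1))) - Ln (w (s (simplex_edge 0)))) =
      (g 1 - Ln (w (s (simplex_edge 1)))) - (g 0 - Ln (w (s (simplex_edge 0))))"
    using log_increment_eq[of g "\<lambda>t. w (s (simplex_edge t))"] g by simp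
  also have "\<dots> = of_int (m - n) * (2 * pi * \<i>)"
    unfolding mn by (simp add: algebra_simps)
  finally have "turns w s = \<lfloor>Re (of_int (m - n) * (2 * pi * \<i>) / (2 * pi * \<i>))\<rfloor>"
    unfolding turns_def by (simp only:)
  then have "turns w s = m - n" by simp
  then show ?thesis unfolding mn by simp
qed

definition winding_cochain :: "'a topology \<Rightarrow> ('a \<Rightarrow> complex) \<Rightarrow> ('a, 'k::field) cochain" where
  "winding_cochain X w = (\<lambda>n s. if n = 1 \<and> singular_simplex 1 X s then of_int (turns w s) else 0)"

lemma continuous_on_simplex:
  fixes P :: "'c::topological_space \<Rightarrow> nat \<Rightarrow> real"
  assumes s: "singular_simplex n X s" and w: "continuous_map X euclidean w"
    and P: "\<And>i. continuous_on A (\<lambda>x. P x i)" "\<And>x. x \<in> A \<Longrightarrow> P x \<in> standard_simplex n"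
  shows "continuous_on A (\<lambda>x. w (s (P x)))"
proof -
  have "continuous_map (top_of_set A) (subtopology (powertop_real UNIV) (standard_simplex n)) P"
    using P by (auto simp: continuous_map_in_subtopology continuous_map_componentwise_UNIV)
  moreover have "continuous_map (subtopology (powertop_real UNIV) (standard_simplex n)) X s"
    using s by (simp add: singular_simplex_def)
  ultimately have "continuous_map (top_of_set A) euclidean (w \<circ> (s \<circ> P))"
    using w by (intro continuous_map_compose)
  then show ?thesis by (simp add: o_def)
qed

lemma singular_simplex_in_topspace:
  "singular_simplex n X s \<Longrightarrow> x \<in> standard_simplex n \<Longrightarrow> s x \<in> topspace X"
  by (auto simp: singular_simplex_def continuous_map_def)

text \<open>On a 2-simplex, which is contractible, \<open>w\<close> has a continuous logarithm
  \<open>G\<close>. The turns along each edge become differences of the vertex values of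
  \<open>N\<close>, so their alternating sum vanishes, first among integers and then in
  \<open>'k\<close>.\<close>

lemma winding_cocycle:
  assumes w: "continuous_map X euclidean w" "\<And>x. x \<in> topspace X \<Longrightarrow> w x \<noteq> 0"
  shows "(winding_cochain X w :: ('a, 'k::field) cochain) \<in> cocycles X"
proof -
  let ?c = "winding_cochain X w :: ('a, 'k) cochain"
  have "finite {n. \<exists>s. ?c n s \<noteq> 0}"
    by (rule finite_subset[of _ "{1}"]) (auto simp: winding_cochain_def split: if_splits)
  then have "?c \<in> cochains X" by (auto simp: cochains_def winding_cochain_def)
  moreover have "coboundary X ?c n s = 0" for n s
  proof (cases "n = 2 \<and> singular_simplex 2 X s")
    case False
    moreover have "n - Suc 0 = Suc 0 \<longleftrightarrow> n = 2" by auto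
    ultimately show ?thesis by (auto simp: coboundary_def winding_cochain_def)
  next
    case True
    then have s: "singular_simplex 2 X s" by simp
    define T where "T = {z :: real \<times> real. 0 \<le> fst z \<and> 0 \<le> snd z \<and> fst z + snd z \<le> 1}"
    have "convex T" unfolding convex_alt
    proof (intro ballI allI impI)
      fix x y u assume *: "x \<in> T" "y \<in> T" "0 \<le> u \<and> u \<le> (1::real)"
      then have "(1 - u) * (fst x + snd x) + u * (fst y + snd y) \<le> 1"
        by (intro convex_bound_le) (auto simp: T_def)
      then have "((1 - u) * fst x + u * fst y) + ((1 - u) * snd x + u * snd y) \<le> 1"
        by (simp add: algebra_simps)
      moreover have "0 \<le> (1 - u) * fst x + u * fst y" "0 \<le> (1 - u) * snd x + u * snd y"
        using * by (auto simp: T_def intro!: add_nonneg_nonneg mult_nonneg_nonneg)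
      ultimately show "(1 - u) *\<^sub>R x + u *\<^sub>R y \<in> T" by (simp add: T_def)
    qed
    then have "contractible T" by (rule convex_imp_contractible)
    moreover have "continuous_on T (\<lambda>z. w (s (simplex_triangle z)))"
    proof (rule continuous_on_simplex[OF s w(1)])
      fix i :: nat
      consider "i = 0" | "i = 1" | "i = 2" | "2 < i" by linarith
      then show "continuous_on T (\<lambda>z. simplex_triangle z i)"
        by cases (auto simp: simplex_triangle_def intro!: continuous_intros)
    qed (auto simp: T_def simplex_triangle_in)
    moreover have "w (s (simplex_triangle z)) \<noteq> 0" if "z \<in> T" for z
      using that s by (intro w(2) singular_simplex_in_topspace[OF s] simplex_triangle_in) (auto simp: T_def)
    ultimately obtain G where G: "continuous_on T G" "\<And>z. z \<in> T \<Longrightarrow> w (s (simplex_triangle z)) = exp (G z)"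
      using continuous_logarithm_on_contractible[of T "\<lambda>z. w (s (simplex_triangle z))"] by metis
    define N where "N z = (G z - Ln (w (s (simplex_triangle z)))) / (2 * pi * \<i>)" for z
    have turns: "of_int (turns w (singular_face 2 k s)) = N (e 1) - N (e 0)"
      if e: "\<And>t. t \<in> {0..1} \<Longrightarrow> e t \<in> T" "continuous_on {0..1} e"
        "\<And>t. simplical_face k (simplex_edge t) = simplex_triangle (e t)" for k and e :: "real \<Rightarrow> real \<times> real"
    proof -
      have face: "singular_face 2 k s (simplex_edge t) = s (simplex_triangle (e t))" if "t \<in> {0..1}" for t
        using simplex_edge_in[OF that] e(3) by (simp add: singular_face_def)
      have "continuous_on {0..1} (\<lambda>t. G (e t))"
        by (rule continuous_on_compose2[OF G(1) e(2)]) (use e(1) in blast)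
      moreover have "w (singular_face 2 k s (simplex_edge t)) = exp (G (e t))" if "t \<in> {0..1}" for t
        using face[OF that] G(2) e(1)[OF that] by simp
      ultimately show ?thesis
        using turns_eq[of "\<lambda>t. G (e t)" w "singular_face 2 k s"] face[of 0] face[of 1] by (simp add: N_def)
    qed
    have "of_int (turns w (singular_face 2 0 s)) = N (0, 1) - N (1, 0)"
      using turns[of "\<lambda>t. (1 - t, t)" 0] by (simp add: T_def simplical_face_edge continuous_intros)
    moreover have "of_int (turns w (singular_face 2 1 s)) = N (0, 1) - N (0, 0)"
      using turns[of "\<lambda>t. (0, t)" 1] by (simp add: T_def simplical_face_edge[unfolded One_nat_def] continuous_intros)
    moreover have "of_int (turns w (singular_face 2 2 s)) = N (1, 0) - N (0, 0)"
      using turns[of "\<lambda>t. (t, 0)" 2] by (simp add: T_def simplical_face_edge continuous_intros)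
    ultimately have "(of_int (turns w (singular_face 2 0 s) - turns w (singular_face 2 1 s) +
        turns w (singular_face 2 2 s)) :: complex) = 0" by simp
    then have "turns w (singular_face 2 0 s) - turns w (singular_face 2 1 s) + turns w (singular_face 2 2 s) = 0"
      using of_int_eq_0_iff by blast
    then have "(of_int (turns w (singular_face 2 0 s)) - of_int (turns w (singular_face 2 1 s)) +
        of_int (turns w (singular_face 2 2 s)) :: 'k) = 0"
      by (metis of_int_0 of_int_add of_int_diff)
    moreover have "singular_simplex 1 X (singular_face 2 k s)" if "k \<le> 2" for k
      using singular_simplex_singular_face[OF s, of k] that by simp
    ultimately show ?thesis
      using s True by (simp add: coboundary_def winding_cochain_def numeral_2_eq_2)
  qed
  ultimately show ?thesis by (auto simp: cocycles_def)
qed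

section \<open>Centers of mass\<close>

text \<open>Faces 0 and 2 carry the same sign in the coboundary, so exchanging them changes nothing.
  This plays the role of evaluation on the cycle formed by the difference of the two triangles of a
  square torus.\<close>

lemma coboundary_torus_faces:
  assumes "\<rho> \<in> coboundaries X" "singular_simplex 2 X \<sigma>" "singular_simplex 2 X \<tau>"
    and "singular_face 2 0 \<sigma> = singular_face 2 2 \<tau>" "singular_face 2 1 \<sigma> = singular_face 2 1 \<tau>"
      "singular_face 2 2 \<sigma> = singular_face 2 0 \<tau>"
  shows "\<rho> 2 \<sigma> = \<rho> 2 \<tau>"
  using assms by (auto simp: coboundaries_def coboundary_def numeral_2_eq_2)

text \<open>The squared norm is at least (1 - c) times the sum of squared weights, plus
  \<open>c\<close>. With at most three weights adding to 1 the squares sum to at least 1/3, which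
  gives (1 + 2c)/3, positive exactly when \<open>c\<close> exceeds -1/2.\<close>

lemma convex_combination_nonzero:
  fixes T :: "complex set"
  assumes T: "finite T" "card T \<le> 3" "\<And>v. v \<in> T \<Longrightarrow> norm v = 1" "\<And>v w. v \<in> T \<Longrightarrow> w \<in> T \<Longrightarrow> c \<le> v \<bullet> w"
    and c: "- 1 / 2 < c" "c \<le> 1" and l: "\<And>v. v \<in> T \<Longrightarrow> 0 \<le> l v" "sum l T = 1"
  shows "(\<Sum>v\<in>T. l v *\<^sub>R v) \<noteq> 0"
proof
  assume "(\<Sum>v\<in>T. l v *\<^sub>R v) = 0"
  then have "0 = (\<Sum>v\<in>T. l v *\<^sub>R v) \<bullet> (\<Sum>w\<in>T. l w *\<^sub>R w)" by simp
  also have "\<dots> = (\<Sum>v\<in>T. \<Sum>w\<in>T. l v * l w * (v \<bullet> w))"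
    unfolding inner_sum_left unfolding inner_sum_right by (simp add: mult_ac)
  finally have "0 = (\<Sum>v\<in>T. \<Sum>w\<in>T. l v * l w * (v \<bullet> w))" .
  moreover have "(\<Sum>v\<in>T. \<Sum>w\<in>T. l v * l w * ((if v = w then 1 - c else 0) + c)) \<le> (\<Sum>v\<in>T. \<Sum>w\<in>T. l v * l w * (v \<bullet> w))"
    using T(3,4) l(1) by (intro sum_mono mult_left_mono) (auto simp: dot_square_norm)
  moreover have "(\<Sum>v\<in>T. \<Sum>w\<in>T. l v * l w * ((if v = w then 1 - c else 0) + c)) =
      (1 - c) * (\<Sum>v\<in>T. (l v)\<^sup>2) + c * (sum l T)\<^sup>2"
  proof -
    have "(\<Sum>w\<in>T. l v * l w * ((if v = w then 1 - c else 0) + c)) = (1 - c) * (l v)\<^sup>2 + c * l v * sum l T"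
      if "v \<in> T" for v
    proof -
      have "(\<Sum>w\<in>T. l v * l w * ((if v = w then 1 - c else 0) + c)) =
          (\<Sum>w\<in>T. (if v = w then (1 - c) * (l v)\<^sup>2 else 0) + c * l v * l w)"
        by (intro sum.cong refl) (simp add: power2_eq_square distrib_left mult_ac)
      then show ?thesis using T(1) that by (simp add: sum.distrib sum_distrib_left)
    qed
    then have "(\<Sum>v\<in>T. \<Sum>w\<in>T. l v * l w * ((if v = w then 1 - c else 0) + c)) =
        (\<Sum>v\<in>T. (1 - c) * (l v)\<^sup>2 + c * sum l T * l v)"
      by (intro sum.cong) (auto simp: algebra_simps)
    then show ?thesis by (simp add: sum.distrib sum_distrib_left[symmetric] power2_eq_square)
  qed
  moreover have "1 \<le> 3 * (\<Sum>v\<in>T. (l v)\<^sup>2)"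
  proof -
    have "1 \<le> (\<Sum>v\<in>T. (l v)\<^sup>2) * card T"
      using sum_squared_le_sum_of_squares[of l T] l(2) by simp
    also have "\<dots> \<le> (\<Sum>v\<in>T. (l v)\<^sup>2) * 3"
      using T(2) by (intro mult_left_mono sum_nonneg) auto
    finally show ?thesis by simp
  qed
  then have "(1 - c) * 1 \<le> (1 - c) * (3 * (\<Sum>v\<in>T. (l v)\<^sup>2))"
    using c by (intro mult_left_mono) auto
  ultimately show False using c l(2) by simp
qed

definition center :: "('a \<Rightarrow> complex) \<Rightarrow> ('a \<Rightarrow> real) \<Rightarrow> complex" where
  "center c u = (\<Sum>v | u v \<noteq> 0. u v *\<^sub>R c v)"

lemma center_on_cell:
  assumes "u \<in> closed_cell S" "finite S"
  shows "center c u = (\<Sum>v\<in>S. u v *\<^sub>R c v)"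
  unfolding center_def using assms
  by (intro sum.mono_neutral_left) (auto simp: closed_cell_def)

lemma continuous_map_center:
  assumes "\<And>S. S \<in> K \<Longrightarrow> finite S"
  shows "continuous_map (geometric_realization K) euclidean (center c)"
proof (rule continuous_map_from_realization)
  fix S assume S: "S \<in> K"
  have "continuous_map (subtopology (powertop_real UNIV) (closed_cell S)) euclideanreal (\<lambda>u. u v)" for v
    by (intro continuous_map_from_subtopology continuous_map_product_projection) auto
  moreover have "continuous_map euclideanreal euclidean (\<lambda>r. r *\<^sub>R c v)" for v
    by (auto intro!: continuous_intros)
  ultimately have "continuous_map (subtopology (powertop_real UNIV) (closed_cell S)) euclidean (\<lambda>u. u v *\<^sub>R c v)" for v
    using continuous_map_compose[of _ euclideanreal "\<lambda>u. u v" euclidean "\<lambda>r. r *\<^sub>R c v"] by (simp add: o_def)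
  then have "continuous_map (subtopology (powertop_real UNIV) (closed_cell S)) euclidean (\<lambda>u. \<Sum>v\<in>S. u v *\<^sub>R c v)"
    using assms[OF S] by (intro continuous_map_sum)
  then show "continuous_map (subtopology (powertop_real UNIV) (closed_cell S)) euclidean (center c)"
    by (rule continuous_map_eq) (simp add: center_on_cell[OF _ assms[OF S]])
qed

text \<open>A simplex may have many vertices, but Caratheodory's theorem in the plane reduces a
  convex combination equal to 0 to one of at most three of the points \<open>c v\<close>.\<close>

lemma center_nonzero:
  assumes u: "u \<in> closed_cell S" "finite S" and c: "\<And>v. v \<in> S \<Longrightarrow> norm (c v) = 1"
    "\<And>v w. v \<in> S \<Longrightarrow> w \<in> S \<Longrightarrow> d \<le> c v \<bullet> c w" and d: "- 1 / 2 < d" "d \<le> 1"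
  shows "center c u \<noteq> 0"
proof
  assume 0: "center c u = 0"
  have "(\<Sum>v\<in>S. u v *\<^sub>R c v) \<in> convex hull (c ` S)"
    using u by (intro convex_sum) (auto simp: closed_cell_def intro: hull_inc)
  then have "0 \<in> convex hull (c ` S)" using 0 center_on_cell[OF u, of c] by simp
  then obtain T where T: "finite T" "T \<subseteq> c ` S" "card T \<le> 3" "0 \<in> convex hull T"
    unfolding caratheodory[of "c ` S"] by auto
  have "\<exists>l. (\<forall>v\<in>T. 0 \<le> l v) \<and> sum l T = 1 \<and> (\<Sum>v\<in>T. l v *\<^sub>R v) = 0"
    using T(4) by (simp only: convex_hull_finite[OF T(1)] mem_Collect_eq)
  then obtain l where l: "\<forall>v\<in>T. 0 \<le> l v" "sum l T = 1" "(\<Sum>v\<in>T. l v *\<^sub>R v) = 0"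
    by (elim exE conjE)
  have "norm v = 1" if "v \<in> T" for v using that T(2) c(1) by auto
  moreover have "d \<le> v \<bullet> w" if "v \<in> T" "w \<in> T" for v w
    using subsetD[OF T(2) that(1)] subsetD[OF T(2) that(2)] c(2) by auto
  ultimately have "(\<Sum>v\<in>T. l v *\<^sub>R v) \<noteq> 0"
    using l(1,2) by (intro convex_combination_nonzero[OF T(1,3) _ _ d]) auto
  then show False using l(3) by simp
qed

section \<open>The torus in its Rips complexes\<close>

text \<open>Normalised tent functions around a finite net. Finiteness of \<open>G\<close> later
  confines the image of the torus to finitely many cells.\<close>

lemma circle_partition_of_unity:
  assumes "0 < d"
  obtains G :: "complex set" and l :: "complex \<Rightarrow> complex \<Rightarrow> real"
  where "finite G" "G \<subseteq> sphere 0 1" "\<forall>x. continuous_on (sphere 0 1) (\<lambda>z. l z x)" "\<forall>z x. 0 \<le> l z x"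
    "\<forall>z x. l z x \<noteq> 0 \<longrightarrow> x \<in> G \<and> dist x z < d" "\<forall>z\<in>sphere 0 1. (\<Sum>x\<in>G. l z x) = 1"
proof -
  have "compact (sphere 0 1 :: complex set)" "sphere 0 1 \<subseteq> (\<Union>x\<in>sphere 0 1. ball x d :: complex set)"
    using assms by auto
  from compactE_image[OF this(1) open_ball this(2)]
  obtain G :: "complex set" where G: "finite G" "G \<subseteq> sphere 0 1" "sphere 0 1 \<subseteq> (\<Union>x\<in>G. ball x d)"
    by metis
  define h where "h z x = max 0 (d - dist x z)" for z x :: complex
  have h: "0 \<le> h z x" "h z x \<noteq> 0 \<longleftrightarrow> dist x z < d" for z x by (auto simp: h_def)
  have pos: "0 < (\<Sum>x\<in>G. h z x)" if z: "z \<in> sphere 0 1" for z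
  proof -
    obtain x where "x \<in> G" "dist x z < d" using G(3) z by auto
    then show ?thesis using G(1) h by (intro sum_pos2[of G x]) (auto simp: less_le)
  qed
  define l where "l z x = (if x \<in> G then h z x / (\<Sum>y\<in>G. h z y) else 0)" for z x
  show ?thesis
  proof (rule that[OF G(1,2)]; intro allI ballI impI)
    fix x
    have "continuous_on (sphere 0 1) (\<lambda>z. h z x / (\<Sum>y\<in>G. h z y))"
      using pos unfolding h_def by (intro continuous_intros) force
    then show "continuous_on (sphere 0 1) (\<lambda>z. l z x)" by (cases "x \<in> G") (simp_all add: l_def)
  next
    show "0 \<le> l z x" for z x using h by (auto simp: l_def intro!: divide_nonneg_nonneg sum_nonneg)
    show "x \<in> G \<and> dist x z < d" if "l z x \<noteq> 0" for z x using that h by (auto simp: l_def split: if_splits)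
    show "(\<Sum>x\<in>G. l z x) = 1" if "z \<in> sphere 0 1" for z
      using pos[OF that] by (simp add: l_def flip: sum_divide_distrib)
  qed
qed

section \<open>Mapping the torus into its Rips complex\<close>

lemma mspace_torus2: "mspace torus2 = sphere 0 1 \<times> sphere 0 1"
  by (simp add: torus2_def)

lemma mdist_torus2:
  "mdist torus2 u v = max (mdist sphere_metric (fst u) (fst v)) (mdist sphere_metric (snd u) (snd v))"
  by (cases u; cases v) (simp add: torus2_def)

text \<open>A point of the torus is sent to the product of two partition-of-unity weights on nearby
  vertices. Each center of mass sees only one marginal, a weighted mean of points close to
  \<open>z\<close> or \<open>w\<close>, so the loops of the torus keep their winding
  numbers.\<close>

lemma torus_into_rips:
  assumes "0 < a"
  obtains j m where
    "continuous_map (top_of_set (sphere 0 1 \<times> sphere 0 1)) (geometric_realization (rips_complex torus2 a)) j"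
    "\<forall>z\<in>sphere 0 1. \<forall>w\<in>sphere 0 1. center fst (j (z, w)) = m z \<and> center snd (j (z, w)) = m w"
    "continuous_on (sphere 0 1) m" "\<forall>z\<in>sphere 0 1. dist (m z) z < 1"
proof -
  obtain e where e: "0 < e"
    "\<And>x y :: complex. norm x = 1 \<Longrightarrow> norm y = 1 \<Longrightarrow> dist x y < e \<Longrightarrow> mdist sphere_metric x y \<le> a"
    using mdist_sphere_le_if_close[OF assms] by blast
  \<comment> \<open>Half of \<open>e\<close> keeps any two vertices of a support within
    \<open>e\<close> of each other; 1/2 keeps the weighted mean \<open>m z\<close> within 1 of
    \<open>z\<close>.\<close>
  define d where "d = min (e / 2) (1 / 2)"
  have d: "0 < d" "d \<le> e / 2" "d \<le> 1 / 2" using e by (auto simp: d_def)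
  obtain G :: "complex set" and l :: "complex \<Rightarrow> complex \<Rightarrow> real" where G: "finite G" "G \<subseteq> sphere 0 1"
    and l: "\<forall>x. continuous_on (sphere 0 1) (\<lambda>z. l z x)" "\<forall>z x. 0 \<le> l z x"
    "\<forall>z x. l z x \<noteq> 0 \<longrightarrow> x \<in> G \<and> dist x z < d" "\<forall>z\<in>sphere 0 1. (\<Sum>x\<in>G. l z x) = 1"
    by (rule circle_partition_of_unity[OF d(1)], erule that, assumption+)
  then have l: "\<And>x. continuous_on (sphere 0 1) (\<lambda>z. l z x)" "\<And>z x. 0 \<le> l z x"
    "\<And>z x. l z x \<noteq> 0 \<Longrightarrow> x \<in> G \<and> dist x z < d" "\<And>z. z \<in> sphere 0 1 \<Longrightarrow> (\<Sum>x\<in>G. l z x) = 1"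
    by auto
  define j where "j = (\<lambda>(z, w) (x, y). l z x * l w y)"
  define m where "m z = (\<Sum>x\<in>G. l z x *\<^sub>R x)" for z
  \<comment> \<open>Used twice: with the support, which is a simplex at scale \<open>a\<close>, and
    with all of \<open>G \<times> G\<close>, on which the centers are computed as double
    sums.\<close>
  have cell: "j (z, w) \<in> closed_cell T" if zw: "z \<in> sphere 0 1" "w \<in> sphere 0 1"
    and T: "T \<subseteq> G \<times> G" "\<And>x y. l z x \<noteq> 0 \<Longrightarrow> l w y \<noteq> 0 \<Longrightarrow> (x, y) \<in> T" for z w T
  proof -
    have zero: "l z x * l w y = 0" if "(x, y) \<notin> T" for x y using T(2) that by fastforce
    then have "(\<Sum>v\<in>T. j (z, w) v) = (\<Sum>v\<in>G \<times> G. j (z, w) v)"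
      using T(1) G(1) by (intro sum.mono_neutral_left) (auto simp: j_def simp del: mult_eq_0_iff)
    also have "\<dots> = (\<Sum>x\<in>G. l z x) * (\<Sum>y\<in>G. l w y)"
      by (simp add: j_def sum_product sum.cartesian_product)
    finally show ?thesis
      using l(2,4) zw zero by (auto simp: closed_cell_def j_def simp del: mult_eq_0_iff)
  qed
  have "\<exists>T\<in>rips_complex torus2 a. T \<subseteq> G \<times> G \<and> j (z, w) \<in> closed_cell T"
    if zw: "z \<in> sphere 0 1" "w \<in> sphere 0 1" for z w
  proof (intro bexI conjI)
    let ?T = "{x. l z x \<noteq> 0} \<times> {y. l w y \<noteq> 0}"
    show T: "?T \<subseteq> G \<times> G" using l(3) by auto
    show cT: "j (z, w) \<in> closed_cell ?T" using T by (intro cell zw) auto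
    have "(\<Sum>v\<in>?T. j (z, w) v) = 1" using cT unfolding closed_cell_def by blast
    then have "?T \<noteq> {}" by (metis sum.empty zero_neq_one)
    moreover have "finite ?T" using T G(1) finite_subset by blast
    moreover have "mdist sphere_metric x y \<le> a" if "l z x \<noteq> 0" "l z y \<noteq> 0" for x y z
    proof -
      have "dist x y < e"
        using l(3)[OF that(1)] l(3)[OF that(2)] d dist_triangle_half_r[of z x e y] by (auto simp: dist_commute)
      then show ?thesis using l(3)[OF that(1)] l(3)[OF that(2)] G(2) by (intro e(2)) auto
    qed
    moreover have "?T \<subseteq> mspace torus2" using T G(2) by (auto simp: mspace_torus2)
    ultimately show "?T \<in> rips_complex torus2 a"
      by (auto simp: rips_complex_def mdist_torus2)
  qed
  then have img: "j ` (sphere 0 1 \<times> sphere 0 1) \<subseteq> (\<Union>T\<in>{T \<in> rips_complex torus2 a. T \<subseteq> G \<times> G}. closed_cell T)"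
    by fastforce
  have "continuous_on (sphere 0 1 \<times> sphere 0 1) (\<lambda>p. j p v)" for v
  proof -
    have "continuous_on (sphere 0 1 \<times> sphere 0 1) (\<lambda>p. l (fst p) (fst v) * l (snd p) (snd v))"
      by (intro continuous_intros continuous_on_compose2[OF l(1)]) auto
    then show ?thesis by (simp add: j_def case_prod_beta)
  qed
  then have "continuous_map (top_of_set (sphere 0 1 \<times> sphere 0 1)) (powertop_real UNIV) j"
    by (simp add: continuous_map_componentwise_UNIV)
  then have "continuous_map (top_of_set (sphere 0 1 \<times> sphere 0 1)) (geometric_realization (rips_complex torus2 a)) j"
    by (rule continuous_map_into_realization[where F = "{T \<in> rips_complex torus2 a. T \<subseteq> G \<times> G}"])
      (use G(1) img finite_rips_complex in auto)
  moreover have "center fst (j (z, w)) = m z \<and> center snd (j (z, w)) = m w"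
    if zw: "z \<in> sphere 0 1" "w \<in> sphere 0 1" for z w
  proof -
    have jc: "j (z, w) \<in> closed_cell (G \<times> G)" using l(3) by (intro cell zw) auto
    have center: "center c (j (z, w)) = (\<Sum>v\<in>G \<times> G. j (z, w) v *\<^sub>R c v)" for c
      by (rule center_on_cell[OF jc]) (simp add: G(1))
    have "center fst (j (z, w)) = (\<Sum>x\<in>G. \<Sum>y\<in>G. l w y *\<^sub>R l z x *\<^sub>R x)"
      unfolding center by (simp add: sum.cartesian_product' j_def mult.commute)
    also have "\<dots> = m z"
      using l(4)[OF zw(2)] by (simp add: m_def flip: scaleR_left.sum sum_distrib_right)
    finally have fst_eq: "center fst (j (z, w)) = m z" .
    have "center snd (j (z, w)) = (\<Sum>x\<in>G. \<Sum>y\<in>G. l z x *\<^sub>R l w y *\<^sub>R y)"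
      unfolding center by (simp add: sum.cartesian_product' j_def)
    also have "\<dots> = (\<Sum>y\<in>G. \<Sum>x\<in>G. l z x *\<^sub>R l w y *\<^sub>R y)" by (rule sum.swap)
    also have "\<dots> = m w"
      using l(4)[OF zw(1)] by (simp add: m_def flip: scaleR_left.sum sum_distrib_right)
    finally have "center snd (j (z, w)) = m w" .
    with fst_eq show ?thesis by simp
  qed
  moreover have "continuous_on (sphere 0 1) m"
    unfolding m_def by (intro continuous_intros l(1))
  moreover have "dist (m z) z < 1" if "z \<in> sphere 0 1" for z
  proof -
    have "z = (\<Sum>x\<in>G. l z x *\<^sub>R z)" using l(4)[OF that] by (simp flip: scaleR_left.sum)
    then have "m z - z = (\<Sum>x\<in>G. l z x *\<^sub>R (x - z))"
      by (simp add: m_def scaleR_diff_right sum_subtractf)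
    then have "norm (m z - z) \<le> (\<Sum>x\<in>G. norm (l z x *\<^sub>R (x - z)))"
      by (simp only: norm_sum)
    also have "\<dots> \<le> (\<Sum>x\<in>G. l z x * (1 / 2))"
    proof (intro sum_mono)
      fix x assume "x \<in> G"
      show "norm (l z x *\<^sub>R (x - z)) \<le> l z x * (1 / 2)"
        using l(2)[of z x] l(3)[of z x] d(3) by (cases "l z x = 0") (auto simp: dist_norm intro!: mult_left_mono)
    qed
    also have "\<dots> = 1 / 2" using l(4)[OF that] by (simp flip: sum_divide_distrib)
    finally show ?thesis by (simp add: dist_norm)
  qed
  ultimately show ?thesis by (intro that) auto
qed

section \<open>Winding numbers of the loops and the cup product on the torus\<close>

lemma turns_const:
  assumes "k \<noteq> 0" "\<And>t. t \<in> {0..1} \<Longrightarrow> w (s (simplex_edge t)) = k"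
  shows "turns w s = 0"
proof -
  have "(of_int (turns w s) :: complex) = 0"
    using turns_eq[of "\<lambda>_. Ln k" w s] assms by simp
  then show ?thesis by simp
qed

text \<open>The quotient \<open>m z / z\<close> stays in the right half-plane, where the principal
  logarithm is continuous. Adding it to 2 pi i t gives a logarithm along the loop; its increment is
  2 pi i because the quotient returns to its initial value.\<close>

lemma turns_circle:
  assumes m: "continuous_on (sphere 0 1) m" "\<And>z. z \<in> sphere 0 1 \<Longrightarrow> dist (m z) z < 1"
    and w: "\<And>t. t \<in> {0..1} \<Longrightarrow> w (s (simplex_edge t)) = m (cis (2 * pi * t))"
  shows "turns w s = 1"
proof -
  have near: "norm (m (cis x) / cis x - 1) < 1" for x
  proof -
    have "m (cis x) / cis x - 1 = (m (cis x) - cis x) / cis x" by (simp add: diff_divide_distrib)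
    then show ?thesis using m(2)[of "cis x"] by (simp add: norm_divide dist_norm)
  qed
  have Re: "0 < Re (m (cis x) / cis x)" for x
    using near[of x] complex_Re_le_cmod[of "1 - m (cis x) / cis x"] by (simp add: norm_minus_commute)
  define g where "g t = \<i> * (2 * pi * t) + Ln (m (cis (2 * pi * t)) / cis (2 * pi * t))" for t :: real
  have "continuous_on {0..1} (\<lambda>t. m (cis (2 * pi * t)))"
    by (rule continuous_on_compose2[OF m(1)]) (auto intro!: continuous_intros)
  then have "continuous_on {0..1} (\<lambda>t. m (cis (2 * pi * t)) / cis (2 * pi * t))"
    by (intro continuous_intros) auto
  moreover have "m (cis (2 * pi * t)) / cis (2 * pi * t) \<notin> \<real>\<^sub>\<le>\<^sub>0" for t :: real
    using Re[of "2 * pi * t"] by (auto simp: complex_nonpos_Reals_iff)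
  ultimately have "continuous_on {0..1} (\<lambda>t. Ln (m (cis (2 * pi * t)) / cis (2 * pi * t)))"
    by (intro continuous_on_Ln') auto
  then have "continuous_on {0..1} g"
    unfolding g_def by (intro continuous_on_add) (auto intro!: continuous_intros)
  moreover have "exp (g t) = m (cis (2 * pi * t))" for t
  proof -
    have "m (cis (2 * pi * t)) / cis (2 * pi * t) \<noteq> 0" using Re[of "2 * pi * t"] by auto
    moreover have "exp (\<i> * (2 * pi * t)) = cis (2 * pi * t)" by (simp add: cis_conv_exp)
    ultimately show ?thesis by (simp add: g_def exp_add)
  qed
  ultimately have "(of_int (turns w s) :: complex) = (g 1 - g 0) / (2 * pi * \<i>)"
    using turns_eq[of g w s] w[of 0] w[of 1] w by (simp add: diff_divide_distrib)
  also have "\<dots> = 1" by (simp add: g_def)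
  finally show ?thesis by simp
qed

text \<open>The winding cocycles of the two centers exist up to scale \<open>b\<close> and are
  pulled back to scale \<open>a\<close>. Their product takes the values 1 and 0 on two triangles on
  which every coboundary agrees.\<close>

theorem persistent_cup_torus2:
  assumes ab: "0 < a" "a \<le> b" "b < 2 * pi / 3"
  shows "2 \<le> persistent_cup (K :: 'k::field itself) (rips torus2) a b"
proof -
  let ?X = "geometric_realization (rips_complex torus2 a)"
  let ?Y = "geometric_realization (rips_complex torus2 b)"
  let ?S = "sphere 0 1 :: complex set"
  let ?f = "\<lambda>u :: complex \<times> complex \<Rightarrow> real. u"
  let ?P = "cochain_pullback ?X ?f :: (_, 'k) cochain \<Rightarrow> _"
  have f: "continuous_map ?X ?Y ?f"
    using continuous_map_rips[OF ab(2), of torus2] by (simp add: rips_def)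
  obtain j m where j: "continuous_map (top_of_set (?S \<times> ?S)) ?X j"
    and "\<forall>z\<in>?S. \<forall>w\<in>?S. center fst (j (z, w)) = m z \<and> center snd (j (z, w)) = m w"
      "continuous_on ?S m" "\<forall>z\<in>?S. dist (m z) z < 1"
    by (rule torus_into_rips[OF ab(1)], erule that, assumption+)
  then have m: "\<And>z w. z \<in> ?S \<Longrightarrow> w \<in> ?S \<Longrightarrow> center fst (j (z, w)) = m z \<and> center snd (j (z, w)) = m w"
    "continuous_on ?S m" "\<And>z. z \<in> ?S \<Longrightarrow> dist (m z) z < 1"
    by auto
  have nz: "center c u \<noteq> 0" if c: "c = fst \<or> c = snd" and u: "u \<in> topspace ?Y" for c u
  proof -
    obtain T where T: "T \<in> rips_complex torus2 b" "u \<in> closed_cell T"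
      using u by (auto simp: topspace_geometric_realization)
    have "cos (2 * pi / 3) < cos b" using ab by (intro cos_monotone_0_pi) auto
    then have cosb: "- 1 / 2 < cos b" "cos b \<le> 1" by (simp_all add: cos_120)
    show ?thesis
    proof (rule center_nonzero[OF T(2) finite_rips_complex[OF T(1)] _ _ cosb])
      show n: "norm (c v) = 1" if "v \<in> T" for v
        using that T(1) c by (auto simp: rips_complex_def mspace_torus2)
      show "cos b \<le> c v \<bullet> c w" if "v \<in> T" "w \<in> T" for v w
      proof -
        have "mdist sphere_metric (c v) (c w) \<le> b"
          using that T(1) c by (auto simp: rips_complex_def mdist_torus2)
        then show ?thesis using mdist_sphere_le_iff[OF n[OF that(1)] n[OF that(2)], of b] ab by auto
      qed
    qed
  qed
  have centers: "continuous_map ?Y euclidean (center c)" for c :: "complex \<times> complex \<Rightarrow> complex"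
    using finite_rips_complex by (intro continuous_map_center) blast
  define A where "A = (winding_cochain ?Y (center fst) :: (_, 'k) cochain)"
  define B where "B = (winding_cochain ?Y (center snd) :: (_, 'k) cochain)"
  have AB: "A \<in> cocycles ?Y" "B \<in> cocycles ?Y"
    unfolding A_def B_def using nz by (auto intro!: winding_cocycle centers)
  have deg: "n \<noteq> 1 \<Longrightarrow> A n s = 0" "n \<noteq> 1 \<Longrightarrow> B n s = 0" for n s
    by (auto simp: A_def B_def winding_cochain_def)
  have pull: "?P A 1 s = of_int (turns (center fst) s)" "?P B 1 s = of_int (turns (center snd) s)"
    "n \<noteq> 1 \<Longrightarrow> ?P A n t = 0" "n \<noteq> 1 \<Longrightarrow> ?P B n t = 0" if "singular_simplex 1 ?X s" for s n t
  proof -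
    have "simplex_map 1 ?f s = s" by (rule simplex_map_id_gen[OF that]) simp
    moreover have "singular_simplex 1 ?Y (simplex_map 1 ?f s)" by (rule singular_simplex_simplex_map[OF that f])
    ultimately show "?P A 1 s = of_int (turns (center fst) s)" "?P B 1 s = of_int (turns (center snd) s)"
      using that by (simp_all add: cochain_pullback_def A_def B_def winding_cochain_def)
  qed (simp_all add: cochain_pullback_def deg)
  define one where "one = (\<lambda>(n :: nat) s. if n = 0 \<and> singular_simplex 0 ?X s then 1 else 0 :: 'k)"
  \<comment> \<open>The fold in the cup-length ends with the unit, so the second factor appears
    multiplied by \<open>one\<close>.\<close>
  define D where "D = cup_product ?X (?P B) one"
  define \<rho> where "\<rho> = cup_product ?X (?P A) D"
  have \<rho>: "\<rho> 2 s = of_int (turns (center fst) (front_face 1 s) * turns (center snd) (back_face 1 1 s))"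
    if s: "singular_simplex 2 ?X s" for s
  proof -
    have ff: "singular_simplex 1 ?X (front_face 1 s)" "singular_simplex 1 ?X (back_face 1 1 s)"
      using singular_simplex_front_face[OF s] singular_simplex_back_face[OF s] by auto
    let ?e = "back_face 1 1 s"
    have "front_face 1 ?e = ?e" by (simp add: front_face_def back_face_def)
    moreover have "singular_simplex 0 ?X (back_face 1 0 ?e)"
      using singular_simplex_back_face[OF ff(2)] by simp
    ultimately have "D 1 ?e = ?P B 1 ?e"
      using ff(2) pull(4)[OF ff(1)] by (simp add: D_def cup_product_def one_def)
    then show ?thesis
      using s pull[OF ff(1)] pull[OF ff(2)] by (simp add: \<rho>_def cup_product_def numeral_2_eq_2)
  qed
  define tri where "tri h k = restrict (\<lambda>x. j (cis (2 * pi * h x), cis (2 * pi * k x))) (standard_simplex 2)"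
    for h k :: "(nat \<Rightarrow> real) \<Rightarrow> real"
  have tri: "singular_simplex 2 ?X (tri h k)"
    if "continuous_map (powertop_real UNIV) euclideanreal h" "continuous_map (powertop_real UNIV) euclideanreal k" for h k
  proof -
    have "continuous_map (powertop_real UNIV) euclidean (\<lambda>x. cis (2 * pi * h x))"
      if "continuous_map (powertop_real UNIV) euclideanreal h" for h
    proof -
      have "continuous_map euclideanreal euclidean (\<lambda>r. cis (2 * pi * r))" by (auto intro!: continuous_intros)
      from continuous_map_compose[OF that this] show ?thesis by (simp add: o_def)
    qed
    then have "continuous_map (subtopology (powertop_real UNIV) (standard_simplex 2)) (prod_topology euclidean euclidean)
        (\<lambda>x. (cis (2 * pi * h x), cis (2 * pi * k x)))"
      using that unfolding continuous_map_paired by (intro conjI continuous_map_from_subtopology) blast+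
    then have "continuous_map (subtopology (powertop_real UNIV) (standard_simplex 2)) (top_of_set (?S \<times> ?S))
        (\<lambda>x. (cis (2 * pi * h x), cis (2 * pi * k x)))"
      by (auto simp: continuous_map_in_subtopology)
    from continuous_map_compose[OF this j]
    show ?thesis by (simp add: singular_simplex_def tri_def o_def)
  qed
  \<comment> \<open>The two triangles of the unit square cut along its diagonal: \<sigma> passes
    through (0,0), (1,0), (1,1) and \<tau> through (0,0), (0,1), (1,1).\<close>
  define \<sigma> where "\<sigma> = tri (\<lambda>x. x 1 + x 2) (\<lambda>x. x 2)"
  define \<tau> where "\<tau> = tri (\<lambda>x. x 2) (\<lambda>x. x 1 + x 2)"
  have proj: "continuous_map (powertop_real UNIV) euclideanreal (\<lambda>x. x i)" for i :: nat
    using continuous_map_product_projection[of i UNIV "\<lambda>_. euclideanreal"] by simp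
  have st: "singular_simplex 2 ?X \<sigma>" "singular_simplex 2 ?X \<tau>"
    unfolding \<sigma>_def \<tau>_def by (intro tri continuous_map_add proj)+
  define e1 where "e1 = restrict (\<lambda>x. j (cis (2 * pi * x 1), 1)) (standard_simplex 1)"
  define e2 where "e2 = restrict (\<lambda>x. j (1, cis (2 * pi * x 1))) (standard_simplex 1)"
  define e3 where "e3 = restrict (\<lambda>x. j (cis (2 * pi * x 1), cis (2 * pi * x 1))) (standard_simplex 1)"
  have D1: "x 0 + x 1 = 1" "x 2 = 0" if "x \<in> standard_simplex 1" for x
    using that by (auto simp: standard_simplex_def)
  have D1': "x 0 + x 1 = 1 \<and> x 2 = 0" if "x \<in> standard_simplex 1" for x
    using D1[OF that] by (intro conjI)
  have D2: "x \<in> standard_simplex 2" if "x \<in> standard_simplex 1" for x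
    using that standard_simplex_mono[of 1 2] by auto
  have cis1: "cis (2 * pi * (x 0 + x 1)) = 1" if "x \<in> standard_simplex 1" for x :: "nat \<Rightarrow> real"
    using D1(1)[OF that] by simp
  have sf_in: "simplical_face k x \<in> standard_simplex 2" if "k \<le> 2" "x \<in> standard_simplex 1"
    for k and x :: "nat \<Rightarrow> real"
    using simplical_face_in_standard_simplex[of 2 k x] that by simp
  have sf: "simplical_face 0 x 1 = x 0" "simplical_face 0 x 2 = x 1" "simplical_face 1 x 1 = 0"
    "simplical_face 1 x 2 = x 1" "simplical_face 2 x 1 = x 1" "simplical_face 2 x 2 = 0" for x :: "nat \<Rightarrow> real"
    by (simp_all add: simplical_face_def)
  have faces: "singular_face 2 0 \<sigma> = e2" "singular_face 2 1 \<sigma> = e3" "singular_face 2 2 \<sigma> = e1"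
    "singular_face 2 0 \<tau> = e1" "singular_face 2 1 \<tau> = e3" "singular_face 2 2 \<tau> = e2"
    using sf_in sf D1 cis1
    by (auto simp: singular_face_def \<sigma>_def \<tau>_def tri_def e1_def e2_def e3_def restrict_def fun_eq_iff)
  have front: "front_face 1 (tri h k) = restrict (\<lambda>x. j (cis (2 * pi * h x), cis (2 * pi * k x))) (standard_simplex 1)"
    for h k unfolding front_face_def tri_def by (rule restrict_ext) (simp only: restrict_apply'[OF D2])
  have shift: "(\<lambda>i. if i < 1 then 0 else x (i - 1)) \<in> standard_simplex 2" if "x \<in> standard_simplex 1"
    for x :: "nat \<Rightarrow> real"
    using back_shift_in_standard_simplex[OF _ that, of 1 2] by simp
  have backs: "back_face 1 1 (tri h k) = restrict (\<lambda>x. j (cis (2 * pi * h (\<lambda>i. if i < 1 then 0 else x (i - 1))),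
      cis (2 * pi * k (\<lambda>i. if i < 1 then 0 else x (i - 1))))) (standard_simplex 1)"
    for h k unfolding back_face_def tri_def by (rule restrict_ext) (simp only: restrict_apply'[OF shift])
  have ends: "front_face 1 \<sigma> = e1" "back_face 1 1 \<sigma> = e2" "front_face 1 \<tau> = e2" "back_face 1 1 \<tau> = e1"
    unfolding \<sigma>_def \<tau>_def front backs e1_def e2_def
    by (rule restrict_ext, drule D1', simp)+
  have S1: "(1 :: complex) \<in> ?S" "cis t \<in> ?S" for t by auto
  have e_val: "e1 (simplex_edge t) = j (cis (2 * pi * t), 1)" "e2 (simplex_edge t) = j (1, cis (2 * pi * t))"
    if "t \<in> {0..1}" for t
    using simplex_edge_in[OF that] by (simp_all add: e1_def e2_def) (simp_all add: simplex_edge_def)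
  have "m 1 \<noteq> 0" using m(3)[OF S1(1)] by auto
  then have "turns (center fst) e1 = 1" "turns (center snd) e2 = 1" "turns (center fst) e2 = 0" "turns (center snd) e1 = 0"
    using m(1)[OF S1(2) S1(1)] m(1)[OF S1(1) S1(2)]
    by (auto intro!: turns_circle[OF m(2,3)] turns_const[of "m 1"] simp: e_val)
  \<comment> \<open>Along \<sigma> the first center turns on the front edge and the second on the
    back edge; along \<tau> each is constant on the edge where it is tested.\<close>
  then have "\<rho> 2 \<sigma> = 1" "\<rho> 2 \<tau> = 0" using \<rho>[OF st(1)] \<rho>[OF st(2)] unfolding ends by simp_all
  then have not_cob: "\<rho> \<notin> coboundaries ?X"
    using coboundary_torus_faces[OF _ st] faces by (metis zero_neq_one)
  let ?H = "cohomology_map ?X ?f :: (_, 'k) cochain set \<Rightarrow> (_, 'k) cochain set"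
  let ?xs = "[?H (cohomology_class ?Y A), ?H (cohomology_class ?Y B)]"
  have grade: "\<forall>x\<in>set ?xs. \<exists>p>0. x \<in> ?H ` cohomology_grade ?Y p"
    using AB deg by (auto simp: cohomology_grade_eq intro!: exI[of _ 1])
  have xs: "?xs = map (cohomology_class ?X) [?P A, ?P B]"
    by (simp add: cohomology_map_class[OF f])
  have sub: "set [?P A, ?P B] \<subseteq> cocycles ?X"
    using cocycles_pullback[OF f AB(1)] cocycles_pullback[OF f AB(2)] by simp
  have "foldr (cup_product ?X) [?P A, ?P B] one = \<rho>" by (simp add: \<rho>_def D_def)
  then have prod: "foldr (rcoset_mult (cocycle_ring ?X) (coboundaries ?X)) ?xs (cohomology_class ?X one) =
      cohomology_class ?X \<rho>"
    using foldr_mult_cohomology_class(1)[OF sub] unfolding xs one_def by (simp only:)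
  have "foldr (rcoset_mult (cocycle_ring ?X) (coboundaries ?X)) ?xs (cohomology_class ?X one) \<noteq> coboundaries ?X"
    unfolding prod using not_cob cohomology_class_self[of \<rho> ?X] by metis
  then have "enat (length ?xs) \<le> cup_length_map K ?X ?Y ?f"
    unfolding cup_length_map_def graded_ring_length_def Let_def one_def
    using grade by (intro Sup_upper CollectI exI[of _ ?xs]) simp
  then show ?thesis
    by (simp add: persistent_cup_def rips_def numeral_eq_enat numeral_2_eq_2)
qed

section \<open>Erosion distance and Gromov-Hausdorff distance\<close>

text \<open>If the distance were below \<open>c\<close>, both \<open>w\<close> and \<open>w'\<close>
  would have partners in \<open>m1\<close> closer than \<open>c\<close>, and going through these
  would bound their distance strictly below \<open>D + 2 * c\<close>.\<close>

lemma gromov_hausdorff_dist_ge_diameter_gap: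
  assumes D: "\<And>x y. x \<in> mspace m1 \<Longrightarrow> y \<in> mspace m1 \<Longrightarrow> mdist m1 x y \<le> D"
    and w: "w \<in> mspace m2" "w' \<in> mspace m2" "D + 2 * c \<le> mdist m2 w w'"
  shows "ennreal c \<le> gromov_hausdorff_dist m1 m2"
  unfolding gromov_hausdorff_dist_def
proof (rule INF_greatest, clarify)
  fix Z :: "('a + 'b) metric" and f g
  assume f: "isometric_embedding m1 Z f" and g: "isometric_embedding m2 Z g"
  show "ennreal c \<le> hausdorff_dist Z (f ` mspace m1) (g ` mspace m2)"
  proof (rule ccontr)
    assume "\<not> ennreal c \<le> hausdorff_dist Z (f ` mspace m1) (g ` mspace m2)"
    then have less: "hausdorff_dist Z (f ` mspace m1) (g ` mspace m2) < ennreal c" by simp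
    have near: "\<exists>t\<in>mspace m1. mdist Z (f t) (g v) < c" if v: "v \<in> mspace m2" for v
    proof -
      have "(INF x\<in>f ` mspace m1. ennreal (mdist Z x (g v))) \<le>
          (SUP y\<in>g ` mspace m2. INF x\<in>f ` mspace m1. ennreal (mdist Z x y))"
        using v by (intro SUP_upper) auto
      also have "\<dots> \<le> hausdorff_dist Z (f ` mspace m1) (g ` mspace m2)"
        unfolding hausdorff_dist_def by (rule max.cobounded2)
      finally have "(INF x\<in>f ` mspace m1. ennreal (mdist Z x (g v))) < ennreal c" using less by simp
      then show ?thesis by (auto simp: INF_less_iff ennreal_less_iff)
    qed
    obtain t where t: "t \<in> mspace m1" "mdist Z (f t) (g w) < c" using near[OF w(1)] by blast
    obtain t' where t': "t' \<in> mspace m1" "mdist Z (f t') (g w') < c" using near[OF w(2)] by blast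
    have Z: "f t \<in> mspace Z" "f t' \<in> mspace Z" "g w \<in> mspace Z" "g w' \<in> mspace Z"
      using f g t(1) t'(1) w(1,2) by (auto simp: isometric_embedding_def)
    have "mdist m2 w w' = mdist Z (g w) (g w')" "mdist Z (f t) (f t') = mdist m1 t t'"
      using f g t(1) t'(1) w(1,2) by (auto simp: isometric_embedding_def)
    moreover have "mdist Z (g w) (g w') \<le> mdist Z (g w) (f t) + mdist Z (f t) (f t') + mdist Z (f t') (g w')"
      using mdist_triangle[OF Z(3) Z(1) Z(4)] mdist_triangle[OF Z(1) Z(2) Z(4)] by linarith
    ultimately show False
      using t(2) t'(2) D[OF t(1) t'(1)] w(3) mdist_commute[of Z "g w" "f t"] by linarith
  qed
qed

text \<open>Widening an interval by pi/3 at both ends adds 2 pi/3 to its length, which annihilates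
  both functions and gives the upper bound.\<close>

lemma erosion_dist_eq:
  assumes null: "\<And>a b. a + 2 * pi / 3 \<le> b \<Longrightarrow> J\<^sub>1 a b = 0" "\<And>a b. a + 2 * pi / 3 \<le> b \<Longrightarrow> J\<^sub>2 a b = 0"
    and big: "\<And>a b. 0 < a \<Longrightarrow> a \<le> b \<Longrightarrow> b < 2 * pi / 3 \<Longrightarrow> 2 \<le> J\<^sub>1 a b"
    and small: "\<And>a b. 0 < a \<Longrightarrow> a < b \<Longrightarrow> a < pi / 2 \<Longrightarrow> pi / 3 \<le> b \<Longrightarrow> J\<^sub>2 a b \<le> 1"
  shows "erosion_dist J\<^sub>1 J\<^sub>2 = ennreal (pi / 3)"
proof (rule antisym)
  have "J\<^sub>2 (a - pi / 3) (b + pi / 3) = 0" "J\<^sub>1 (a - pi / 3) (b + pi / 3) = 0" if "a \<le> b" for a b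
    using that by (intro null; simp)+
  then have "eroded (pi / 3) J\<^sub>1 J\<^sub>2" by (simp add: eroded_def)
  then show "erosion_dist J\<^sub>1 J\<^sub>2 \<le> ennreal (pi / 3)"
    unfolding erosion_dist_def by (intro Inf_lower) auto
  show "ennreal (pi / 3) \<le> erosion_dist J\<^sub>1 J\<^sub>2"
    unfolding erosion_dist_def
  proof (rule Inf_greatest, clarify)
    fix \<epsilon> :: real assume \<epsilon>: "0 \<le> \<epsilon>" "eroded \<epsilon> J\<^sub>1 J\<^sub>2"
    have "pi / 3 \<le> \<epsilon>"
    proof (rule ccontr)
      assume "\<not> pi / 3 \<le> \<epsilon>"
      \<comment> \<open>With this choice [a, b] is [pi/3 - d, pi/3 + d], and widening it by
        \<epsilon> gives [d, 2 pi/3 - d], still inside the range where \<open>J\<^sub>1\<close> is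
        at least 2.\<close>
      define d where "d = (pi / 3 - \<epsilon>) / 2"
      define a where "a = \<epsilon> + d"
      define b where "b = 2 * pi / 3 - \<epsilon> - d"
      have d: "0 < d" "d \<le> pi / 6" using \<epsilon>(1) \<open>\<not> pi / 3 \<le> \<epsilon>\<close> by (auto simp: d_def)
      have "\<epsilon> = pi / 3 - 2 * d" by (simp add: d_def field_simps)
      then have ab: "0 < a" "a < b" "a < pi / 2" "pi / 3 \<le> b"
        using d pi_gt_zero by (auto simp: a_def b_def)
      have "2 \<le> J\<^sub>1 (a - \<epsilon>) (b + \<epsilon>)"
        using d by (intro big) (auto simp: a_def b_def)
      also have "\<dots> \<le> J\<^sub>2 a b" using \<epsilon>(2) ab(2) by (simp add: eroded_def)
      also have "\<dots> \<le> 1" by (rule small[OF ab])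
      finally show False by (simp add: numeral_eq_enat one_enat_def)
    qed
    then show "ennreal (pi / 3) \<le> ennreal \<epsilon>" by (rule ennreal_leI)
  qed
qed

lemma persistent_cup_le_cat:
  "a \<le> b \<Longrightarrow> persistent_cup K (rips m) a b \<le> persistent_cat (rips m) a b"
  unfolding persistent_cup_def persistent_cat_def
  by (intro cup_length_map_le_cat_map continuous_map_rips)

theorem proposition3p7:
  fixes K :: "'k::field itself"
    and p r :: complex and q :: "real ^ 3"
  assumes "p \<in> sphere 0 1" and "q \<in> sphere 0 1" and "r \<in> sphere 0 1"
  shows "ennreal (pi / 3) =
           erosion_dist (persistent_cup K (rips torus2))
                        (persistent_cup K (rips (wedge_S1_S2_S1 p q r))) \<and>
         erosion_dist (persistent_cup K (rips torus2))
                      (persistent_cup K (rips (wedge_S1_S2_S1 p q r)))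
           \<le> 2 * gromov_hausdorff_dist torus2 (wedge_S1_S2_S1 p q r) \<and>
         ennreal (pi / 3) =
           erosion_dist (persistent_cat (rips torus2))
                        (persistent_cat (rips (wedge_S1_S2_S1 p q r))) \<and>
         erosion_dist (persistent_cat (rips torus2))
                      (persistent_cat (rips (wedge_S1_S2_S1 p q r)))
           \<le> 2 * gromov_hausdorff_dist torus2 (wedge_S1_S2_S1 p q r)"
proof -
  let ?W = "wedge_S1_S2_S1 p q r"
  let ?V = "wedge_metric sphere_metric p sphere_metric q"
  have n: "norm p = 1" "norm q = 1" "norm r = 1" using assms by auto
  have base: "(p, q) \<in> mspace ?V" using n by (simp add: mspace_wedge_metric)
  have spheres: "coarsely_retractable sphere_metric p" "coarsely_retractable sphere_metric q"
    "coarsely_retractable sphere_metric r"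
    using n by (intro coarsely_retractable_sphere; simp)+
  have "coarsely_retractable torus2 (p, p)"
    unfolding torus2_def by (intro coarsely_retractable_linf spheres)
  then have null_T: "persistent_cat (rips torus2) a b = 0" if "a + 2 * pi / 3 \<le> b" for a b
    using that n by (intro persistent_cat_coarsely_retractable) (auto simp: mspace_torus2)
  have "coarsely_retractable ?W ((p, q), r)"
    unfolding wedge_S1_S2_S1_def using n base
    by (intro coarsely_retractable_wedge spheres) auto
  moreover have "((p, q), r) \<in> mspace ?W"
    using n base by (simp add: wedge_S1_S2_S1_def mspace_wedge_metric)
  ultimately have null_W: "persistent_cat (rips ?W) a b = 0" if "a + 2 * pi / 3 \<le> b" for a b
    using that by (intro persistent_cat_coarsely_retractable)
  have ab_le: "a \<le> b" if "a + 2 * pi / 3 \<le> b" for a b using that pi_gt_zero by linarith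
  have cup_T: "2 \<le> persistent_cup K (rips torus2) a b" if "0 < a" "a \<le> b" "b < 2 * pi / 3" for a b
    by (rule persistent_cup_torus2[OF that])
  have cat_W: "persistent_cat (rips ?W) a b \<le> 1" if "0 < a" "a < b" "a < pi / 2" "pi / 3 \<le> b" for a b
  proof -
    have "bicontractible ?W a b ((p, q), r)"
      unfolding wedge_S1_S2_S1_def using n that
      by (intro bicontractible_wedge bicontractible_sphere) auto
    then show ?thesis using that by (intro persistent_cat_bicontractible) auto
  qed
  have cat: "erosion_dist (persistent_cat (rips torus2)) (persistent_cat (rips ?W)) = ennreal (pi / 3)"
  proof (rule erosion_dist_eq[OF null_T null_W _ cat_W])
    show "2 \<le> persistent_cat (rips torus2) a b" if "0 < a" "a \<le> b" "b < 2 * pi / 3" for a b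
      using cup_T[OF that] persistent_cup_le_cat[OF that(2), of K torus2] by (rule order_trans)
  qed
  have cup: "erosion_dist (persistent_cup K (rips torus2)) (persistent_cup K (rips ?W)) = ennreal (pi / 3)"
  proof (rule erosion_dist_eq[OF _ _ cup_T])
    show "persistent_cup K (rips torus2) a b = 0" if "a + 2 * pi / 3 \<le> b" for a b
      using persistent_cup_le_cat[OF ab_le[OF that], of K torus2] null_T[OF that] by simp
    show "persistent_cup K (rips ?W) a b = 0" if "a + 2 * pi / 3 \<le> b" for a b
      using persistent_cup_le_cat[OF ab_le[OF that], of K ?W] null_W[OF that] by simp
    show "persistent_cup K (rips ?W) a b \<le> 1" if "0 < a" "a < b" "a < pi / 2" "pi / 3 \<le> b" for a b
      using persistent_cup_le_cat[of a b K ?W] cat_W[OF that] that(2) by (meson less_imp_le order_trans)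
  qed
  have "ennreal (pi / 2) \<le> gromov_hausdorff_dist torus2 ?W"
  proof (rule gromov_hausdorff_dist_ge_diameter_gap)
    show "mdist torus2 u v \<le> pi" if "u \<in> mspace torus2" "v \<in> mspace torus2" for u v
      using that by (auto simp: mspace_torus2 mdist_torus2 intro!: mdist_sphere_le_pi)
    have far: "mdist sphere_metric v (- v) = pi" if "norm v = 1" for v :: complex
      using that by (simp add: mdist_sphere_metric dot_square_norm)
    have V: "(- p, q) \<in> mspace ?V" using n by (simp add: mspace_wedge_metric)
    \<comment> \<open>The antipodes of the base point in the two circles: each is at distance pi
      from it, hence at distance 2 pi from the other.\<close>
    then show in_W: "((- p, q), r) \<in> mspace ?W" "((p, q), - r) \<in> mspace ?W"
      using n base by (simp_all add: wedge_S1_S2_S1_def mspace_wedge_metric)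
    have "mdist ?W ((- p, q), r) ((p, q), - r) = mdist ?V (- p, q) (p, q) + mdist sphere_metric r (- r)"
      using mdist_wedge_metric[OF base, of r sphere_metric "((- p, q), r)" "((p, q), - r)"] in_W n
      by (simp add: wedge_S1_S2_S1_def)
    also have "mdist ?V (- p, q) (p, q) = mdist sphere_metric p (- p)"
      using mdist_wedge(1)[of p sphere_metric q sphere_metric "- p" p] n by (simp add: mdist_commute)
    finally show "pi + 2 * (pi / 2) \<le> mdist ?W ((- p, q), r) ((p, q), - r)"
      using far n by simp
  qed
  then have "2 * ennreal (pi / 2) \<le> 2 * gromov_hausdorff_dist torus2 ?W"
    by (intro mult_left_mono) auto
  moreover have "ennreal (pi / 3) \<le> 2 * ennreal (pi / 2)"
    by (simp add: ennreal_mult[symmetric] ennreal_leI flip: ennreal_numeral)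
  ultimately have "ennreal (pi / 3) \<le> 2 * gromov_hausdorff_dist torus2 ?W" by (rule order_trans[rotated])
  then show ?thesis using cat cup by simp
qed

end
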